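(* Let $(M,L)$ be a pseudo-Finsler manifold on $A$ with fundamental tensor $g$ and Levi-Civita–Chern connection $\nabla$. Let $\mathcal Q$ be a symmetric $A$-anisotropic tensor of type $(0,3)$ with $\mathcal Q_v(v,u,w)=0$ for all $v\in A$ and $u,w\in T_{\pi(v)}M$, and let $\hat\nabla$ be the torsion-free $A$-anisotropic connection satisfying $\hat\nabla g=\mathcal Q$. Then $\hat\nabla$ determines the same flag curvature, the same Jacobi operator and the same Jacobi equation as $\nabla$; that is, with $R,\hat R$ the curvature tensors and $D_\gamma,\hat D_\gamma$ the covariant derivatives along curves of $\nabla,\hat\nabla$: (1) $K_v(w)=\dfrac{g_v(\hat R_v(v,w)w,v)}{g_v(w,w)L(v)-g_v(v,w)^2}=\dfrac{g_v(R_v(v,w)w,v)}{g_v(w,w)L(v)-g_v(v,w)^2}$ for all $v\in A$, $w\in T_{\pi(v)}M$ for which the denominator is nonzero; (2) along every auto-parallel curve $\gamma$, $\hat R_{\dot\gamma}(\dot\gamma,U)\dot\gamma=R_{\dot\gamma}(\dot\gamma,U)\dot\gamma$ for every vector field $U$ along $\gamma$; (3) along every auto-parallel curve $\gamma$, the Jacobi equations $(\hat D^{\dot\gamma}_\gamma)^2J=\hat R_{\dot\gamma}(\dot\gamma,J)\dot\gamma$ and $(D^{\dot\gamma}_\gamma)^2J=R_{\dot\gamma}(\dot\gamma,J)\dot\gamma$, satisfied by the Jacobi fields of $\hat\nabla$ and $\nabla$ respectively, coincide. Moreover, the vertical derivative $\hat P$ of $\hat\nabla$ satisfies, as does that of $\nabla$,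 $\hat P_v(v,v,u)=0$ for all $v\in A$, $u\in T_{\pi(v)}M$, and it also satisfies $$g_v(\hat P_v(v,u,w),v)=0\qquad\text{for every } v\in A \text{ and } u,w\in T_{\pi(v)}M.$$
   Context: $M$ is a smooth manifold, $\pi:TM\to M$, and $A\subset TM\setminus\mathbf 0$ is an open conic subset ($\lambda v\in A$ for $v\in A$, $\lambda>0$) with $\pi(A)=M$. A pseudo-Finsler metric on $A$ is a smooth function $L:A\to\mathbb R$, positively homogeneous of degree two ($L(\lambda v)=\lambda^2L(v)$ for $\lambda>0$), whose fundamental tensor $g_v(u,w)=\frac12\frac{\partial^2}{\partial t\partial s}L(v+tu+sw)|_{t=s=0}$ is non-degenerate for each $v\in A$. $\mathcal F(\cdot)$ denotes smooth functions, $\mathfrak X(\cdot)$ smooth vector fields. $\mathfrak T^1_0(M,A)$ is the set of smooth maps $v\in A\mapsto\mathcal X_v\in T_{\pi(v)}M$; vector fields $X$ on $M$ are regarded as such maps via $v\mapsto X_{\pi(v)}$. An $A$-anisotropic tensor of type $(0,s)$ (resp. $(1,s)$) amounts to multilinear maps $T_v:(T_{\pi(v)}M)^s\to\mathbb R$ (resp. $\to T_{\pi(v)}M$) depending smoothly on $v\in A$; vertical derivative $(\partial^\nu T)_v(x_1,\ldots,x_s,z)=\frac{d}{dt}T_{v+tz}(x_1,\ldots,x_s)|_{t=0}$. A vector field $V$ on an open $\Omega\subset M$ is $A$-admissible if $V_p\in A$ for all $p\in\Omega$; it extends $v$ if $V_{\pi(v)}=v$; $(T_V)_p=T_{V_p}$.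 An $A$-anisotropic connection is a map $\nabla:A\times\mathfrak X(M)\times\mathfrak X(M)\to TM$, $(v,X,Y)\mapsto\nabla^v_XY\in T_{\pi(v)}M$, additive in $Y$, with $\nabla^v_X(fY)=X_{\pi(v)}(f)Y_{\pi(v)}+f(\pi(v))\nabla^v_XY$, $\nabla^v_{fX+hY}Z=f(\pi(v))\nabla^v_XZ+h(\pi(v))\nabla^v_YZ$ for $f,h\in\mathcal F(M)$, and with $\nabla_XY\in\mathfrak T^1_0(M,A)$. It is torsion-free if $\nabla^v_XY-\nabla^v_YX=[X,Y]_{\pi(v)}$. For any local $A$-admissible extension $V$ of $v$ (independently of $V$): $(\nabla_Xh)(v)=X_{\pi(v)}(h(V))-(\partial^\nu h)_v(\nabla^v_XV)$ for $h\in\mathcal F(A)$, $\nabla^v_X\mathcal Y=\nabla^v_X(\mathcal Y_V)-(\partial^\nu\mathcal Y)_v(\nabla^v_XV)$ for $\mathcal Y\in\mathfrak T^1_0(M,A)$, and $(\nabla_XT)(X_1,\ldots,X_s)=\nabla_X(T(X_1,\ldots,X_s))-\sum_jT(\ldots,\nabla_XX_j,\ldots)$; $(\nabla_XT)_v$ depends only on $X_{\pi(v)}$. $\hat\nabla g=\mathcal Q$ means $(\hat\nabla_ug)_v(w,z)=\mathcal Q_v(u,w,z)$. The Levi-Civita–Chern connection is the unique torsion-free $A$-anisotropic connection $\nabla$ with $\nabla g=0$. Vertical derivative of $\nabla$: $P_v(X,Y,Z)=\frac{\partial}{\partial t}(\nabla^{v+tZ}_XY)|_{t=0}$. Curvature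 tensor: $R_v(X,Y)Z=\nabla^v_X(\nabla_YZ)-\nabla^v_Y(\nabla_XZ)-\nabla^v_{[X,Y]}Z$. The flag curvature of $L$ is $K_v(w)=\frac{g_v(R_v(v,w)w,v)}{g_v(w,w)L(v)-g_v(v,w)^2}$ with $R$ the curvature tensor of the Levi-Civita–Chern connection. The covariant derivative along a curve $\gamma$ is $D^v_\gamma X=\big(\dot X^k(t_0)+\dot\gamma^i(t_0)X^j(t_0)\Gamma^k_{ij}(v)\big)\partial_k$ for $v\in A$, $\pi(v)=\gamma(t_0)$, $X$ a vector field along $\gamma$, with $\nabla^v_{\partial_i}\partial_j=\Gamma^k_{ij}(v)\partial_k$; $(D^V_\gamma X)(t)=D^{V(t)}_\gamma X$. A smooth curve $\gamma$ is auto-parallel if $\dot\gamma\in A$ and $D^{\dot\gamma}_\gamma\dot\gamma=0$ ($\nabla$ and $\hat\nabla$ have the same auto-parallel curves). A Jacobi field along an auto-parallel $\gamma$ is the variational field of a smooth variation of $\gamma$ by auto-parallel curves. The Jacobi (curvature) operator of $\gamma$ is $U\mapsto R_{\dot\gamma}(\dot\gamma,U)\dot\gamma$. *)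

theory Defs
  imports "HOL-Analysis.Analysis"
begin

section \<open>Smooth maps between open subsets of normed spaces\<close>

primrec Ck_on :: "nat \<Rightarrow> 'a::real_normed_vector set \<Rightarrow> ('a \<Rightarrow> 'b::real_normed_vector) \<Rightarrow> bool" where
  "Ck_on 0 S f \<longleftrightarrow> continuous_on S f"
| "Ck_on (Suc k) S f \<longleftrightarrow>
     (\<forall>x\<in>S. f differentiable (at x)) \<and>
     (\<forall>a. Ck_on k S (\<lambda>x. frechet_derivative f (at x) a))"

definition smooth_on :: "'a::real_normed_vector set \<Rightarrow> ('a \<Rightarrow> 'b::real_normed_vector) \<Rightarrow> bool" where
  "smooth_on S f \<longleftrightarrow> (\<forall>k. Ck_on k S f)"


section \<open>Smooth manifolds\<close>

text \<open>
  The manifold is the whole type \<open>'m\<close> (Hausdorff and second countable), modelled on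
  \<open>'e\<close>; its smooth structure is given by an atlas.  A chart is a pair of its domain
  and its coordinate map.
\<close>

type_synonym ('m, 'e) chart = "'m set \<times> ('m \<Rightarrow> 'e)"
type_synonym ('m, 'e) atlas = "('m, 'e) chart set"

definition chart_inv :: "('m, 'e) chart \<Rightarrow> 'e \<Rightarrow> 'm" where
  "chart_inv c = inv_into (fst c) (snd c)"

definition smooth_atlas ::
  "('m::{t2_space, second_countable_topology}, 'e::euclidean_space) atlas \<Rightarrow> bool" where
  "smooth_atlas \<A> \<longleftrightarrow>
     (\<Union>c\<in>\<A>. fst c) = UNIV \<and>
     (\<forall>c\<in>\<A>. open (fst c) \<and> open (snd c ` fst c) \<and> inj_on (snd c) (fst c) \<and>
        homeomorphism (fst c) (snd c ` fst c) (snd c) (chart_inv c)) \<and>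
     (\<forall>c\<in>\<A>. \<forall>d\<in>\<A>. smooth_on (snd c ` (fst c \<inter> fst d)) (snd d \<circ> chart_inv c))"

text \<open>
  Each tangent space is identified with \<open>'e\<close> by means of a preferred chart around the
  base point: \<open>(p, \<xi>)\<close> is the tangent vector at \<open>p\<close> whose components in
  \<open>chart_at \<A> p\<close> are \<open>\<xi>\<close>.  So \<open>TM\<close> is the type \<open>'m \<times> 'e\<close>, with \<open>\<pi> = fst\<close>.  Since the
  preferred chart jumps from point to point, the topology and the smooth structure of
  \<open>TM\<close> are not those of a product; they are defined below through the charts of the atlas.
\<close>

definition chart_at :: "('m, 'e) atlas \<Rightarrow> 'm \<Rightarrow> ('m, 'e) chart" where
  "chart_at \<A> p = (SOME c. c \<in> \<A> \<and> p \<in> fst c)"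

definition coord_change ::
  "('m, 'e::real_normed_vector) chart \<Rightarrow> ('m, 'e) chart \<Rightarrow> 'm \<Rightarrow> 'e \<Rightarrow> 'e" where
  "coord_change c d p = frechet_derivative (snd d \<circ> chart_inv c) (at (snd c p))"

text \<open>Components in the chart \<open>c\<close> of a tangent vector at \<open>p\<close>, and conversely.\<close>

definition to_chart ::
  "('m, 'e::real_normed_vector) atlas \<Rightarrow> ('m, 'e) chart \<Rightarrow> 'm \<Rightarrow> 'e \<Rightarrow> 'e" where
  "to_chart \<A> c p = coord_change (chart_at \<A> p) c p"

definition from_chart ::
  "('m, 'e::real_normed_vector) atlas \<Rightarrow> ('m, 'e) chart \<Rightarrow> 'm \<Rightarrow> 'e \<Rightarrow> 'e" where
  "from_chart \<A> c p = coord_change c (chart_at \<A> p) p"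

text \<open>The inverse of the chart of \<open>TM\<close> induced by \<open>c\<close>.\<close>

definition tchart_inv ::
  "('m, 'e::real_normed_vector) atlas \<Rightarrow> ('m, 'e) chart \<Rightarrow> 'e \<times> 'e \<Rightarrow> 'm \<times> 'e" where
  "tchart_inv \<A> c z = (chart_inv c (fst z), from_chart \<A> c (chart_inv c (fst z)) (snd z))"

definition smooth_fun :: "('m, 'e::euclidean_space) atlas \<Rightarrow> ('m \<Rightarrow> real) \<Rightarrow> bool" where
  "smooth_fun \<A> f \<longleftrightarrow> (\<forall>c\<in>\<A>. smooth_on (snd c ` fst c) (f \<circ> chart_inv c))"

definition vec_rep ::
  "('m, 'e::euclidean_space) atlas \<Rightarrow> ('m, 'e) chart \<Rightarrow> ('m \<Rightarrow> 'e) \<Rightarrow> 'e \<Rightarrow> 'e" where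
  "vec_rep \<A> c X x = to_chart \<A> c (chart_inv c x) (X (chart_inv c x))"

definition smooth_vf :: "('m, 'e::euclidean_space) atlas \<Rightarrow> ('m \<Rightarrow> 'e) \<Rightarrow> bool" where
  "smooth_vf \<A> X \<longleftrightarrow> (\<forall>c\<in>\<A>. smooth_on (snd c ` fst c) (vec_rep \<A> c X))"

text \<open>The derivative of a (locally defined) function \<open>f\<close> along the tangent vector \<open>(p, \<xi>)\<close>.\<close>

definition tderiv :: "('m, 'e::euclidean_space) atlas \<Rightarrow> 'm \<Rightarrow> 'e \<Rightarrow> ('m \<Rightarrow> real) \<Rightarrow> real" where
  "tderiv \<A> p \<xi> f =
     frechet_derivative (f \<circ> chart_inv (chart_at \<A> p)) (at (snd (chart_at \<A> p) p)) \<xi>"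

text \<open>\<open>[X, Y]\<^sup>k = X\<^sup>i \<partial>\<^sub>i Y\<^sup>k - Y\<^sup>i \<partial>\<^sub>i X\<^sup>k\<close>, in the preferred chart at the point.\<close>

definition lie_bracket ::
  "('m, 'e::euclidean_space) atlas \<Rightarrow> ('m \<Rightarrow> 'e) \<Rightarrow> ('m \<Rightarrow> 'e) \<Rightarrow> 'm \<Rightarrow> 'e" where
  "lie_bracket \<A> X Y p =
     (let c = chart_at \<A> p; x = snd c p in
        frechet_derivative (vec_rep \<A> c Y) (at x) (X p)
      - frechet_derivative (vec_rep \<A> c X) (at x) (Y p))"

text \<open>A global vector field with the germ at \<open>p\<close> of a vector field \<open>W\<close> defined near \<open>p\<close>.\<close>

definition germ_ext ::
  "('m::topological_space, 'e::euclidean_space) atlas \<Rightarrow> 'm \<Rightarrow> ('m \<Rightarrow> 'e) \<Rightarrow> 'm \<Rightarrow> 'e" where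
  "germ_ext \<A> p W = (SOME X. smooth_vf \<A> X \<and> (\<forall>\<^sub>F q in nhds p. X q = W q))"

text \<open>
  A global vector field extending the tangent vector \<open>(p, \<xi>)\<close>.  If \<open>(p, \<xi>) \<in> A\<close> with \<open>A\<close>
  open, every such field is \<open>A\<close>-admissible on a neighbourhood of \<open>p\<close>.
\<close>

definition vec_ext :: "('m, 'e::euclidean_space) atlas \<Rightarrow> 'm \<Rightarrow> 'e \<Rightarrow> 'm \<Rightarrow> 'e" where
  "vec_ext \<A> p \<xi> = (SOME X. smooth_vf \<A> X \<and> X p = \<xi>)"


section \<open>Anisotropic tensors and pseudo-Finsler metrics\<close>

definition vadd :: "'m \<times> 'e \<Rightarrow> 'e \<Rightarrow> 'm \<times> 'e::real_vector" where
  "vadd v z = (fst v, snd v + z)"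

text \<open>The representation of a subset of \<open>TM\<close> in the chart of \<open>TM\<close> induced by \<open>c\<close>.\<close>

definition tset_rep ::
  "('m, 'e::euclidean_space) atlas \<Rightarrow> ('m, 'e) chart \<Rightarrow> ('m \<times> 'e) set \<Rightarrow> ('e \<times> 'e) set" where
  "tset_rep \<A> c A = {z. fst z \<in> snd c ` fst c \<and> tchart_inv \<A> c z \<in> A}"

definition conic_domain ::
  "('m, 'e::euclidean_space) atlas \<Rightarrow> ('m \<times> 'e) set \<Rightarrow> bool" where
  "conic_domain \<A> A \<longleftrightarrow>
     (\<forall>c\<in>\<A>. open (tset_rep \<A> c A)) \<and>
     (\<forall>v\<in>A. snd v \<noteq> 0) \<and>
     (\<forall>v\<in>A. \<forall>r>0. (fst v, r *\<^sub>R snd v) \<in> A) \<and>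
     fst ` A = UNIV"

text \<open>\<open>\<F>(A)\<close> and \<open>\<TT>\<^sup>1\<^sub>0(M, A)\<close>.\<close>

definition aniso_fun ::
  "('m, 'e::euclidean_space) atlas \<Rightarrow> ('m \<times> 'e) set \<Rightarrow> ('m \<times> 'e \<Rightarrow> real) \<Rightarrow> bool" where
  "aniso_fun \<A> A h \<longleftrightarrow> (\<forall>c\<in>\<A>. smooth_on (tset_rep \<A> c A) (h \<circ> tchart_inv \<A> c))"

definition aniso_vf ::
  "('m, 'e::euclidean_space) atlas \<Rightarrow> ('m \<times> 'e) set \<Rightarrow> ('m \<times> 'e \<Rightarrow> 'e) \<Rightarrow> bool" where
  "aniso_vf \<A> A Y \<longleftrightarrow>
     (\<forall>c\<in>\<A>. smooth_on (tset_rep \<A> c A)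
        (\<lambda>z. to_chart \<A> c (chart_inv c (fst z)) (Y (tchart_inv \<A> c z))))"

definition aniso_tensor3 ::
  "('m, 'e::euclidean_space) atlas \<Rightarrow> ('m \<times> 'e) set \<Rightarrow>
     ('m \<times> 'e \<Rightarrow> 'e \<Rightarrow> 'e \<Rightarrow> 'e \<Rightarrow> real) \<Rightarrow> bool" where
  "aniso_tensor3 \<A> A T \<longleftrightarrow>
     (\<forall>v\<in>A. \<forall>x y. linear (\<lambda>u. T v u x y) \<and> linear (\<lambda>u. T v x u y) \<and> linear (\<lambda>u. T v x y u)) \<and>
     (\<forall>c\<in>\<A>. \<forall>a b d. smooth_on (tset_rep \<A> c A)
        (\<lambda>z. let p = chart_inv c (fst z) in
           T (tchart_inv \<A> c z) (from_chart \<A> c p a) (from_chart \<A> c p b) (from_chart \<A> c p d)))"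

definition symmetric_tensor3 ::
  "('m \<times> 'e) set \<Rightarrow> ('m \<times> 'e \<Rightarrow> 'e \<Rightarrow> 'e \<Rightarrow> 'e \<Rightarrow> real) \<Rightarrow> bool" where
  "symmetric_tensor3 A T \<longleftrightarrow>
     (\<forall>v\<in>A. \<forall>x y z. T v x y z = T v y x z \<and> T v x y z = T v x z y)"

definition vert_fun :: "('m \<times> 'e::real_vector \<Rightarrow> real) \<Rightarrow> 'm \<times> 'e \<Rightarrow> 'e \<Rightarrow> real" where
  "vert_fun h v z = deriv (\<lambda>t. h (vadd v (t *\<^sub>R z))) 0"

definition vert_vf :: "('m \<times> 'e::real_normed_vector \<Rightarrow> 'e) \<Rightarrow> 'm \<times> 'e \<Rightarrow> 'e \<Rightarrow> 'e" where
  "vert_vf Y v z = vector_derivative (\<lambda>t. Y (vadd v (t *\<^sub>R z))) (at 0)"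

definition fund_tensor :: "('m \<times> 'e::real_vector \<Rightarrow> real) \<Rightarrow> 'm \<times> 'e \<Rightarrow> 'e \<Rightarrow> 'e \<Rightarrow> real" where
  "fund_tensor L v u w =
     (1/2) * deriv (\<lambda>t. deriv (\<lambda>s. L (vadd v (t *\<^sub>R u + s *\<^sub>R w))) 0) 0"

definition pseudo_finsler ::
  "('m, 'e::euclidean_space) atlas \<Rightarrow> ('m \<times> 'e) set \<Rightarrow> ('m \<times> 'e \<Rightarrow> real) \<Rightarrow> bool" where
  "pseudo_finsler \<A> A L \<longleftrightarrow>
     aniso_fun \<A> A L \<and>
     (\<forall>v\<in>A. \<forall>r>0. L (fst v, r *\<^sub>R snd v) = r\<^sup>2 * L v) \<and>
     (\<forall>v\<in>A. \<forall>u. (\<forall>w. fund_tensor L v u w = 0) \<longrightarrow> u = 0)"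


section \<open>Anisotropic connections\<close>

text \<open>\<open>D v X Y\<close> is \<open>\<nabla>\<^sup>v\<^sub>X Y\<close>, a vector in the tangent space at \<open>fst v\<close>.\<close>

type_synonym ('m, 'e) conn = "'m \<times> 'e \<Rightarrow> ('m \<Rightarrow> 'e) \<Rightarrow> ('m \<Rightarrow> 'e) \<Rightarrow> 'e"

definition aniso_connection ::
  "('m, 'e::euclidean_space) atlas \<Rightarrow> ('m \<times> 'e) set \<Rightarrow> ('m, 'e) conn \<Rightarrow> bool" where
  "aniso_connection \<A> A D \<longleftrightarrow>
     (\<forall>v\<in>A. \<forall>X Y Z. smooth_vf \<A> X \<longrightarrow> smooth_vf \<A> Y \<longrightarrow> smooth_vf \<A> Z \<longrightarrow>
        D v X (\<lambda>q. Y q + Z q) = D v X Y + D v X Z) \<and>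
     (\<forall>v\<in>A. \<forall>X Y f. smooth_vf \<A> X \<longrightarrow> smooth_vf \<A> Y \<longrightarrow> smooth_fun \<A> f \<longrightarrow>
        D v X (\<lambda>q. f q *\<^sub>R Y q) =
          tderiv \<A> (fst v) (X (fst v)) f *\<^sub>R Y (fst v) + f (fst v) *\<^sub>R D v X Y) \<and>
     (\<forall>v\<in>A. \<forall>X Y Z f h. smooth_vf \<A> X \<longrightarrow> smooth_vf \<A> Y \<longrightarrow> smooth_vf \<A> Z \<longrightarrow>
        smooth_fun \<A> f \<longrightarrow> smooth_fun \<A> h \<longrightarrow>
        D v (\<lambda>q. f q *\<^sub>R X q + h q *\<^sub>R Y q) Z = f (fst v) *\<^sub>R D v X Z + h (fst v) *\<^sub>R D v Y Z) \<and>
     (\<forall>X Y. smooth_vf \<A> X \<longrightarrow> smooth_vf \<A> Y \<longrightarrow> aniso_vf \<A> A (\<lambda>v. D v X Y))"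

definition torsion_free ::
  "('m, 'e::euclidean_space) atlas \<Rightarrow> ('m \<times> 'e) set \<Rightarrow> ('m, 'e) conn \<Rightarrow> bool" where
  "torsion_free \<A> A D \<longleftrightarrow>
     (\<forall>v\<in>A. \<forall>X Y. smooth_vf \<A> X \<longrightarrow> smooth_vf \<A> Y \<longrightarrow>
        D v X Y - D v Y X = lie_bracket \<A> X Y (fst v))"

text \<open>
  Covariant derivatives of \<open>h \<in> \<F>(A)\<close> and of \<open>Y \<in> \<TT>\<^sup>1\<^sub>0(M, A)\<close>, by means of an extension
  \<open>V\<close> of \<open>v\<close>.  They do not depend on the choice of \<open>V\<close>.  As \<open>Y\<^sub>V\<close> is only defined where
  \<open>V\<close> is admissible, it is replaced by a global field with the same germ.
\<close>

definition cov_fun ::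
  "('m, 'e::euclidean_space) atlas \<Rightarrow> ('m, 'e) conn \<Rightarrow> ('m \<Rightarrow> 'e) \<Rightarrow>
     ('m \<times> 'e \<Rightarrow> real) \<Rightarrow> 'm \<times> 'e \<Rightarrow> real" where
  "cov_fun \<A> D X h v =
     (let p = fst v; V = vec_ext \<A> p (snd v) in
        tderiv \<A> p (X p) (\<lambda>q. h (q, V q)) - vert_fun h v (D v X V))"

definition cov_vf ::
  "('m::topological_space, 'e::euclidean_space) atlas \<Rightarrow> ('m, 'e) conn \<Rightarrow> ('m \<Rightarrow> 'e) \<Rightarrow>
     ('m \<times> 'e \<Rightarrow> 'e) \<Rightarrow> 'm \<times> 'e \<Rightarrow> 'e" where
  "cov_vf \<A> D X Y v =
     (let p = fst v; V = vec_ext \<A> p (snd v) in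
        D v X (germ_ext \<A> p (\<lambda>q. Y (q, V q))) - vert_vf Y v (D v X V))"

text \<open>\<open>(\<nabla>\<^sub>u T)\<^sub>v(w, z)\<close> for an anisotropic tensor \<open>T\<close> of type \<open>(0, 2)\<close>.\<close>

definition cov_tensor2 ::
  "('m, 'e::euclidean_space) atlas \<Rightarrow> ('m, 'e) conn \<Rightarrow> ('m \<times> 'e \<Rightarrow> 'e \<Rightarrow> 'e \<Rightarrow> real) \<Rightarrow>
     'm \<times> 'e \<Rightarrow> 'e \<Rightarrow> 'e \<Rightarrow> 'e \<Rightarrow> real" where
  "cov_tensor2 \<A> D T v u w z =
     (let p = fst v; X = vec_ext \<A> p u; W = vec_ext \<A> p w; Z = vec_ext \<A> p z in
        cov_fun \<A> D X (\<lambda>v'. T v' (W (fst v')) (Z (fst v'))) v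
      - T v (D v X W) z - T v w (D v X Z))"

definition levi_civita_chern ::
  "('m, 'e::euclidean_space) atlas \<Rightarrow> ('m \<times> 'e) set \<Rightarrow> ('m \<times> 'e \<Rightarrow> real) \<Rightarrow>
     ('m, 'e) conn \<Rightarrow> bool" where
  "levi_civita_chern \<A> A L D \<longleftrightarrow>
     aniso_connection \<A> A D \<and> torsion_free \<A> A D \<and>
     (\<forall>v\<in>A. \<forall>u w z. cov_tensor2 \<A> D (fund_tensor L) v u w z = 0)"

text \<open>\<open>P\<^sub>v(x, y, z)\<close> and \<open>R\<^sub>v(x, y)z\<close>, both tensorial in \<open>x, y, z\<close>.\<close>

definition vert_conn ::
  "('m, 'e::euclidean_space) atlas \<Rightarrow> ('m, 'e) conn \<Rightarrow> 'm \<times> 'e \<Rightarrow> 'e \<Rightarrow> 'e \<Rightarrow> 'e \<Rightarrow> 'e" where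
  "vert_conn \<A> D v x y z =
     (let X = vec_ext \<A> (fst v) x; Y = vec_ext \<A> (fst v) y in
        vector_derivative (\<lambda>t. D (vadd v (t *\<^sub>R z)) X Y) (at 0))"

definition curvature ::
  "('m::topological_space, 'e::euclidean_space) atlas \<Rightarrow> ('m, 'e) conn \<Rightarrow>
     'm \<times> 'e \<Rightarrow> 'e \<Rightarrow> 'e \<Rightarrow> 'e \<Rightarrow> 'e" where
  "curvature \<A> D v x y z =
     (let X = vec_ext \<A> (fst v) x; Y = vec_ext \<A> (fst v) y; Z = vec_ext \<A> (fst v) z in
        cov_vf \<A> D X (\<lambda>v'. D v' Y Z) v - cov_vf \<A> D Y (\<lambda>v'. D v' X Z) v
      - D v (lie_bracket \<A> X Y) Z)"

definition flag_denom :: "('m \<times> 'e::real_vector \<Rightarrow> real) \<Rightarrow> 'm \<times> 'e \<Rightarrow> 'e \<Rightarrow> real" where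
  "flag_denom L v w = fund_tensor L v w w * L v - (fund_tensor L v (snd v) w)\<^sup>2"

definition flag_quotient ::
  "('m::topological_space, 'e::euclidean_space) atlas \<Rightarrow> ('m \<times> 'e \<Rightarrow> real) \<Rightarrow> ('m, 'e) conn \<Rightarrow>
     'm \<times> 'e \<Rightarrow> 'e \<Rightarrow> real" where
  "flag_quotient \<A> L D v w =
     fund_tensor L v (curvature \<A> D v (snd v) w w) (snd v) / flag_denom L v w"

text \<open>
  The connection is unique only as a map on \<open>A \<times> \<XX>(M) \<times> \<XX>(M)\<close>; outside this set a function
  of type \<open>conn\<close> is arbitrary, hence \<open>SOME\<close> rather than \<open>THE\<close>.
\<close>

definition flag_curvature ::
  "('m::topological_space, 'e::euclidean_space) atlas \<Rightarrow> ('m \<times> 'e) set \<Rightarrow>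
     ('m \<times> 'e \<Rightarrow> real) \<Rightarrow> 'm \<times> 'e \<Rightarrow> 'e \<Rightarrow> real" where
  "flag_curvature \<A> A L = flag_quotient \<A> L (SOME D. levi_civita_chern \<A> A L D)"


section \<open>Curves, auto-parallel curves and Jacobi fields\<close>

definition smooth_into ::
  "('m::topological_space, 'e::euclidean_space) atlas \<Rightarrow> 'a::real_normed_vector set \<Rightarrow>
     ('a \<Rightarrow> 'm) \<Rightarrow> bool" where
  "smooth_into \<A> S f \<longleftrightarrow>
     continuous_on S f \<and> (\<forall>c\<in>\<A>. smooth_on {x\<in>S. f x \<in> fst c} (snd c \<circ> f))"

definition velocity ::
  "('m, 'e::euclidean_space) atlas \<Rightarrow> (real \<Rightarrow> 'm) \<Rightarrow> real \<Rightarrow> 'e" where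
  "velocity \<A> \<gamma> t = vector_derivative (snd (chart_at \<A> (\<gamma> t)) \<circ> \<gamma>) (at t)"

definition smooth_along ::
  "('m, 'e::euclidean_space) atlas \<Rightarrow> real set \<Rightarrow> (real \<Rightarrow> 'm) \<Rightarrow> (real \<Rightarrow> 'e) \<Rightarrow> bool" where
  "smooth_along \<A> I \<gamma> U \<longleftrightarrow>
     (\<forall>c\<in>\<A>. smooth_on {t\<in>I. \<gamma> t \<in> fst c} (\<lambda>t. to_chart \<A> c (\<gamma> t) (U t)))"

text \<open>
  \<open>\<nabla>\<^sup>v\<^bsub>\<partial>a\<^esub> \<partial>b\<close> for the coordinate fields \<open>\<partial>a, \<partial>b\<close> of the preferred chart at
  \<open>fst v\<close> and \<open>a, b \<in> Basis\<close>; its inner product with \<open>k \<in> Basis\<close> is the Christoffel symbol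
  \<open>\<Gamma>\<^sup>k\<^bsub>ab\<^esub>(v)\<close>.
\<close>

definition coord_field ::
  "('m, 'e::euclidean_space) atlas \<Rightarrow> 'm \<Rightarrow> 'e \<Rightarrow> 'm \<Rightarrow> 'e" where
  "coord_field \<A> p a q = from_chart \<A> (chart_at \<A> p) q a"

definition christoffel ::
  "('m::topological_space, 'e::euclidean_space) atlas \<Rightarrow> ('m, 'e) conn \<Rightarrow>
     'm \<times> 'e \<Rightarrow> 'e \<Rightarrow> 'e \<Rightarrow> 'e" where
  "christoffel \<A> D v a b =
     (let p = fst v in
        D v (germ_ext \<A> p (coord_field \<A> p a)) (germ_ext \<A> p (coord_field \<A> p b)))"

text \<open>\<open>(D\<^sup>V\<^sub>\<gamma> X)(t)\<close>, computed in the preferred chart at \<open>\<gamma> t\<close>.\<close>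

definition cov_along ::
  "('m::topological_space, 'e::euclidean_space) atlas \<Rightarrow> ('m, 'e) conn \<Rightarrow> (real \<Rightarrow> 'm) \<Rightarrow>
     (real \<Rightarrow> 'e) \<Rightarrow> (real \<Rightarrow> 'e) \<Rightarrow> real \<Rightarrow> 'e" where
  "cov_along \<A> D \<gamma> V X t =
     vector_derivative (\<lambda>s. to_chart \<A> (chart_at \<A> (\<gamma> t)) (\<gamma> s) (X s)) (at t)
     + (\<Sum>i\<in>Basis. \<Sum>j\<in>Basis.
          ((velocity \<A> \<gamma> t \<bullet> i) * (X t \<bullet> j)) *\<^sub>R christoffel \<A> D (\<gamma> t, V t) i j)"

definition auto_parallel ::
  "('m::topological_space, 'e::euclidean_space) atlas \<Rightarrow> ('m \<times> 'e) set \<Rightarrow> ('m, 'e) conn \<Rightarrow>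
     real set \<Rightarrow> (real \<Rightarrow> 'm) \<Rightarrow> bool" where
  "auto_parallel \<A> A D I \<gamma> \<longleftrightarrow>
     open I \<and> is_interval I \<and> smooth_into \<A> I \<gamma> \<and>
     (\<forall>t\<in>I. (\<gamma> t, velocity \<A> \<gamma> t) \<in> A \<and>
        cov_along \<A> D \<gamma> (velocity \<A> \<gamma>) (velocity \<A> \<gamma>) t = 0)"

definition jacobi_field ::
  "('m::topological_space, 'e::euclidean_space) atlas \<Rightarrow> ('m \<times> 'e) set \<Rightarrow> ('m, 'e) conn \<Rightarrow>
     real set \<Rightarrow> (real \<Rightarrow> 'm) \<Rightarrow> (real \<Rightarrow> 'e) \<Rightarrow> bool" where
  "jacobi_field \<A> A D I \<gamma> J \<longleftrightarrow>
     (\<exists>\<epsilon>>0. \<exists>\<sigma> :: real \<times> real \<Rightarrow> 'm.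
        smooth_into \<A> ({-\<epsilon><..<\<epsilon>} \<times> I) \<sigma> \<and>
        (\<forall>t\<in>I. \<sigma> (0, t) = \<gamma> t) \<and>
        (\<forall>s\<in>{-\<epsilon><..<\<epsilon>}. auto_parallel \<A> A D I (\<lambda>t. \<sigma> (s, t))) \<and>
        (\<forall>t\<in>I. J t = velocity \<A> (\<lambda>s. \<sigma> (s, t)) 0))"

definition jacobi_operator ::
  "('m::topological_space, 'e::euclidean_space) atlas \<Rightarrow> ('m, 'e) conn \<Rightarrow> (real \<Rightarrow> 'm) \<Rightarrow>
     (real \<Rightarrow> 'e) \<Rightarrow> real \<Rightarrow> 'e" where
  "jacobi_operator \<A> D \<gamma> U t =
     curvature \<A> D (\<gamma> t, velocity \<A> \<gamma> t) (velocity \<A> \<gamma> t) (U t) (velocity \<A> \<gamma> t)"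

definition cov_along2 ::
  "('m::topological_space, 'e::euclidean_space) atlas \<Rightarrow> ('m, 'e) conn \<Rightarrow> (real \<Rightarrow> 'm) \<Rightarrow>
     (real \<Rightarrow> 'e) \<Rightarrow> real \<Rightarrow> 'e" where
  "cov_along2 \<A> D \<gamma> J =
     cov_along \<A> D \<gamma> (velocity \<A> \<gamma>) (cov_along \<A> D \<gamma> (velocity \<A> \<gamma>) J)"

definition jacobi_equation ::
  "('m::topological_space, 'e::euclidean_space) atlas \<Rightarrow> ('m, 'e) conn \<Rightarrow> real set \<Rightarrow>
     (real \<Rightarrow> 'm) \<Rightarrow> (real \<Rightarrow> 'e) \<Rightarrow> bool" where
  "jacobi_equation \<A> D I \<gamma> J \<longleftrightarrow>
     (\<forall>t\<in>I. cov_along2 \<A> D \<gamma> J t = jacobi_operator \<A> D \<gamma> J t)"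

end

theory Submission
  imports Defs
begin

text \<open>
  Write \<open>y\<close> for the fibre coordinate and \<open>\<Gamma>\<close>, \<open>\<Gamma>'\<close> for the Christoffel symbols of two torsion-free
  connections whose derivatives of \<open>g\<close> vanish when an argument is \<open>y\<close>.  Everything follows from
  properties of \<open>H = \<Gamma>' - \<Gamma>\<close>: the two metric equations show that \<open>H(y, \<cdot>)\<close> is both symmetric and
  antisymmetric with respect to \<open>g\<close>, so that \<open>H(y, \<cdot>) = 0\<close> and \<open>g(H(\<cdot>, \<cdot>), y) = 0\<close>.  Differentiating
  these two identities in the directions that enter the curvature gives the equality of the Jacobi
  operators and of the flag curvatures.  The identities for the vertical derivative come from
  differentiating along the fibre the equations \<open>\<partial>\<^sub>u L = 2 g(\<Gamma>(u, y), y)\<close> and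
  \<open>g(w, \<Gamma>(y, y)) = (\<partial>\<^sub>y g)(w, y) - \<partial>\<^sub>w L / 2\<close>, where \<open>L = g(y, y)\<close> and the derivatives are taken
  along the base.
\<close>

section \<open>Calculus of smooth maps\<close>

text \<open>A connection acts on global vector fields only, and vectors and germs are extended by
  arbitrary choices. Cut-off functions therefore have to show first that \<open>D v X Y\<close>
  depends on germs alone. Expansion in coordinate frames then yields \<open>D_formula\<close>, and
  in each covariant derivative the derivative of the chosen extension of \<open>v\<close> cancels,
  leaving a derivative along the horizontal lift (u, -\<Gamma>(u, y)).

  Tensorial quantities are compared in the preferred chart at the point in question, where
  components are the vectors themselves. The Jacobi equation differentiates twice along the curve
  and needs one chart for an interval of times, hence the transformation law of the Christoffel
  symbols.

  The Jacobi operator has y in the last slot of the curvature, the numerator of the flag curvature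
  has w there. The two equalities are therefore separate: the first holds for the curvature vectors,
  the second is obtained only after pairing with y.\<close>

abbreviation fd :: "('a::real_normed_vector \<Rightarrow> 'b::real_normed_vector) \<Rightarrow> 'a \<Rightarrow> 'a \<Rightarrow> 'b" where
  "fd f x \<equiv> frechet_derivative f (at x)"

lemma fd_eq: "(f has_derivative f') (at x) \<Longrightarrow> fd f x = f'"
  using frechet_derivative_at by metis

lemma fd_works: "f differentiable (at x) \<Longrightarrow> (f has_derivative fd f x) (at x)"
  using frechet_derivative_works by blast

text \<open>No differentiability is assumed: \<open>frechet_derivative\<close> chooses among the
  derivatives at \<open>x\<close>, and both functions have the same ones, so the choices
  coincide.\<close>

lemma fd_cong_open:
  assumes "open S" "x \<in> S" "\<And>y. y \<in> S \<Longrightarrow> f y = g y"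
  shows "fd f x = fd g x"
proof -
  have "(f has_derivative D) (at x) \<longleftrightarrow> (g has_derivative D) (at x)" for D
    using assms has_derivative_transform_within_open[of f D x UNIV S g]
      has_derivative_transform_within_open[of g D x UNIV S f] by auto
  then show ?thesis
    unfolding frechet_derivative_def by presburger
qed

lemma differentiable_cong_open:
  assumes "open S" "x \<in> S" "\<And>y. y \<in> S \<Longrightarrow> f y = g y" "f differentiable (at x)"
  shows "g differentiable (at x)"
  using assms has_derivative_transform_within_open[of f _ x UNIV S g]
  unfolding differentiable_def by blast

lemma Ck_on_SucI:
  "(\<And>x. x \<in> S \<Longrightarrow> f differentiable (at x)) \<Longrightarrow> (\<And>a. Ck_on k S (\<lambda>x. fd f x a)) \<Longrightarrow> Ck_on (Suc k) S f"
  by simp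

lemma Ck_on_Suc_differentiable: "Ck_on (Suc k) S f \<Longrightarrow> x \<in> S \<Longrightarrow> f differentiable (at x)"
  by simp

lemma Ck_on_Suc_fd: "Ck_on (Suc k) S f \<Longrightarrow> Ck_on k S (\<lambda>x. fd f x a)"
  by simp

lemma Ck_on_SucD: "Ck_on (Suc k) S f \<Longrightarrow> Ck_on k S f"
proof (induction k arbitrary: f)
  case 0
  then show ?case
    by (auto intro!: continuous_at_imp_continuous_on differentiable_imp_continuous_within)
next
  case (Suc k)
  have a: "\<forall>x\<in>S. f differentiable (at x)" and b: "\<And>a. Ck_on (Suc k) S (\<lambda>x. fd f x a)"
    using Ck_on_Suc_differentiable[OF Suc.prems] Ck_on_Suc_fd[OF Suc.prems] by blast+
  show ?case
    by (rule Ck_on_SucI) (use a Suc.IH b in blast)+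
qed

lemma Ck_on_cong:
  assumes "open S" "\<And>x. x \<in> S \<Longrightarrow> f x = g x" "Ck_on k S f"
  shows "Ck_on k S g"
  using assms(2,3)
proof (induction k arbitrary: f g)
  case 0
  then show ?case by (metis Ck_on.simps(1) continuous_on_cong)
next
  case (Suc k)
  show ?case
  proof (rule Ck_on_SucI)
    show "g differentiable (at x)" if "x \<in> S" for x
      using differentiable_cong_open[OF assms(1) that, of f g] Suc.prems(1)
        Ck_on_Suc_differentiable[OF Suc.prems(2) that] by blast
    show "Ck_on k S (\<lambda>x. fd g x a)" for a
    proof (rule Suc.IH)
      show "fd f x a = fd g x a" if "x \<in> S" for x
        using fd_cong_open[OF assms(1) that Suc.prems(1)] by simp
      show "Ck_on k S (\<lambda>x. fd f x a)"
        using Suc.prems(2) by (rule Ck_on_Suc_fd)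
    qed
  qed
qed

lemma Ck_on_subset: "Ck_on k S f \<Longrightarrow> T \<subseteq> S \<Longrightarrow> Ck_on k T f"
  by (induction k arbitrary: f) (auto intro: continuous_on_subset)

lemma Ck_on_local:
  assumes "\<And>x. x \<in> S \<Longrightarrow> \<exists>T. open T \<and> x \<in> T \<and> Ck_on k T f"
  shows "Ck_on k S f"
  using assms
proof (induction k arbitrary: f)
  case 0
  then show ?case
    by (auto intro!: continuous_at_imp_continuous_on) (meson continuous_on_eq_continuous_at)
next
  case (Suc k)
  show ?case
  proof (rule Ck_on_SucI)
    show "f differentiable (at x)" if "x \<in> S" for x
      using Suc.prems[OF that] Ck_on_Suc_differentiable by blast
    show "Ck_on k S (\<lambda>x. fd f x a)" for a
    proof (rule Suc.IH)
      fix x assume "x \<in> S"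
      then show "\<exists>T. open T \<and> x \<in> T \<and> Ck_on k T (\<lambda>x. fd f x a)"
        using Suc.prems Ck_on_Suc_fd[of k _ f a] by metis
    qed
  qed
qed

lemma Ck_on_const: "Ck_on k S (\<lambda>x. c)"
  by (induction k arbitrary: c) auto

lemma Ck_on_bounded_linear:
  assumes "bounded_linear h" "Ck_on k S f" "open S"
  shows "Ck_on k S (\<lambda>x. h (f x))"
  using assms(2)
proof (induction k arbitrary: f)
  case 0
  then show ?case
    using assms(1) by (auto intro: bounded_linear.continuous_on)
next
  case (Suc k)
  have d: "((\<lambda>x. h (f x)) has_derivative (\<lambda>a. h (fd f x a))) (at x)" if "x \<in> S" for x
    using bounded_linear.has_derivative[OF assms(1) fd_works] Suc.prems that by auto
  have "Ck_on k S (\<lambda>x. fd (\<lambda>x. h (f x)) x a)" for a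
    by (rule Ck_on_cong[OF assms(3), of "\<lambda>x. h (fd f x a)"])
      (use Suc in \<open>auto simp: fd_eq[OF d]\<close>)
  then show ?case using d by (auto simp: differentiable_def)
qed

lemma Ck_on_add:
  assumes "open S" "Ck_on k S f" "Ck_on k S g"
  shows "Ck_on k S (\<lambda>x. f x + g x)"
  using assms(2,3)
proof (induction k arbitrary: f g)
  case 0
  then show ?case by (auto intro: continuous_on_add)
next
  case (Suc k)
  have d: "((\<lambda>x. f x + g x) has_derivative (\<lambda>a. fd f x a + fd g x a)) (at x)" if "x \<in> S" for x
    using Suc.prems that by (intro has_derivative_add fd_works) auto
  have "Ck_on k S (\<lambda>x. fd (\<lambda>x. f x + g x) x a)" for a
    by (rule Ck_on_cong[OF assms(1), of "\<lambda>x. fd f x a + fd g x a"])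
      (use Suc in \<open>auto simp: fd_eq[OF d]\<close>)
  then show ?case using d by (auto simp: differentiable_def)
qed

lemma Ck_on_sum:
  assumes "open S" "\<And>i. i \<in> B \<Longrightarrow> Ck_on k S (f i)"
  shows "Ck_on k S (\<lambda>x. \<Sum>i\<in>B. f i x)"
  using assms(2)
  by (induction B rule: infinite_finite_induct) (auto intro: Ck_on_const Ck_on_add[OF assms(1)])

lemma Ck_on_bilinear:
  assumes "bounded_bilinear h" "open S" "Ck_on k S f" "Ck_on k S g"
  shows "Ck_on k S (\<lambda>x. h (f x) (g x))"
  using assms(3,4)
proof (induction k arbitrary: f g)
  case 0
  then show ?case using assms(1) by (auto intro: bounded_bilinear.continuous_on)
next
  case (Suc k)
  have d: "((\<lambda>x. h (f x) (g x)) has_derivative (\<lambda>a. h (f x) (fd g x a) + h (fd f x a) (g x))) (at x)"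
    if "x \<in> S" for x
    using Suc.prems that by (intro bounded_bilinear.FDERIV[OF assms(1)] fd_works) auto
  have "Ck_on k S (\<lambda>x. fd (\<lambda>x. h (f x) (g x)) x a)" for a
    by (rule Ck_on_cong[OF assms(2), of "\<lambda>x. h (f x) (fd g x a) + h (fd f x a) (g x)"])
      (simp_all add: fd_eq[OF d] Ck_on_add[OF assms(2)] Suc.IH Ck_on_SucD[OF Suc.prems(1)]
        Ck_on_SucD[OF Suc.prems(2)] Ck_on_Suc_fd[OF Suc.prems(1)] Ck_on_Suc_fd[OF Suc.prems(2)])
  then show ?case using d by (auto simp: differentiable_def)
qed

text \<open>\<open>Ck_on\<close> controls derivatives in fixed directions, whereas the chain rule
  differentiates \<open>f\<close> in the moving direction \<open>fd g x a\<close>. Expanding that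
  direction in the basis of the intermediate Euclidean space restores fixed directions, so that the
  induction hypothesis applies.\<close>

lemma Ck_on_compose:
  fixes g :: "'a::real_normed_vector \<Rightarrow> 'b::euclidean_space" and f :: "'b \<Rightarrow> 'c::real_normed_vector"
  assumes "open S" "g ` S \<subseteq> T" "Ck_on k S g" "Ck_on k T f"
  shows "Ck_on k S (\<lambda>x. f (g x))"
  using assms(3,4)
proof (induction k arbitrary: f)
  case 0
  then show ?case using assms(2) by (auto intro: continuous_on_compose2)
next
  case (Suc k)
  have dg: "(g has_derivative fd g x) (at x)" and df: "(f has_derivative fd f (g x)) (at (g x))"
    if "x \<in> S" for x
    using Suc.prems that assms(2) by (auto intro!: fd_works)
  have d: "((\<lambda>x. f (g x)) has_derivative (\<lambda>a. fd f (g x) (fd g x a))) (at x)" if "x \<in> S" for x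
    using has_derivative_compose[OF dg[OF that] df[OF that]] .
  have e: "fd f (g x) (fd g x a) = (\<Sum>i\<in>Basis. (fd g x a \<bullet> i) *\<^sub>R fd f (g x) i)" if "x \<in> S" for x a
  proof -
    interpret linear "fd f (g x)" using df[OF that] has_derivative_linear by blast
    show ?thesis
      by (subst (1) euclidean_representation[of "fd g x a", symmetric]) (simp add: sum scaleR)
  qed
  have "Ck_on k S (\<lambda>x. fd (\<lambda>x. f (g x)) x a)" for a
  proof (rule Ck_on_cong[OF assms(1), of "\<lambda>x. \<Sum>i\<in>Basis. (fd g x a \<bullet> i) *\<^sub>R fd f (g x) i"])
    show "Ck_on k S (\<lambda>x. \<Sum>i\<in>Basis. (fd g x a \<bullet> i) *\<^sub>R fd f (g x) i)"
      by (intro Ck_on_sum Ck_on_bilinear[OF bounded_bilinear_scaleR] assms(1)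
          Ck_on_bounded_linear[OF bounded_linear_inner_left] Suc.IH Ck_on_SucD[OF Suc.prems(1)]
          Ck_on_Suc_fd[OF Suc.prems(1)] Ck_on_Suc_fd[OF Suc.prems(2)])
  qed (simp add: fd_eq[OF d] e)
  then show ?case using d by (auto simp: differentiable_def)
qed

lemma smooth_on_continuous_on: "smooth_on S f \<Longrightarrow> continuous_on S f"
  unfolding smooth_on_def by (auto dest: spec[of _ 0])

lemma smooth_on_differentiable: "smooth_on S f \<Longrightarrow> x \<in> S \<Longrightarrow> f differentiable (at x)"
  unfolding smooth_on_def using Ck_on_Suc_differentiable by blast

lemma smooth_on_has_derivative: "smooth_on S f \<Longrightarrow> x \<in> S \<Longrightarrow> (f has_derivative fd f x) (at x)"
  by (simp add: fd_works smooth_on_differentiable)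

lemma smooth_on_linear_fd: "smooth_on S f \<Longrightarrow> x \<in> S \<Longrightarrow> linear (fd f x)"
  using smooth_on_has_derivative has_derivative_linear by blast

lemma smooth_on_fd: "smooth_on S f \<Longrightarrow> smooth_on S (\<lambda>x. fd f x a)"
  unfolding smooth_on_def using Ck_on_Suc_fd by blast

lemma smooth_on_cong:
  "open S \<Longrightarrow> (\<And>x. x \<in> S \<Longrightarrow> f x = g x) \<Longrightarrow> smooth_on S f \<longleftrightarrow> smooth_on S g"
  unfolding smooth_on_def using Ck_on_cong by metis

lemma smooth_on_subset: "smooth_on S f \<Longrightarrow> T \<subseteq> S \<Longrightarrow> smooth_on T f"
  unfolding smooth_on_def using Ck_on_subset by blast

lemma smooth_on_local:
  "(\<And>x. x \<in> S \<Longrightarrow> \<exists>T. open T \<and> x \<in> T \<and> smooth_on T f) \<Longrightarrow> smooth_on S f"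
  unfolding smooth_on_def by (intro allI Ck_on_local) metis

lemma smooth_on_const: "smooth_on S (\<lambda>x. c)"
  unfolding smooth_on_def using Ck_on_const by blast

lemma smooth_on_bounded_linear:
  "bounded_linear h \<Longrightarrow> open S \<Longrightarrow> smooth_on S f \<Longrightarrow> smooth_on S (\<lambda>x. h (f x))"
  unfolding smooth_on_def using Ck_on_bounded_linear by blast

lemma smooth_on_add:
  "open S \<Longrightarrow> smooth_on S f \<Longrightarrow> smooth_on S g \<Longrightarrow> smooth_on S (\<lambda>x. f x + g x)"
  unfolding smooth_on_def using Ck_on_add by blast

lemma smooth_on_minus: "open S \<Longrightarrow> smooth_on S f \<Longrightarrow> smooth_on S (\<lambda>x. - f x)"
  using smooth_on_bounded_linear[OF bounded_linear_minus[OF bounded_linear_ident]] .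

lemma smooth_on_diff:
  "open S \<Longrightarrow> smooth_on S f \<Longrightarrow> smooth_on S g \<Longrightarrow> smooth_on S (\<lambda>x. f x - g x)"
  using smooth_on_add[of S f "\<lambda>x. - g x"] smooth_on_minus by auto

lemma smooth_on_sum:
  "open S \<Longrightarrow> (\<And>i. i \<in> B \<Longrightarrow> smooth_on S (f i)) \<Longrightarrow> smooth_on S (\<lambda>x. \<Sum>i\<in>B. f i x)"
  unfolding smooth_on_def by (intro allI Ck_on_sum) auto

lemma smooth_on_bilinear:
  "bounded_bilinear h \<Longrightarrow> open S \<Longrightarrow> smooth_on S f \<Longrightarrow> smooth_on S g \<Longrightarrow>
    smooth_on S (\<lambda>x. h (f x) (g x))"
  unfolding smooth_on_def using Ck_on_bilinear by blast

lemmas smooth_on_scaleR = smooth_on_bilinear[OF bounded_bilinear_scaleR]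
lemmas smooth_on_inner = smooth_on_bilinear[OF bounded_bilinear_inner]
lemmas smooth_on_mult = smooth_on_bilinear[OF bounded_bilinear_mult]

lemma smooth_on_compose:
  fixes g :: "'a::real_normed_vector \<Rightarrow> 'b::euclidean_space" and f :: "'b \<Rightarrow> 'c::real_normed_vector"
  shows "open S \<Longrightarrow> g ` S \<subseteq> T \<Longrightarrow> smooth_on S g \<Longrightarrow> smooth_on T f \<Longrightarrow> smooth_on S (\<lambda>x. f (g x))"
  unfolding smooth_on_def using Ck_on_compose by blast

lemma smooth_on_ident: "smooth_on S (\<lambda>x. x)"
proof -
  have "Ck_on k S (\<lambda>x. x)" for k
    by (cases k) (auto simp: Ck_on_const)
  then show ?thesis by (simp add: smooth_on_def)
qed

lemma smooth_on_of_bounded_linear: "bounded_linear h \<Longrightarrow> smooth_on S h"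
  using smooth_on_subset[OF smooth_on_bounded_linear[OF _ open_UNIV smooth_on_ident]] by auto

lemma smooth_on_Pair:
  assumes "open S" "smooth_on S f" "smooth_on S g"
  shows "smooth_on S (\<lambda>x. (f x, g x))"
proof -
  have "bounded_linear (\<lambda>a::'b. (a, 0::'c))" "bounded_linear (\<lambda>b::'c. (0::'b, b))"
    by (auto intro: bounded_linear_Pair bounded_linear_ident bounded_linear_zero)
  then have "smooth_on S (\<lambda>x. (f x, 0::'c) + (0::'b, g x))"
    using smooth_on_add[OF assms(1) smooth_on_bounded_linear[OF _ assms(1,2)]
        smooth_on_bounded_linear[OF _ assms(1,3)]] by blast
  then show ?thesis by simp
qed

lemma smooth_on_snd: "smooth_on S snd"
  by (simp add: smooth_on_of_bounded_linear bounded_linear_snd)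

lemma smooth_on_inverse: "smooth_on {x::real. x \<noteq> 0} inverse"
proof -
  have o: "open {x::real. x \<noteq> 0}"
    by (simp add: open_Collect_neq)
  have d: "(inverse has_derivative (\<lambda>h. - (inverse x * h * inverse x))) (at x)" if "x \<noteq> 0" for x :: real
    using has_derivative_inverse'[OF that] .
  have "Ck_on k {x::real. x \<noteq> 0} inverse" for k
  proof (induction k)
    case 0
    then show ?case by (auto intro: continuous_on_inverse continuous_on_id)
  next
    case (Suc k)
    have "Ck_on k {x::real. x \<noteq> 0} (\<lambda>x. fd inverse x a)" for a
    proof (rule Ck_on_cong[OF o, of "\<lambda>x. (- a) * (inverse x * inverse x)"])
      show "Ck_on k {x. x \<noteq> 0} (\<lambda>x. (- a) * (inverse x * inverse x))"
        using Suc by (intro Ck_on_bilinear[OF bounded_bilinear_mult o] Ck_on_const)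
    qed (simp add: fd_eq[OF d])
    then show ?case using d by (auto simp: differentiable_def)
  qed
  then show ?thesis by (simp add: smooth_on_def)
qed

subsection \<open>Symmetry of second derivatives\<close>

text \<open>Two mean value theorems, in direction \<open>a\<close> for the increment along
  \<open>h *\<^sub>R b\<close> and then in direction \<open>b\<close>. The second difference on the
  left is symmetric in \<open>a\<close> and \<open>b\<close>, which is the source of the symmetry of
  second derivatives.\<close>

lemma second_derivative_mean_value:
  fixes f :: "'a::real_normed_vector \<Rightarrow> real"
  assumes "smooth_on S f" "h > 0"
    and S: "\<And>s t. \<bar>s\<bar> \<le> h \<Longrightarrow> \<bar>t\<bar> \<le> h \<Longrightarrow> x + s *\<^sub>R a + t *\<^sub>R b \<in> S"
  obtains s t where "0 < s" "s < h" "0 < t" "t < h"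
    "f (x + h *\<^sub>R a + h *\<^sub>R b) - f (x + h *\<^sub>R a) - f (x + h *\<^sub>R b) + f x =
      h * h * fd (\<lambda>x. fd f x a) (x + s *\<^sub>R a + t *\<^sub>R b) b"
proof -
  define g where "g = (\<lambda>s. f (x + s *\<^sub>R a + h *\<^sub>R b) - f (x + s *\<^sub>R a))"
  have lin: "fd f y (c *\<^sub>R v) = c * fd f y v" if "y \<in> S" for y c v
    using smooth_on_linear_fd[OF assms(1) that] by (simp add: linear_cmul)
  have "(g has_real_derivative
      (fd f (x + s *\<^sub>R a + h *\<^sub>R b) a - fd f (x + s *\<^sub>R a) a)) (at s)"
    if "0 \<le> s" "s \<le> h" for s
  proof -
    have p: "x + s *\<^sub>R a + h *\<^sub>R b \<in> S" "x + s *\<^sub>R a \<in> S"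
      using S[of s h] S[of s 0] that \<open>h > 0\<close> by auto
    have "((\<lambda>s. f (x + s *\<^sub>R a + h *\<^sub>R b)) has_derivative
        (\<lambda>c. fd f (x + s *\<^sub>R a + h *\<^sub>R b) (c *\<^sub>R a))) (at s)"
      by (rule has_derivative_compose[where f = "\<lambda>s. x + s *\<^sub>R a + h *\<^sub>R b" and g = "f", OF _ smooth_on_has_derivative[OF assms(1) p(1)]])
        (auto intro!: derivative_eq_intros)
    moreover have "((\<lambda>s. f (x + s *\<^sub>R a)) has_derivative (\<lambda>c. fd f (x + s *\<^sub>R a) (c *\<^sub>R a))) (at s)"
      by (rule has_derivative_compose[where f = "\<lambda>s. x + s *\<^sub>R a" and g = "f", OF _ smooth_on_has_derivative[OF assms(1) p(2)]])
        (auto intro!: derivative_eq_intros)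
    ultimately show ?thesis
      unfolding g_def has_field_derivative_def
      by (rule has_derivative_eq_rhs[OF has_derivative_diff])
        (auto simp: lin[OF p(1)] lin[OF p(2)] right_diff_distrib[symmetric] mult.commute fun_eq_iff)
  qed
  from MVT2[OF \<open>h > 0\<close> this] obtain s where s: "0 < s" "s < h"
    "g h - g 0 = (h - 0) * (fd f (x + s *\<^sub>R a + h *\<^sub>R b) a - fd f (x + s *\<^sub>R a) a)"
    by blast
  have sm: "smooth_on S (\<lambda>x. fd f x a)"
    using assms(1) by (rule smooth_on_fd)
  have "((\<lambda>t. fd f (x + s *\<^sub>R a + t *\<^sub>R b) a) has_real_derivative
      fd (\<lambda>x. fd f x a) (x + s *\<^sub>R a + t *\<^sub>R b) b) (at t)" if "0 \<le> t" "t \<le> h" for t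
  proof -
    have p: "x + s *\<^sub>R a + t *\<^sub>R b \<in> S"
      using S[of s t] that s by auto
    have "((\<lambda>t. fd f (x + s *\<^sub>R a + t *\<^sub>R b) a) has_derivative
        (\<lambda>c. fd (\<lambda>x. fd f x a) (x + s *\<^sub>R a + t *\<^sub>R b) (c *\<^sub>R b))) (at t)"
      by (rule has_derivative_compose[where f = "\<lambda>t. x + s *\<^sub>R a + t *\<^sub>R b" and g = "\<lambda>x. fd f x a", OF _ smooth_on_has_derivative[OF sm p]])
        (auto intro!: derivative_eq_intros)
    then show ?thesis
      unfolding has_field_derivative_def
      by (rule has_derivative_eq_rhs)
        (simp add: linear_cmul[OF smooth_on_linear_fd[OF sm p]] mult.commute[of _ "fd _ _ _"])
  qed
  from MVT2[OF \<open>h > 0\<close> this] obtain t where t: "0 < t" "t < h"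
    "fd f (x + s *\<^sub>R a + h *\<^sub>R b) a - fd f (x + s *\<^sub>R a + 0 *\<^sub>R b) a =
      (h - 0) * fd (\<lambda>x. fd f x a) (x + s *\<^sub>R a + t *\<^sub>R b) b"
    by blast
  have "f (x + h *\<^sub>R a + h *\<^sub>R b) - f (x + h *\<^sub>R a) - f (x + h *\<^sub>R b) + f x = g h - g 0"
    by (simp add: g_def)
  also have "\<dots> = h * h * fd (\<lambda>x. fd f x a) (x + s *\<^sub>R a + t *\<^sub>R b) b"
    using s(3) t(3) by simp
  finally show ?thesis using s(1,2) t(1,2) that by blast
qed

lemma second_derivative_symmetric_real:
  fixes f :: "'a::real_normed_vector \<Rightarrow> real"
  assumes "open S" "smooth_on S f" "x \<in> S"
  shows "fd (\<lambda>x. fd f x a) x b = fd (\<lambda>x. fd f x b) x a"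
proof (rule ccontr)
  let ?A = "\<lambda>y. fd (\<lambda>x. fd f x a) y b" and ?B = "\<lambda>y. fd (\<lambda>x. fd f x b) y a"
  assume "?A x \<noteq> ?B x"
  \<comment> \<open>Half the gap, so that two errors below \<open>e\<close> contradict it.\<close>
  define e where "e = \<bar>?A x - ?B x\<bar> / 2"
  have e: "e > 0" using \<open>?A x \<noteq> ?B x\<close> by (simp add: e_def)
  have "isCont ?A x" "isCont ?B x"
    using smooth_on_continuous_on[OF smooth_on_fd[OF smooth_on_fd[OF assms(2)]]] assms(1,3)
    by (auto simp: continuous_on_eq_continuous_at)
  then obtain d1 d2 where d: "d1 > 0" "d2 > 0"
    "\<And>y. dist y x < d1 \<Longrightarrow> dist (?A y) (?A x) < e" "\<And>y. dist y x < d2 \<Longrightarrow> dist (?B y) (?B x) < e"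
    using e unfolding continuous_at_eps_delta by metis
  obtain d3 where d3: "d3 > 0" "ball x d3 \<subseteq> S"
    using assms(1,3) open_contains_ball by blast
  define r where "r = min d1 (min d2 d3)"
  \<comment> \<open>Keeps the parallelogram spanned by \<open>h *\<^sub>R a\<close> and
    \<open>h *\<^sub>R b\<close> within distance \<open>r\<close> of \<open>x\<close>; the summand 1
    keeps the denominator positive when both directions are zero.\<close>
  define h where "h = r / (2 * (norm a + norm b + 1))"
  have r: "r > 0" using d d3 by (simp add: r_def)
  have n: "norm a + norm b + 1 > 0"
    using norm_ge_zero[of a] norm_ge_zero[of b] by linarith
  have h: "h > 0" using r n by (simp add: h_def)
  have hr: "h * (norm a + norm b) < r"
  proof -
    have "h * (norm a + norm b) \<le> h * (norm a + norm b + 1)" using h by simp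
    also have "\<dots> = r / 2" using n by (simp add: h_def field_simps)
    finally show ?thesis using r by linarith
  qed
  have near: "dist (x + s *\<^sub>R a + t *\<^sub>R b) x < r" if "\<bar>s\<bar> \<le> h" "\<bar>t\<bar> \<le> h" for s t
  proof -
    have "dist (x + s *\<^sub>R a + t *\<^sub>R b) x = norm (s *\<^sub>R a + t *\<^sub>R b)"
      by (simp add: dist_norm)
    also have "\<dots> \<le> \<bar>s\<bar> * norm a + \<bar>t\<bar> * norm b"
      using norm_triangle_ineq[of "s *\<^sub>R a" "t *\<^sub>R b"] by simp
    also have "\<dots> \<le> h * norm a + h * norm b"
      using that by (intro add_mono mult_right_mono) auto
    finally show ?thesis using hr by (simp add: algebra_simps)
  qed
  have near': "dist (x + t *\<^sub>R b + s *\<^sub>R a) x < r" if "\<bar>s\<bar> \<le> h" "\<bar>t\<bar> \<le> h" for s t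
    using near[OF that] by (simp add: algebra_simps)
  have S: "x + s *\<^sub>R a + t *\<^sub>R b \<in> S" "x + t *\<^sub>R b + s *\<^sub>R a \<in> S" if "\<bar>s\<bar> \<le> h" "\<bar>t\<bar> \<le> h" for s t
    using near[OF that] near'[OF that] d3 by (auto simp: r_def dist_commute)
  obtain s t where st: "0 < s" "s < h" "0 < t" "t < h"
    "f (x + h *\<^sub>R a + h *\<^sub>R b) - f (x + h *\<^sub>R a) - f (x + h *\<^sub>R b) + f x =
      h * h * ?A (x + s *\<^sub>R a + t *\<^sub>R b)"
    using second_derivative_mean_value[OF assms(2) h, of x a b] S by metis
  obtain s' t' where st': "0 < s'" "s' < h" "0 < t'" "t' < h"
    "f (x + h *\<^sub>R b + h *\<^sub>R a) - f (x + h *\<^sub>R b) - f (x + h *\<^sub>R a) + f x =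
      h * h * ?B (x + s' *\<^sub>R b + t' *\<^sub>R a)"
    using second_derivative_mean_value[OF assms(2) h, of x b a] S by metis
  have "h * h * ?A (x + s *\<^sub>R a + t *\<^sub>R b) = h * h * ?B (x + s' *\<^sub>R b + t' *\<^sub>R a)"
    unfolding st(5)[symmetric] st'(5)[symmetric] by (simp add: algebra_simps)
  then have eq: "?A (x + s *\<^sub>R a + t *\<^sub>R b) = ?B (x + s' *\<^sub>R b + t' *\<^sub>R a)"
    using h by simp
  have "dist (?A (x + s *\<^sub>R a + t *\<^sub>R b)) (?A x) < e"
    by (rule d(3)) (use near[of s t] st in \<open>simp add: r_def\<close>)
  moreover have "dist (?B (x + s' *\<^sub>R b + t' *\<^sub>R a)) (?B x) < e"
    by (rule d(4)) (use near'[of t' s'] st' in \<open>simp add: r_def\<close>)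
  ultimately have "\<bar>?A x - ?B x\<bar> < 2 * e"
    using eq by (simp add: dist_real_def)
  then show False by (simp add: e_def)
qed

text \<open>The mean value theorem gives the real-valued case; components commute with both
  derivatives.\<close>

lemma second_derivative_symmetric:
  fixes f :: "'a::real_normed_vector \<Rightarrow> 'b::euclidean_space"
  assumes "open S" "smooth_on S f" "x \<in> S"
  shows "fd (\<lambda>x. fd f x a) x b = fd (\<lambda>x. fd f x b) x a"
proof (rule euclidean_eqI)
  fix i :: 'b
  assume "i \<in> Basis"
  have inner: "fd (\<lambda>x. g x \<bullet> i) y c = fd g y c \<bullet> i" if "smooth_on S g" "y \<in> S" for g :: "'a \<Rightarrow> 'b" and y c
    using fd_eq[OF bounded_linear.has_derivative[OF bounded_linear_inner_left smooth_on_has_derivative[OF that]]]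
    by simp
  have "fd (\<lambda>x. fd f x a) x b \<bullet> i = fd (\<lambda>x. fd (\<lambda>x. f x \<bullet> i) x a) x b" for a b
    unfolding inner[OF smooth_on_fd[OF assms(2)] assms(3), symmetric]
    using fd_cong_open[OF assms(1,3), of "\<lambda>x. fd f x a \<bullet> i" "\<lambda>x. fd (\<lambda>x. f x \<bullet> i) x a"]
      inner[OF assms(2)] by simp
  then show "fd (\<lambda>x. fd f x a) x b \<bullet> i = fd (\<lambda>x. fd f x b) x a \<bullet> i"
    using second_derivative_symmetric_real[OF assms(1)
        smooth_on_bounded_linear[OF bounded_linear_inner_left assms(1,2)] assms(3)] by metis
qed

subsection \<open>Linear and bilinear families\<close>

lemma linear_sum_Basis:
  fixes f :: "'a::euclidean_space \<Rightarrow> 'b::real_vector"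
  assumes "linear f"
  shows "f x = (\<Sum>i\<in>Basis. (x \<bullet> i) *\<^sub>R f i)"
  by (subst euclidean_representation[of x, symmetric])
    (simp add: linear_sum[OF assms] linear_cmul[OF assms])

text \<open>Differentiability is assumed only for the maps \<open>\<lambda>z. T z i\<close> with
  \<open>i\<close> fixed. Expanding the moving vector \<open>a y\<close> in the basis reduces the
  claim to finitely many products; linearity of \<open>T z\<close> is available on \<open>U\<close>
  only, so the expansion is used near \<open>x\<close>, by continuity of \<open>f\<close>.\<close>

lemma has_derivative_linear_family:
  fixes T :: "'z::real_normed_vector \<Rightarrow> 'e::euclidean_space \<Rightarrow> 'c::real_normed_vector"
  assumes "open U" and lin: "\<And>z. z \<in> U \<Longrightarrow> linear (T z)"
    and dif: "\<And>i. (\<lambda>z. T z i) differentiable (at (f x))"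
    and "f x \<in> U" "(f has_derivative f') (at x)" "(a has_derivative a') (at x)"
  shows "((\<lambda>y. T (f y) (a y)) has_derivative
      (\<lambda>h. fd (\<lambda>z. T z (a x)) (f x) (f' h) + T (f x) (a' h))) (at x)"
proof -
  have b: "linear (T (f x))" using assms by blast
  have fd_sum: "fd (\<lambda>z. T z b) (f x) = (\<lambda>h. \<Sum>i\<in>Basis. (b \<bullet> i) *\<^sub>R fd (\<lambda>z. T z i) (f x) h)" for b
  proof -
    have "((\<lambda>z. \<Sum>i\<in>Basis. (b \<bullet> i) *\<^sub>R T z i) has_derivative
        (\<lambda>h. \<Sum>i\<in>Basis. (b \<bullet> i) *\<^sub>R fd (\<lambda>z. T z i) (f x) h)) (at (f x))"
      by (intro has_derivative_sum has_derivative_scaleR_right fd_works dif)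
    then show ?thesis
      using fd_cong_open[OF assms(1,4), of "\<lambda>z. T z b", OF linear_sum_Basis[OF lin]] by (simp add: fd_eq)
  qed
  have "((\<lambda>y. \<Sum>i\<in>Basis. (a y \<bullet> i) *\<^sub>R T (f y) i) has_derivative
      (\<lambda>h. \<Sum>i\<in>Basis. (a x \<bullet> i) *\<^sub>R fd (\<lambda>z. T z i) (f x) (f' h) + (a' h \<bullet> i) *\<^sub>R T (f x) i)) (at x)"
    by (intro has_derivative_sum has_derivative_scaleR has_derivative_inner_left assms(5,6)
        has_derivative_compose[OF assms(5) fd_works[OF dif]])
  then have D: "((\<lambda>y. \<Sum>i\<in>Basis. (a y \<bullet> i) *\<^sub>R T (f y) i) has_derivative
      (\<lambda>h. fd (\<lambda>z. T z (a x)) (f x) (f' h) + T (f x) (a' h))) (at x)"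
    by (rule has_derivative_eq_rhs) (simp only: fd_sum[of "a x"] sum.distrib linear_sum_Basis[OF b, of "a' _"])
  have "isCont f x" using assms(5) has_derivative_continuous by blast
  then obtain N where N: "open N" "x \<in> N" "\<And>y. y \<in> N \<Longrightarrow> f y \<in> U"
    using assms(1,4) continuous_at_open[of x f] by auto
  show ?thesis
    by (rule has_derivative_transform_within_open[OF D N(1,2)])
      (simp add: linear_sum_Basis[OF lin[OF N(3)], of _ "a _"])
qed

lemma linear_fd_family:
  fixes T :: "'z::real_normed_vector \<Rightarrow> 'e::euclidean_space \<Rightarrow> 'c::real_normed_vector"
  assumes "open U" "\<And>z. z \<in> U \<Longrightarrow> linear (T z)" "z \<in> U" "\<And>i. (\<lambda>z. T z i) differentiable (at z)"
  shows "linear (\<lambda>a. fd (\<lambda>z. T z a) z h)"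
proof (rule linearI)
  fix a b :: 'e and r :: real
  have "((\<lambda>z. T z a + T z b) has_derivative (\<lambda>h. fd (\<lambda>z. T z a) z h + fd (\<lambda>z. T z b) z h)) (at z)"
    by (intro has_derivative_add fd_works assms)
  then show "fd (\<lambda>z. T z (a + b)) z h = fd (\<lambda>z. T z a) z h + fd (\<lambda>z. T z b) z h"
    using fd_cong_open[OF assms(1,3), of "\<lambda>z. T z (a + b)" "\<lambda>z. T z a + T z b"]
    by (auto simp: fd_eq linear_add[OF assms(2)])
  have "((\<lambda>z. r *\<^sub>R T z a) has_derivative (\<lambda>h. r *\<^sub>R fd (\<lambda>z. T z a) z h)) (at z)"
    by (intro has_derivative_scaleR_right fd_works assms)
  then show "fd (\<lambda>z. T z (r *\<^sub>R a)) z h = r *\<^sub>R fd (\<lambda>z. T z a) z h"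
    using fd_cong_open[OF assms(1,3), of "\<lambda>z. T z (r *\<^sub>R a)" "\<lambda>z. r *\<^sub>R T z a"]
    by (auto simp: fd_eq linear_cmul[OF assms(2)])
qed

text \<open>The linear case twice: first with \<open>a\<close> as the moving vector and
  \<open>j\<close> fixed, then with the pair of \<open>f\<close> and \<open>a\<close> as the moving
  point and \<open>b\<close> as the moving vector.\<close>

lemma has_derivative_bilinear_family:
  fixes T :: "'z::real_normed_vector \<Rightarrow> 'e::euclidean_space \<Rightarrow> 'f::euclidean_space \<Rightarrow> 'c::real_normed_vector"
  assumes "open U" and bil: "\<And>z. z \<in> U \<Longrightarrow> bilinear (T z)"
    and dif: "\<And>i j. (\<lambda>z. T z i j) differentiable (at (f x))"
    and "f x \<in> U" "(f has_derivative f') (at x)" "(a has_derivative a') (at x)"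
      "(b has_derivative b') (at x)"
  shows "((\<lambda>y. T (f y) (a y) (b y)) has_derivative
      (\<lambda>h. fd (\<lambda>z. T z (a x) (b x)) (f x) (f' h) + T (f x) (a' h) (b x) + T (f x) (a x) (b' h))) (at x)"
proof -
  have D: "((\<lambda>w. T (fst w) (snd w) j) has_derivative
      (\<lambda>h. fd (\<lambda>z. T z (a x) j) (f x) (fst h) + T (f x) (snd h) j)) (at (f x, a x))" for j
    using has_derivative_linear_family[OF assms(1), of "\<lambda>z a. T z a j" fst "(f x, a x)" fst snd snd]
      bil dif assms(4)
    by (auto simp: bilinear_def intro: bounded_linear_imp_has_derivative bounded_linear_fst bounded_linear_snd)
  have "((\<lambda>y. T (fst (f y, a y)) (snd (f y, a y)) (b y)) has_derivative
      (\<lambda>h. fd (\<lambda>w. T (fst w) (snd w) (b x)) (f x, a x) (f' h, a' h)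
        + T (fst (f x, a x)) (snd (f x, a x)) (b' h))) (at x)"
  proof (rule has_derivative_linear_family[where U = "U \<times> UNIV" and f = "\<lambda>y. (f y, a y)"
        and T = "\<lambda>w. T (fst w) (snd w)"])
    show "((\<lambda>y. (f y, a y)) has_derivative (\<lambda>h. (f' h, a' h))) (at x)"
      using assms by (intro has_derivative_Pair)
    show "(\<lambda>w. T (fst w) (snd w) i) differentiable at (f x, a x)" for i
      using D by (auto simp: differentiable_def)
  qed (use assms in \<open>auto simp: bilinear_def intro: open_Times\<close>)
  then show ?thesis by (simp add: fd_eq[OF D])
qed

lemma smooth_on_linear_family:
  fixes T :: "'z::euclidean_space \<Rightarrow> 'e::euclidean_space \<Rightarrow> 'c::real_normed_vector"
  assumes "open S" "\<And>z. z \<in> U \<Longrightarrow> linear (T z)" "\<And>i. smooth_on U (\<lambda>z. T z i)"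
    "f ` S \<subseteq> U" "smooth_on S f" "smooth_on S a"
  shows "smooth_on S (\<lambda>x. T (f x) (a x))"
proof -
  have "smooth_on S (\<lambda>x. \<Sum>i\<in>Basis. (a x \<bullet> i) *\<^sub>R T (f x) i)"
    using assms by (intro smooth_on_sum smooth_on_scaleR smooth_on_inner smooth_on_const
        smooth_on_compose[OF assms(1,4,5)]) auto
  then show ?thesis
    using smooth_on_cong[OF assms(1), of "\<lambda>x. T (f x) (a x)" "\<lambda>x. \<Sum>i\<in>Basis. (a x \<bullet> i) *\<^sub>R T (f x) i"]
      linear_sum_Basis[OF assms(2)] assms(4) by blast
qed

lemma smooth_on_bilinear_family:
  fixes T :: "'z::euclidean_space \<Rightarrow> 'e::euclidean_space \<Rightarrow> 'f::euclidean_space \<Rightarrow> 'c::real_normed_vector"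
  assumes "open S" "\<And>z. z \<in> U \<Longrightarrow> bilinear (T z)" "\<And>i j. smooth_on U (\<lambda>z. T z i j)"
    "f ` S \<subseteq> U" "smooth_on S f" "smooth_on S a" "smooth_on S b"
  shows "smooth_on S (\<lambda>x. T (f x) (a x) (b x))"
proof -
  have "smooth_on S (\<lambda>x. \<Sum>i\<in>Basis. (a x \<bullet> i) *\<^sub>R (\<Sum>j\<in>Basis. (b x \<bullet> j) *\<^sub>R T (f x) i j))"
    using assms by (intro smooth_on_sum smooth_on_scaleR smooth_on_inner smooth_on_const
        smooth_on_compose[OF assms(1,4,5)]) auto
  moreover have "T (f x) (a x) (b x) = (\<Sum>i\<in>Basis. (a x \<bullet> i) *\<^sub>R (\<Sum>j\<in>Basis. (b x \<bullet> j) *\<^sub>R T (f x) i j))"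
    if "x \<in> S" for x
  proof -
    have "linear (\<lambda>u. T (f x) u (b x))" "\<And>u. linear (T (f x) u)"
      using assms(2)[of "f x"] assms(4) that by (auto simp: bilinear_def)
    then show ?thesis
      using linear_sum_Basis[of "\<lambda>u. T (f x) u (b x)" "a x"] linear_sum_Basis[of "T (f x) _" "b x"]
      by (metis (no_types, lifting) sum.cong)
  qed
  ultimately show ?thesis
    using smooth_on_cong[OF assms(1)] by (metis (no_types, lifting))
qed

subsection \<open>Bump functions\<close>

text \<open>The powers of x in the denominator make the family closed under differentiation up to
  linear combinations, so the smoothness of all members is a single induction on the order.\<close>

definition exp_flat :: "nat \<Rightarrow> real \<Rightarrow> real" where
  "exp_flat n x = (if x > 0 then exp (- (1 / x)) / x ^ n else 0)"

lemma exp_flat_tendsto_0: "(exp_flat n \<longlongrightarrow> 0) (at 0)"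
proof -
  have "((\<lambda>x. inverse x ^ n / exp (inverse x)) \<longlongrightarrow> (0::real)) (at_right 0)"
    by (rule filterlim_compose[OF tendsto_power_div_exp_0 filterlim_inverse_at_top_right])
  moreover have "\<forall>\<^sub>F x in at_right 0. inverse x ^ n / exp (inverse x) = exp_flat n x"
    unfolding eventually_at_right_field
    by (auto intro!: exI[of _ 1] simp: exp_flat_def exp_minus field_simps)
  ultimately have "(exp_flat n \<longlongrightarrow> 0) (at_right 0)"
    using tendsto_cong by force
  moreover have "(exp_flat n \<longlongrightarrow> 0) (at_left 0)"
    by (rule tendsto_eventually) (auto simp: eventually_at_left_field exp_flat_def intro: exI[of _ "-1"])
  ultimately show ?thesis
    by (simp add: filterlim_at_split)
qed

lemma exp_flat_has_derivative:
  "(exp_flat n has_real_derivative (exp_flat (n + 2) x - n * exp_flat (n + 1) x)) (at x)"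
proof -
  consider "x > 0" | "x < 0" | "x = 0" by linarith
  then show ?thesis
  proof cases
    case 1
    \<comment> \<open>The derivative of a power carries the truncated exponent
      \<open>n - Suc 0\<close>; this relates it to the original power.\<close>
    have "m = 0 \<or> x ^ m = x * x ^ (m - Suc 0)" for m
      by (cases m) auto
    then have "((\<lambda>x. exp (- (1 / x)) / x ^ n) has_real_derivative
        (exp_flat (n + 2) x - n * exp_flat (n + 1) x)) (at x)"
      using 1 by (cases n)
        (auto intro!: derivative_eq_intros simp: exp_flat_def field_simps power2_eq_square)
    then show ?thesis
      by (rule has_field_derivative_transform_within_open[where S = "{0<..}"])
        (use 1 in \<open>auto simp: exp_flat_def\<close>)
  next
    case 2
    have "((\<lambda>x. 0) has_real_derivative (exp_flat (n + 2) x - n * exp_flat (n + 1) x)) (at x)"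
      using 2 by (auto intro!: derivative_eq_intros simp: exp_flat_def)
    then show ?thesis
      by (rule has_field_derivative_transform_within_open[where S = "{..<0}"])
        (use 2 in \<open>auto simp: exp_flat_def\<close>)
  next
    case 3
    \<comment> \<open>The difference quotient at 0 is the next member of the family, even at
      \<open>h = 0\<close>, where division by zero gives 0 on the left.\<close>
    have "(\<lambda>h. (exp_flat n (0 + h) - exp_flat n 0) / h) = exp_flat (n + 1)"
      by (auto simp: exp_flat_def fun_eq_iff)
    then show ?thesis
      using 3 exp_flat_tendsto_0[of "n + 1"] by (auto simp: DERIV_def exp_flat_def)
  qed
qed

lemma smooth_on_exp_flat: "smooth_on UNIV (exp_flat n)"
proof -
  have "Ck_on k UNIV (exp_flat n)" for k
  proof (induction k arbitrary: n)
    case 0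
    then show ?case
      using exp_flat_has_derivative DERIV_continuous continuous_at_imp_continuous_on by (metis Ck_on.simps(1))
  next
    case (Suc k)
    have d: "(exp_flat n has_derivative (\<lambda>a. (exp_flat (n + 2) x - n * exp_flat (n + 1) x) * a)) (at x)" for x
      using exp_flat_has_derivative[of n x] by (simp add: has_field_derivative_def)
    have "Ck_on k UNIV (\<lambda>x. (exp_flat (n + 2) x + (- n) * exp_flat (n + 1) x) * a)" for a
      by (intro Ck_on_bilinear[OF bounded_bilinear_mult] Ck_on_add Ck_on_const Suc open_UNIV)
    then have "Ck_on k UNIV (\<lambda>x. fd (exp_flat n) x a)" for a
      by (simp add: fd_eq[OF d])
    then show ?case using d by (auto simp: differentiable_def)
  qed
  then show ?thesis by (simp add: smooth_on_def)
qed

text \<open>The quotient u / (u + w), where u is positive exactly inside the ball of radius 2r and w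
  exactly outside the closed ball of radius r, so that the denominator never vanishes. The squared
  distance \<open>q\<close> is used because the distance is not smooth at the centre.\<close>

lemma bump_function_exists:
  fixes x0 :: "'e::euclidean_space"
  assumes "r > 0"
  obtains \<phi> :: "'e \<Rightarrow> real" where "smooth_on UNIV \<phi>" "\<And>x. x \<in> ball x0 r \<Longrightarrow> \<phi> x = 1"
    "\<And>x. x \<notin> ball x0 (2 * r) \<Longrightarrow> \<phi> x = 0"
proof -
  define q where "q = (\<lambda>x. (x - x0) \<bullet> (x - x0))"
  define u where "u = (\<lambda>x. exp_flat 0 (4 * r\<^sup>2 - q x))"
  define w where "w = (\<lambda>x. exp_flat 0 (q x - r\<^sup>2))"
  have q: "q x = (dist x0 x)\<^sup>2" for x
    by (simp add: q_def dist_norm norm_minus_commute[of x0] power2_norm_eq_inner)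
  have sq: "smooth_on UNIV q"
    unfolding q_def by (intro smooth_on_inner smooth_on_diff smooth_on_ident smooth_on_const open_UNIV)
  have su: "smooth_on UNIV u" unfolding u_def
    by (intro smooth_on_compose[OF _ _ _ smooth_on_exp_flat, where g = "\<lambda>x. 4 * r\<^sup>2 - q x"]
        smooth_on_diff smooth_on_const sq) auto
  have sw: "smooth_on UNIV w" unfolding w_def
    by (intro smooth_on_compose[OF _ _ _ smooth_on_exp_flat, where g = "\<lambda>x. q x - r\<^sup>2"]
        smooth_on_diff smooth_on_const sq) auto
  have u0: "u x \<ge> 0" and w0: "w x \<ge> 0" for x by (auto simp: u_def w_def exp_flat_def)
  have pos: "u x + w x \<noteq> 0" for x
  proof (cases "q x < 4 * r\<^sup>2")
    case True
    then have "u x > 0" by (simp add: u_def exp_flat_def)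
    then show ?thesis using w0[of x] by linarith
  next
    case False
    then have "w x > 0" using assms by (simp add: w_def exp_flat_def)
        (smt (verit) zero_less_power)
    then show ?thesis using u0[of x] by linarith
  qed
  have "smooth_on UNIV (\<lambda>x. u x * inverse (u x + w x))"
    by (intro smooth_on_mult su smooth_on_compose[OF _ _ _ smooth_on_inverse] smooth_on_add sw open_UNIV)
      (use pos in auto)
  moreover have "u x * inverse (u x + w x) = 1" if "x \<in> ball x0 r" for x
  proof -
    have "q x < r\<^sup>2" using that by (simp add: q power_strict_mono)
    then have "w x = 0" by (simp add: w_def exp_flat_def)
    then show ?thesis using pos[of x] by simp
  qed
  moreover have "u x * inverse (u x + w x) = 0" if "x \<notin> ball x0 (2 * r)" for x
  proof -
    have "q x \<ge> (2 * r)\<^sup>2" using that assms unfolding q by (intro power_mono) auto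
    then have "u x = 0" by (simp add: u_def exp_flat_def power_mult_distrib)
    then show ?thesis by simp
  qed
  ultimately show ?thesis using that by blast
qed

section \<open>Anisotropic connections in coordinates\<close>

text \<open>Points of \<open>'e \<times> 'e\<close> are pairs \<open>(x, y)\<close> of a base and a fibre coordinate.\<close>

definition fibre_hessian :: "('e::euclidean_space \<times> 'e \<Rightarrow> real) \<Rightarrow> 'e \<times> 'e \<Rightarrow> 'e \<Rightarrow> 'e \<Rightarrow> real" where
  "fibre_hessian L z a b = (1/2) * fd (\<lambda>z. fd L z (0, b)) z (0, a)"

lemma linear_Pair_0: "linear (\<lambda>a. (a, 0))" and linear_0_Pair: "linear (\<lambda>a. (0, a))"
  by (auto intro: linearI)

section \<open>Pseudo-Finsler functions in coordinates: Euler identities and the Cartan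
  tensor\<close>

locale local_finsler =
  fixes U :: "('e::euclidean_space \<times> 'e) set" and L :: "'e \<times> 'e \<Rightarrow> real"
  assumes open_U: "open U"
    and cone: "(x, y) \<in> U \<Longrightarrow> r > 0 \<Longrightarrow> (x, r *\<^sub>R y) \<in> U"
    and smooth_L: "smooth_on U L"
    and homogeneous: "(x, y) \<in> U \<Longrightarrow> r > 0 \<Longrightarrow> L (x, r *\<^sub>R y) = r\<^sup>2 * L (x, y)"
    and nondegenerate: "z \<in> U \<Longrightarrow> (\<And>w. fibre_hessian L z u w = 0) \<Longrightarrow> u = 0"
begin

abbreviation g :: "'e \<times> 'e \<Rightarrow> 'e \<Rightarrow> 'e \<Rightarrow> real" where
  "g \<equiv> fibre_hessian L"

abbreviation dg :: "'e \<times> 'e \<Rightarrow> 'e \<times> 'e \<Rightarrow> 'e \<Rightarrow> 'e \<Rightarrow> real" where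
  "dg z \<zeta> a b \<equiv> fd (\<lambda>z. g z a b) z \<zeta>"

lemma smooth_dL: "smooth_on U (\<lambda>z. fd L z \<zeta>)"
  using smooth_L by (rule smooth_on_fd)

lemma smooth_g: "smooth_on U (\<lambda>z. g z a b)"
  unfolding fibre_hessian_def
  by (intro smooth_on_mult open_U smooth_on_const smooth_on_fd smooth_L)

lemma linear_dL: "z \<in> U \<Longrightarrow> linear (fd L z)"
  using smooth_on_linear_fd[OF smooth_L] .

lemma linear_dg: "z \<in> U \<Longrightarrow> linear (\<lambda>\<zeta>. dg z \<zeta> a b)"
  using smooth_on_linear_fd[OF smooth_g] .

lemma linear_dL_snd: "z \<in> U \<Longrightarrow> linear (\<lambda>a. fd L z (0, a))"
  using linear_compose[OF linear_0_Pair linear_dL] by (simp add: o_def)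

lemma bilinear_g:
  assumes "z \<in> U"
  shows "bilinear (g z)"
proof -
  have "linear (\<lambda>b. fd (\<lambda>z. fd L z (0, b)) z (0, a))" for a
    by (rule linear_fd_family[where T = "\<lambda>z b. fd L z (0, b)", OF open_U linear_dL_snd assms])
      (auto intro: smooth_on_differentiable[OF smooth_dL assms])
  moreover have "linear (\<lambda>a. fd (\<lambda>z. fd L z (0, b)) z (0, a))" for b
    using linear_compose[OF linear_0_Pair smooth_on_linear_fd[OF smooth_dL assms]] by (simp add: o_def)
  ultimately show ?thesis
    unfolding bilinear_def fibre_hessian_def real_scaleR_def[symmetric]
    by (intro conjI allI linear_compose_scale_right)
qed

lemma g_sym: "z \<in> U \<Longrightarrow> g z a b = g z b a"
  unfolding fibre_hessian_def
  using second_derivative_symmetric[OF open_U smooth_L] by metis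

lemma g_eq_zeroD: "z \<in> U \<Longrightarrow> (\<And>w. g z w u = 0) \<Longrightarrow> u = 0"
  using nondegenerate g_sym by metis

lemma g_has_derivative:
  assumes "f x \<in> U" "(f has_derivative f') (at x)" "(a has_derivative a') (at x)"
    "(b has_derivative b') (at x)"
  shows "((\<lambda>y. g (f y) (a y) (b y)) has_derivative
    (\<lambda>h. dg (f x) (f' h) (a x) (b x) + g (f x) (a' h) (b x) + g (f x) (a x) (b' h))) (at x)"
  by (rule has_derivative_bilinear_family[where T = g, OF open_U bilinear_g _ assms])
    (auto intro: smooth_on_differentiable[OF smooth_g assms(1)])

text \<open>Two ways to differentiate L(x, r y) at r = 1: by the chain rule and by
  homogeneity.\<close>

lemma euler_L:
  assumes "z \<in> U"
  shows "fd L z (0, snd z) = 2 * L z"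
proof -
  obtain x y where z: "z = (x, y)" by fastforce
  have "((\<lambda>r. L (x, r *\<^sub>R y)) has_derivative (\<lambda>h. fd L (x, 1 *\<^sub>R y) (0, h *\<^sub>R y))) (at (1::real))"
    by (rule has_derivative_compose[where f = "\<lambda>r. (x, r *\<^sub>R y)" and g = L])
      (use assms smooth_on_has_derivative[OF smooth_L] in \<open>auto simp: z intro!: derivative_eq_intros\<close>)
  moreover have "((\<lambda>r. L (x, r *\<^sub>R y)) has_derivative (\<lambda>h. (2 * h) * L (x, y))) (at (1::real))"
    by (rule has_derivative_transform_within_open[where s = "{0<..}" and f = "\<lambda>r. r\<^sup>2 * L (x, y)"])
      (use assms homogeneous in \<open>auto simp: z intro!: derivative_eq_intros\<close>)
  ultimately have "(\<lambda>h. fd L (x, 1 *\<^sub>R y) (0, h *\<^sub>R y)) = (\<lambda>h. (2 * h) * L (x, y))"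
    by (rule has_derivative_unique)
  from fun_cong[OF this, of 1] show ?thesis by (simp add: z)
qed

text \<open>Differentiating \<open>euler_L\<close> along (0, w) gives 2 g(w, y) + dL(0, w) on the
  left and 2 dL(0, w) on the right.\<close>

lemma dL_snd:
  assumes "z \<in> U"
  shows "fd L z (0, w) = 2 * g z w (snd z)"
proof -
  have "((\<lambda>z. fd L z (0, snd z)) has_derivative
      (\<lambda>h. fd (\<lambda>z'. fd L z' (0, snd z)) z h + fd L z (0, snd h))) (at z)"
    by (rule has_derivative_linear_family[OF open_U linear_dL_snd, where f = "\<lambda>z. z"])
      (use assms smooth_on_differentiable[OF smooth_dL] in
        \<open>auto intro: bounded_linear_imp_has_derivative bounded_linear_snd\<close>)
  from fd_eq[OF this] have "fd (\<lambda>z. fd L z (0, snd z)) z (0, w) = 2 * g z w (snd z) + fd L z (0, w)"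
    by (simp add: fibre_hessian_def)
  moreover have "fd (\<lambda>z. fd L z (0, snd z)) z = fd (\<lambda>z. 2 * L z) z"
    using open_U assms by (rule fd_cong_open) (rule euler_L)
  moreover have "fd (\<lambda>z. 2 * L z) z = (\<lambda>h. 2 * fd L z h)"
    by (rule fd_eq) (intro has_derivative_mult_right smooth_on_has_derivative[OF smooth_L assms])
  ultimately show ?thesis by simp
qed

lemma L_eq: "z \<in> U \<Longrightarrow> L z = g z (snd z) (snd z)"
  using euler_L dL_snd by fastforce

lemma fd_g_snd:
  assumes "z \<in> U"
  shows "fd (\<lambda>z. g z w (snd z)) z \<zeta> = dg z \<zeta> w (snd z) + g z w (snd \<zeta>)"
proof -
  have "((\<lambda>z. g z w (snd z)) has_derivative
      (\<lambda>h. dg z h w (snd z) + g z 0 (snd z) + g z w (snd h))) (at z)"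
    by (rule g_has_derivative[where f = "\<lambda>z. z"])
      (use assms in \<open>auto intro: bounded_linear_imp_has_derivative bounded_linear_snd\<close>)
  then show ?thesis by (simp add: fd_eq bilinear_lzero[OF bilinear_g[OF assms]])
qed

lemma fd_dL_snd:
  assumes "z \<in> U"
  shows "fd (\<lambda>z. fd L z (0, w)) z \<zeta> = 2 * (dg z \<zeta> w (snd z) + g z w (snd \<zeta>))"
proof -
  have "fd (\<lambda>z. fd L z (0, w)) z = fd (\<lambda>z. 2 * g z w (snd z)) z"
    using open_U assms by (rule fd_cong_open) (rule dL_snd)
  also have "\<dots> = (\<lambda>h. 2 * fd (\<lambda>z. g z w (snd z)) z h)"
  proof (rule fd_eq, intro has_derivative_mult_right fd_works)
    show "(\<lambda>z. g z w (snd z)) differentiable (at z)"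
      by (rule smooth_on_differentiable[OF smooth_on_bilinear_family[OF open_U bilinear_g smooth_g,
              where f = "\<lambda>z. z"] assms])
        (auto intro: smooth_on_ident smooth_on_snd smooth_on_const)
  qed
  finally show ?thesis by (simp add: fd_g_snd assms)
qed

text \<open>The Cartan tensor vanishes on y: a vertical derivative of \<open>dL_snd\<close> is 2
  g(h, w) on the left, and on the right the same Hessian plus twice the term in question.\<close>

lemma dg_snd:
  assumes "z \<in> U"
  shows "dg z (0, h) w (snd z) = 0"
  using fd_dL_snd[OF assms, of w "(0, h)"] g_sym[OF assms, of h w]
  by (simp add: fibre_hessian_def)

lemma dg_sym: "z \<in> U \<Longrightarrow> dg z \<zeta> a b = dg z \<zeta> b a"
  using fd_cong_open[OF open_U, of z "\<lambda>z. g z a b" "\<lambda>z. g z b a"] g_sym by simp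

text \<open>A vertical derivative of g is half a third fibre derivative of L, hence symmetric in its
  directions.\<close>

lemma dg_swap:
  assumes "z \<in> U"
  shows "dg z (0, h) a b = dg z (0, a) h b"
proof -
  have "dg z (0, h) a b = (1/2) * fd (\<lambda>z. fd (\<lambda>z. fd L z (0, b)) z (0, a)) z (0, h)" for h a
    unfolding fibre_hessian_def
    by (subst fd_eq[OF has_derivative_mult_right[OF
        smooth_on_has_derivative[OF smooth_on_fd[OF smooth_dL] assms]]]) simp
  then show ?thesis
    using second_derivative_symmetric[OF open_U smooth_dL assms] by metis
qed

text \<open>By \<open>L_eq\<close>; a base direction leaves the fibre coordinate fixed, so only g
  itself is differentiated.\<close>

lemma dL_fst:
  assumes "z \<in> U"
  shows "fd L z (u, 0) = dg z (u, 0) (snd z) (snd z)"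
proof -
  have "((\<lambda>z. g z (snd z) (snd z)) has_derivative
      (\<lambda>h. dg z h (snd z) (snd z) + g z (snd h) (snd z) + g z (snd z) (snd h))) (at z)"
    by (rule g_has_derivative[where f = "\<lambda>z. z"])
      (use assms in \<open>auto intro: bounded_linear_imp_has_derivative bounded_linear_snd\<close>)
  moreover have "fd L z = fd (\<lambda>z. g z (snd z) (snd z)) z"
    using open_U assms by (rule fd_cong_open) (rule L_eq)
  ultimately show ?thesis
    by (simp add: fd_eq bilinear_lzero[OF bilinear_g[OF assms]] bilinear_rzero[OF bilinear_g[OF assms]])
qed

lemma fd_dL_fst:
  assumes "z \<in> U"
  shows "fd (\<lambda>z. fd L z (u, 0)) z (0, w) = 2 * dg z (u, 0) w (snd z)"
  using second_derivative_symmetric[OF open_U smooth_L assms, of "(u, 0)" "(0, w)"]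
    fd_dL_snd[OF assms, of w "(u, 0)"] bilinear_rzero[OF bilinear_g[OF assms]] by simp

lemma bilinear_dg: "z \<in> U \<Longrightarrow> bilinear (\<lambda>u. dg z (u, 0) w)"
  unfolding bilinear_def
proof (intro conjI allI)
  fix a b assume z: "z \<in> U"
  show "linear (dg z (a, 0) w)"
    by (rule linear_fd_family[OF open_U _ z])
      (use bilinear_g smooth_on_differentiable[OF smooth_g z] in \<open>auto simp: bilinear_def\<close>)
  show "linear (\<lambda>u. dg z (u, 0) w b)"
    using linear_compose[OF linear_Pair_0 linear_dg[OF z]] by (simp add: o_def)
qed

text \<open>The fibre coordinate enters in three places. Its variation in the two arguments gives
  the right-hand side; its variation in the point at which dg is taken contributes nothing, by
  exchange of derivatives and \<open>dg_snd\<close>.\<close>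

lemma fd_dg_snd:
  assumes "z \<in> U"
  shows "fd (\<lambda>z. dg z (snd z, 0) w (snd z)) z (0, u) = dg z (u, 0) w (snd z) + dg z (snd z, 0) w u"
proof -
  define y where "y = snd z"
  have sm: "smooth_on U (\<lambda>z. dg z \<zeta> w b)" for \<zeta> b
    by (rule smooth_on_fd[OF smooth_g])
  have "((\<lambda>z. dg z (snd z, 0) w (snd z)) has_derivative
      (\<lambda>h. fd (\<lambda>z'. dg z' (snd z, 0) w (snd z)) z h + dg z (snd h, 0) w (snd z)
        + dg z (snd z, 0) w (snd h))) (at z)"
    by (rule has_derivative_bilinear_family[OF open_U bilinear_dg, where f = "\<lambda>z. z"])
      (use assms smooth_on_differentiable[OF sm assms] in
        \<open>auto intro: bounded_linear_imp_has_derivative bounded_linear_snd\<close>)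
  then have "fd (\<lambda>z. dg z (snd z, 0) w (snd z)) z (0, u) =
      fd (\<lambda>z. dg z (y, 0) w y) z (0, u) + dg z (u, 0) w (snd z) + dg z (snd z, 0) w u"
    by (simp add: fd_eq y_def)
  also have "fd (\<lambda>z. dg z (y, 0) w y) z (0, u) = fd (\<lambda>z. dg z (0, u) w y) z (y, 0)"
    using second_derivative_symmetric[OF open_U smooth_g assms] .
  also have "\<dots> = 0"
  proof -
    \<comment> \<open>Along this base line the fibre coordinate stays \<open>y\<close>, so
      \<open>dg_snd\<close> holds at all its points in \<open>U\<close> and the derivative along it
      vanishes.\<close>
    have D: "((\<lambda>t. dg (z + t *\<^sub>R (y, 0)) (0, u) w y) has_derivative
        (\<lambda>t. fd (\<lambda>z. dg z (0, u) w y) z (t *\<^sub>R (y, 0)))) (at (0::real))"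
      by (rule has_derivative_compose[where f = "\<lambda>t. z + t *\<^sub>R (y, 0)" and g = "\<lambda>z. dg z (0, u) w y"])
        (use smooth_on_has_derivative[OF sm assms] in
          \<open>auto intro!: derivative_eq_intros simp: zero_prod_def[symmetric]\<close>)
    have "((\<lambda>t. 0) has_derivative
        (\<lambda>t. fd (\<lambda>z. dg z (0, u) w y) z (t *\<^sub>R (y, 0)))) (at (0::real))"
    proof (rule has_derivative_transform_within_open[OF D])
      show "open ((\<lambda>t. z + t *\<^sub>R (y, 0)) -` U)"
        by (intro open_vimage open_U continuous_intros)
      show "dg (z + t *\<^sub>R (y, 0)) (0, u) w y = 0" if "t \<in> (\<lambda>t. z + t *\<^sub>R (y, 0)) -` U" for t
        using dg_snd[of "z + t *\<^sub>R (y, 0)"] that by (simp add: y_def)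
    qed (use assms in \<open>simp add: zero_prod_def[symmetric]\<close>)
    then have "(\<lambda>t. fd (\<lambda>z. dg z (0, u) w y) z (t *\<^sub>R (y, 0))) = (\<lambda>t. 0)"
      using has_derivative_const has_derivative_unique by blast
    from fun_cong[OF this, of 1] show ?thesis by simp
  qed
  finally show ?thesis by simp
qed

end

section \<open>Torsion-free connections and metric equations in coordinates\<close>

locale local_connection =
  fixes U :: "('e::euclidean_space \<times> 'e) set" and \<Gamma> :: "'e \<times> 'e \<Rightarrow> 'e \<Rightarrow> 'e \<Rightarrow> 'e"
  assumes open_dom: "open U"
    and smooth_\<Gamma>: "smooth_on U (\<lambda>z. \<Gamma> z a b)"
    and bilinear_\<Gamma>: "z \<in> U \<Longrightarrow> bilinear (\<Gamma> z)"
    and sym_\<Gamma>: "z \<in> U \<Longrightarrow> \<Gamma> z a b = \<Gamma> z b a"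
begin

abbreviation d\<Gamma> :: "'e \<times> 'e \<Rightarrow> 'e \<times> 'e \<Rightarrow> 'e \<Rightarrow> 'e \<Rightarrow> 'e" where
  "d\<Gamma> z \<zeta> a b \<equiv> fd (\<lambda>z. \<Gamma> z a b) z \<zeta>"

lemma \<Gamma>_has_derivative:
  assumes "f x \<in> U" "(f has_derivative f') (at x)" "(a has_derivative a') (at x)"
    "(b has_derivative b') (at x)"
  shows "((\<lambda>y. \<Gamma> (f y) (a y) (b y)) has_derivative
    (\<lambda>h. d\<Gamma> (f x) (f' h) (a x) (b x) + \<Gamma> (f x) (a' h) (b x) + \<Gamma> (f x) (a x) (b' h))) (at x)"
  by (rule has_derivative_bilinear_family[where T = \<Gamma>, OF open_dom bilinear_\<Gamma> _ assms])
    (auto intro: smooth_on_differentiable[OF smooth_\<Gamma> assms(1)])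

lemma d\<Gamma>_sym: "z \<in> U \<Longrightarrow> d\<Gamma> z \<zeta> a b = d\<Gamma> z \<zeta> b a"
  using fd_cong_open[OF open_dom, of z "\<lambda>z. \<Gamma> z a b" "\<lambda>z. \<Gamma> z b a"] sym_\<Gamma> by simp

lemma linear_d\<Gamma>: "z \<in> U \<Longrightarrow> linear (\<lambda>\<zeta>. d\<Gamma> z \<zeta> a b)"
  using smooth_on_linear_fd[OF smooth_\<Gamma>] .

end

text \<open>\<open>(u, - \<Gamma> z u (snd z))\<close> is the horizontal lift of \<open>u\<close>,
  so \<open>metric\<close> is the coordinate form of \<nabla>g = Q. The case Q = 0 is the
  Levi-Civita-Chern connection, which allows both connections to be treated alike.\<close>

locale local_metric_connection = local_finsler U L + local_connection U \<Gamma>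
  for U :: "('e::euclidean_space \<times> 'e) set" and L \<Gamma> +
  fixes Q :: "'e \<times> 'e \<Rightarrow> 'e \<Rightarrow> 'e \<Rightarrow> 'e \<Rightarrow> real"
  assumes metric: "z \<in> U \<Longrightarrow> dg z (u, - \<Gamma> z u (snd z)) w k =
      g z (\<Gamma> z u w) k + g z w (\<Gamma> z u k) + Q z u w k"
    and Q1: "z \<in> U \<Longrightarrow> Q z (snd z) w k = 0"
    and Q3: "z \<in> U \<Longrightarrow> Q z u w (snd z) = 0"
begin

lemma dg_split:
  assumes "z \<in> U"
  shows "dg z (u, h) w k = dg z (u, 0) w k + dg z (0, h) w k"
  using linear_add[OF linear_dg[OF assms, of w k], of "(u, 0)" "(0, h)"] by simp

text \<open>With y as an argument of g the vertical part of the horizontal lift drops out by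
  \<open>dg_snd\<close>, leaving a pure base derivative.\<close>

lemma metric_snd:
  assumes "z \<in> U"
  shows "dg z (u, 0) w (snd z) = g z (\<Gamma> z u w) (snd z) + g z w (\<Gamma> z u (snd z))"
  using metric[OF assms, where u = u and w = w and k = "snd z"]
    dg_split[OF assms, where u = u and h = "- \<Gamma> z u (snd z)"] dg_snd[OF assms] Q3[OF assms]
  by simp

lemma dL_fst_\<Gamma>: "z \<in> U \<Longrightarrow> fd L z (u, 0) = 2 * g z (\<Gamma> z u (snd z)) (snd z)"
  using dL_fst[of z u] metric_snd[where z = z and u = u and w = "snd z"] g_sym[of z "snd z"] by simp

lemma fd_\<Gamma>_snd:
  assumes "z \<in> U"
  shows "((\<lambda>z. \<Gamma> z u (snd z)) has_derivative (\<lambda>h. d\<Gamma> z h u (snd z) + \<Gamma> z u (snd h))) (at z)"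
  using \<Gamma>_has_derivative[where f = "\<lambda>z. z" and a = "\<lambda>z. u" and b = snd and x = z, OF assms
      has_derivative_ident has_derivative_const bounded_linear_imp_has_derivative[OF bounded_linear_snd]]
  by (simp add: bilinear_lzero[OF bilinear_\<Gamma>[OF assms]])

text \<open>In the vertical derivative of \<open>dL_fst_\<Gamma>\<close> the undifferentiated
  \<Gamma> occurs in exactly the two terms of \<open>metric_snd\<close>; subtracting that equation
  leaves the claim.\<close>

lemma g_vertical_derivative_snd:
  assumes "z \<in> U"
  shows "g z (d\<Gamma> z (0, w) u (snd z)) (snd z) = 0"
proof -
  note b = bilinear_g[OF assms]
  have "((\<lambda>z. g z (\<Gamma> z u (snd z)) (snd z)) has_derivative
      (\<lambda>h. dg z h (\<Gamma> z u (snd z)) (snd z) + g z (d\<Gamma> z h u (snd z) + \<Gamma> z u (snd h)) (snd z)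
        + g z (\<Gamma> z u (snd z)) (snd h))) (at z)"
    by (rule g_has_derivative[where f = "\<lambda>z. z"])
      (use assms fd_\<Gamma>_snd in \<open>auto intro: bounded_linear_imp_has_derivative bounded_linear_snd\<close>)
  from has_derivative_mult_right[OF this, of 2]
  have "fd (\<lambda>z. 2 * g z (\<Gamma> z u (snd z)) (snd z)) z (0, w) =
      2 * (dg z (0, w) (\<Gamma> z u (snd z)) (snd z) + g z (d\<Gamma> z (0, w) u (snd z) + \<Gamma> z u w) (snd z)
        + g z (\<Gamma> z u (snd z)) w)"
    by (simp add: fd_eq)
  moreover have "fd (\<lambda>z. fd L z (u, 0)) z = fd (\<lambda>z. 2 * g z (\<Gamma> z u (snd z)) (snd z)) z"
    using open_U assms by (rule fd_cong_open) (rule dL_fst_\<Gamma>)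
  ultimately have "dg z (u, 0) w (snd z) =
      g z (d\<Gamma> z (0, w) u (snd z)) (snd z) + g z (\<Gamma> z u w) (snd z) + g z (\<Gamma> z u (snd z)) w"
    using fd_dL_fst[OF assms, of u w] dg_snd[OF assms] by (simp add: bilinear_ladd[OF b])
  then show ?thesis
    using metric_snd[OF assms, where u = u and w = w] g_sym[OF assms] by simp
qed

text \<open>In \<open>metric_snd\<close> with u = y, the term g(\<Gamma>(y, w), y) is half of the
  base derivative of L along w, by the symmetry of \<Gamma>. The right-hand side involves L alone,
  so the spray \<Gamma>(y, y) does not depend on the connection.\<close>

lemma g_spray:
  assumes "z \<in> U"
  shows "g z w (\<Gamma> z (snd z) (snd z)) = dg z (snd z, 0) w (snd z) - (1/2) * fd L z (w, 0)"
  using metric_snd[OF assms, where u = "snd z" and w = w] dL_fst_\<Gamma>[OF assms, of w] sym_\<Gamma>[OF assms, of w]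
  by simp

lemma vertical_derivative_snd_snd:
  assumes z: "z \<in> U"
  shows "d\<Gamma> z (0, u) (snd z) (snd z) = 0"
proof (rule g_eq_zeroD[OF assms])
  fix w
  define y where "y = snd z"
  note b = bilinear_g[OF assms]
  have 1: "((\<lambda>z. \<Gamma> z (snd z) (snd z)) has_derivative
      (\<lambda>h. d\<Gamma> z h y y + \<Gamma> z (snd h) y + \<Gamma> z y (snd h))) (at z)"
    unfolding y_def by (rule \<Gamma>_has_derivative[where f = "\<lambda>z. z"])
      (use assms in \<open>auto intro: bounded_linear_imp_has_derivative bounded_linear_snd\<close>)
  have "((\<lambda>z. g z w (\<Gamma> z (snd z) (snd z))) has_derivative
      (\<lambda>h. dg z h w (\<Gamma> z y y) + g z 0 (\<Gamma> z y y) + g z w (d\<Gamma> z h y y + \<Gamma> z (snd h) y + \<Gamma> z y (snd h))))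
      (at z)"
    unfolding y_def
    by (rule g_has_derivative[where f = "\<lambda>z. z"]) (use assms 1 in \<open>auto simp: y_def\<close>)
  then have "fd (\<lambda>z. g z w (\<Gamma> z (snd z) (snd z))) z (0, u) =
      dg z (0, u) w (\<Gamma> z y y) + g z w (d\<Gamma> z (0, u) y y) + 2 * g z w (\<Gamma> z u y)"
    by (simp add: fd_eq bilinear_lzero[OF b] bilinear_radd[OF b] sym_\<Gamma>[OF z, of y u])
  moreover have "fd (\<lambda>z. g z w (\<Gamma> z (snd z) (snd z))) z =
      fd (\<lambda>z. dg z (snd z, 0) w (snd z) - (1/2) * fd L z (w, 0)) z"
    using open_U assms by (rule fd_cong_open) (rule g_spray)
  moreover have "fd (\<lambda>z. dg z (snd z, 0) w (snd z) - (1/2) * fd L z (w, 0)) z (0, u) =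
      fd (\<lambda>z. dg z (snd z, 0) w (snd z)) z (0, u) - (1/2) * fd (\<lambda>z. fd L z (w, 0)) z (0, u)"
  proof -
    have sm: "smooth_on U (\<lambda>z. dg z (snd z, 0) w (snd z))"
      by (rule smooth_on_bilinear_family[OF open_U bilinear_dg, where f = "\<lambda>z. z"])
        (auto intro: smooth_on_ident smooth_on_snd smooth_on_fd smooth_g)
    show ?thesis
      by (subst fd_eq[OF has_derivative_diff[OF smooth_on_has_derivative[OF sm z]
            has_derivative_mult_right[OF smooth_on_has_derivative[OF smooth_dL z]]]]) simp
  qed
  ultimately have 2: "dg z (0, u) w (\<Gamma> z y y) + g z w (d\<Gamma> z (0, u) y y) + 2 * g z w (\<Gamma> z u y) =
      dg z (u, 0) w y + dg z (y, 0) w u - dg z (w, 0) u y"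
    using fd_dg_snd[OF z, of w u] fd_dL_fst[OF z, of w u] by (simp add: y_def)
  \<comment> \<open>The symmetry of the Cartan tensor moves \<Gamma>(y, y) into the direction of
    differentiation, where it is the vertical part of the horizontal lift of y up to sign. Then
    \<open>metric\<close> in direction y eliminates it, and the remaining \<Gamma> terms cancel in
    pairs.\<close>
  have "dg z (0, u) w (\<Gamma> z y y) = dg z (0, \<Gamma> z y y) w u"
    using dg_swap[OF z] dg_sym[OF z] by metis
  moreover have "dg z (y, 0) w u - dg z (0, \<Gamma> z y y) w u = g z (\<Gamma> z w y) u + g z w (\<Gamma> z u y)"
    using metric[OF z, where u = y and w = w and k = u] dg_split[OF z, where u = y and h = "- \<Gamma> z y y"] Q1[OF z]
      linear_neg[OF linear_dg[OF z, of w u], of "(0, \<Gamma> z y y)"] sym_\<Gamma>[OF z, of y w] sym_\<Gamma>[OF z, of y u] by (simp add: y_def)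
  ultimately have "g z w (d\<Gamma> z (0, u) y y) = 0"
    using 2 metric_snd[OF z, where u = u and w = w] metric_snd[OF z, where u = w and w = u] sym_\<Gamma>[OF z, of u w]
      g_sym[OF z, of _ u] by (simp add: y_def)
  then show "g z w (d\<Gamma> z (0, u) (snd z) (snd z)) = 0" by (simp add: y_def)
qed

end

text \<open>The usual coordinate formula for the curvature, with the Christoffel symbols
  differentiated along the horizontal lifts of \<open>a\<close> and \<open>b\<close> instead of
  along the base.\<close>

definition local_curvature ::
  "('e::euclidean_space \<times> 'e \<Rightarrow> 'e \<Rightarrow> 'e \<Rightarrow> 'e) \<Rightarrow> 'e \<times> 'e \<Rightarrow> 'e \<Rightarrow> 'e \<Rightarrow> 'e \<Rightarrow> 'e" where
  "local_curvature \<Gamma> z a b k =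
     fd (\<lambda>z. \<Gamma> z b k) z (a, - \<Gamma> z a (snd z)) - fd (\<lambda>z. \<Gamma> z a k) z (b, - \<Gamma> z b (snd z))
     + \<Gamma> z a (\<Gamma> z b k) - \<Gamma> z b (\<Gamma> z a k)"

text \<open>The second covariant derivative of the variation field of a family of geodesics is compared
  with the derivative of the geodesic equation in the direction of the parameter.\<close>

lemma (in local_metric_connection) local_jacobi:
  fixes f :: "real \<times> real \<Rightarrow> 'e"
  defines "y \<equiv> \<lambda>w. fd f w (0, 1)" and "b \<equiv> \<lambda>w. fd f w (1, 0)"
  defines "DJ \<equiv> \<lambda>w. fd b w (0, 1) + \<Gamma> (f w, y w) (y w) (b w)"
  assumes W: "open W" "w \<in> W" and f: "smooth_on W f"
    and inU: "\<And>w. w \<in> W \<Longrightarrow> (f w, y w) \<in> U"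
    and geodesic: "\<And>w. w \<in> W \<Longrightarrow> fd y w (0, 1) + \<Gamma> (f w, y w) (y w) (y w) = 0"
  shows "fd DJ w (0, 1) + \<Gamma> (f w, y w) (y w) (DJ w) = local_curvature \<Gamma> (f w, y w) (y w) (b w) (y w)"
proof -
  have sy: "smooth_on W y" and sb: "smooth_on W b"
    unfolding y_def b_def by (rule smooth_on_fd[OF f])+
  have syt: "smooth_on W (\<lambda>w. fd y w (0, 1))" and sbt: "smooth_on W (\<lambda>w. fd b w (0, 1))"
    using smooth_on_fd[OF sy] smooth_on_fd[OF sb] by auto
  define z where "z = (\<lambda>w. (f w, y w))"
  define q where "q = (\<lambda>w. fd b w (0, 1))"
  define r where "r = fd q w (0, 1)"
  have zU: "z w \<in> U" using inU W by (simp add: z_def)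
  have z': "(z has_derivative (\<lambda>h. (fd f w h, fd y w h))) (at w)"
    unfolding z_def using W(2) by (intro has_derivative_Pair smooth_on_has_derivative[OF f] smooth_on_has_derivative[OF sy])
  have yq: "fd y x (1, 0) = q x" if "x \<in> W" for x
    unfolding q_def y_def b_def using second_derivative_symmetric[OF W(1) f that] .
  have ytt: "fd y w (0, 1) = - \<Gamma> (z w) (y w) (y w)"
    using geodesic[OF W(2)] by (simp add: z_def eq_neg_iff_add_eq_0)
  note bil = bilinear_\<Gamma>[OF zU]
  have 1: "((\<lambda>w. fd y w (0, 1) + \<Gamma> (z w) (y w) (y w)) has_derivative
      (\<lambda>h. fd (\<lambda>w. fd y w (0, 1)) w h + (d\<Gamma> (z w) (fd f w h, fd y w h) (y w) (y w)
        + \<Gamma> (z w) (fd y w h) (y w) + \<Gamma> (z w) (y w) (fd y w h)))) (at w)"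
    using W(2) by (intro has_derivative_add smooth_on_has_derivative[OF syt]
        \<Gamma>_has_derivative[OF zU z'] smooth_on_has_derivative[OF sy])
  have "fd (\<lambda>w. fd y w (0, 1) + \<Gamma> (z w) (y w) (y w)) w = fd (\<lambda>w. 0) w"
    using W by (rule fd_cong_open) (use geodesic in \<open>simp add: z_def\<close>)
  with fd_eq[OF 1] have "fd (\<lambda>w. fd y w (0, 1)) w (1, 0) + (d\<Gamma> (z w) (b w, q w) (y w) (y w)
      + \<Gamma> (z w) (q w) (y w) + \<Gamma> (z w) (y w) (q w)) = 0"
    using fun_cong[of "\<lambda>h. fd (\<lambda>w. fd y w (0, 1)) w h + (d\<Gamma> (z w) (fd f w h, fd y w h) (y w) (y w)
        + \<Gamma> (z w) (fd y w h) (y w) + \<Gamma> (z w) (y w) (fd y w h))" "\<lambda>h. 0" "(1, 0)"]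
    by (simp add: yq[OF W(2)] b_def)
  moreover have "fd (\<lambda>w. fd y w (0, 1)) w (1, 0) = r"
  proof -
    have "fd (\<lambda>w. fd y w (0, 1)) w (1, 0) = fd (\<lambda>w. fd y w (1, 0)) w (0, 1)"
      using second_derivative_symmetric[OF W(1) sy W(2)] .
    also have "fd (\<lambda>w. fd y w (1, 0)) w = fd q w"
      using W by (rule fd_cong_open) (rule yq)
    finally show ?thesis by (simp add: r_def)
  qed
  \<comment> \<open>The linearised geodesic equation differentiates \<Gamma> along (b, q), the
    curvature along the horizontal lift of b. The two directions differ by a vertical one, in which
    the derivative of \<Gamma> on the arguments y, y vanishes by
    \<open>vertical_derivative_snd_snd\<close>.\<close>
  moreover have "d\<Gamma> (z w) (b w, q w) (y w) (y w) = d\<Gamma> (z w) (b w, k) (y w) (y w)" for k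
  proof -
    have "d\<Gamma> (z w) (b w, k) (y w) (y w) = d\<Gamma> (z w) (b w, 0) (y w) (y w)" for k
      using linear_add[OF linear_d\<Gamma>[OF zU, of "y w" "y w"], of "(b w, 0)" "(0, k)"]
        vertical_derivative_snd_snd[OF zU, of k] by (simp add: z_def)
    then show ?thesis by metis
  qed
  ultimately have r: "r + (d\<Gamma> (z w) (b w, - \<Gamma> (z w) (b w) (y w)) (y w) (y w)
      + \<Gamma> (z w) (q w) (y w) + \<Gamma> (z w) (y w) (q w)) = 0"
    by metis
  have DJ: "DJ = (\<lambda>w. q w + \<Gamma> (z w) (y w) (b w))"
    by (simp add: DJ_def q_def z_def)
  have "(DJ has_derivative
      (\<lambda>h. fd q w h + (d\<Gamma> (z w) (fd f w h, fd y w h) (y w) (b w)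
        + \<Gamma> (z w) (fd y w h) (b w) + \<Gamma> (z w) (y w) (fd b w h)))) (at w)"
    unfolding DJ using W(2) by (intro has_derivative_add smooth_on_has_derivative[OF sbt[folded q_def]]
        \<Gamma>_has_derivative[OF zU z'] smooth_on_has_derivative[OF sy] smooth_on_has_derivative[OF sb])
  then have "fd DJ w (0, 1) = r + (d\<Gamma> (z w) (y w, - \<Gamma> (z w) (y w) (y w)) (y w) (b w)
        + \<Gamma> (z w) (- \<Gamma> (z w) (y w) (y w)) (b w) + \<Gamma> (z w) (y w) (q w))"
    by (simp add: fd_eq ytt r_def q_def fun_cong[OF y_def[THEN meta_eq_to_obj_eq], symmetric])
  moreover have zw: "(f w, y w) = z w" "snd (z w) = y w"
    by (simp_all add: z_def)
  ultimately show ?thesis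
    using r[folded eq_neg_iff_add_eq_0] unfolding local_curvature_def zw
    by (simp add: fun_cong[OF DJ, of w] bilinear_radd[OF bil] bilinear_lneg[OF bil]
        sym_\<Gamma>[OF zU, of "b w"] sym_\<Gamma>[OF zU, of "q w"] d\<Gamma>_sym[OF zU, where a = "y w" and b = "b w"]
        algebra_simps)
qed

section \<open>Comparison of two connections in coordinates\<close>

locale local_metric_connection_pair =
  C: local_metric_connection U L \<Gamma> Q + C': local_metric_connection U L \<Gamma>' Q'
  for U :: "('e::euclidean_space \<times> 'e) set" and L \<Gamma> Q \<Gamma>' Q'
begin

lemma g_agree:
  assumes z: "z \<in> U"
  shows "C.g z (\<Gamma>' z u w - \<Gamma> z u w) (snd z) + C.g z w (\<Gamma>' z u (snd z) - \<Gamma> z u (snd z)) = 0"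
  using C.metric_snd[OF z, where u = u and w = w] C'.metric_snd[OF z, where u = u and w = w]
  by (simp add: bilinear_lsub[OF C.bilinear_g[OF z]] bilinear_rsub[OF C.bilinear_g[OF z]])

text \<open>Antisymmetry of H(y, .) comes from \<open>metric\<close> in direction y. There the
  derivatives of g have to cancel, so the equality of the sprays, a consequence of
  \<open>g_spray\<close>, is established first. Symmetry comes from \<open>g_agree\<close>, whose
  first term is symmetric in \<open>u\<close> and \<open>w\<close>.\<close>

lemma \<Gamma>_snd_agree:
  assumes z: "z \<in> U"
  shows "\<Gamma>' z u (snd z) = \<Gamma> z u (snd z)"
proof -
  define y where "y = snd z"
  define H where "H = (\<lambda>a b. \<Gamma>' z a b - \<Gamma> z a b)"
  note b = C.bilinear_g[OF z]
  have "C.g z w (\<Gamma>' z y y) = C.g z w (\<Gamma> z y y)" for w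
    using C.g_spray[OF z, of w] C'.g_spray[OF z, of w] by (simp add: y_def)
  then have G: "\<Gamma>' z y y = \<Gamma> z y y"
    using C.g_eq_zeroD[OF z, of "\<Gamma>' z y y - \<Gamma> z y y"] by (simp add: bilinear_rsub[OF b])
  have sym: "H a b = H b a" for a b
    using C.sym_\<Gamma>[OF z] C'.sym_\<Gamma>[OF z] by (simp add: H_def)
  have "C.g z (H y w) k + C.g z w (H y k) = 0" for w k
    using C.metric[OF z, where u = y and w = w and k = k] C'.metric[OF z, where u = y and w = w and k = k] C.Q1[OF z] C'.Q1[OF z] G
    by (simp add: H_def y_def bilinear_lsub[OF b] bilinear_rsub[OF b])
  moreover have "C.g z (H a w) y + C.g z w (H a y) = 0" for a w
    using g_agree[OF z] by (simp add: H_def y_def)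
  ultimately have "C.g z w (H u y) = 0" for w
    using sym C.g_sym[OF z] by (smt (verit))
  then show ?thesis
    using C.g_eq_zeroD[OF z, of "H u y"] by (simp add: H_def y_def)
qed

lemma \<Gamma>_snd_agree': "z \<in> U \<Longrightarrow> \<Gamma>' z (snd z) u = \<Gamma> z (snd z) u"
  using \<Gamma>_snd_agree C.sym_\<Gamma> C'.sym_\<Gamma> by metis

lemma g_\<Gamma>_agree: "z \<in> U \<Longrightarrow> C.g z (\<Gamma>' z u w - \<Gamma> z u w) (snd z) = 0"
  using g_agree[of z u w] \<Gamma>_snd_agree[of z u] bilinear_rzero[OF C.bilinear_g] by simp

text \<open>The derivative of \<open>\<Gamma>_snd_agree\<close> in an arbitrary direction; the
  argument y moves too, whence the undifferentiated terms.\<close>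

lemma d\<Gamma>_snd_agree:
  assumes z: "z \<in> U"
  shows "C'.d\<Gamma> z \<zeta> u (snd z) + \<Gamma>' z u (snd \<zeta>) = C.d\<Gamma> z \<zeta> u (snd z) + \<Gamma> z u (snd \<zeta>)"
proof -
  have "fd (\<lambda>z. \<Gamma>' z u (snd z)) z = fd (\<lambda>z. \<Gamma> z u (snd z)) z"
    using C.open_U z by (rule fd_cong_open) (rule \<Gamma>_snd_agree)
  from fun_cong[OF this, of \<zeta>] show ?thesis
    by (simp add: fd_eq[OF C.fd_\<Gamma>_snd[OF z]] fd_eq[OF C'.fd_\<Gamma>_snd[OF z]])
qed

text \<open>The four terms of the curvature form two pairs, each an instance of
  \<open>d\<Gamma>_snd_agree\<close> along the horizontal lift of y or of \<open>b\<close>; both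
  connections have the same horizontal lifts.\<close>

lemma local_curvature_jacobi:
  assumes z: "z \<in> U"
  shows "local_curvature \<Gamma>' z (snd z) b (snd z) = local_curvature \<Gamma> z (snd z) b (snd z)"
  unfolding local_curvature_def
  using d\<Gamma>_snd_agree[OF z, where \<zeta> = "(snd z, - \<Gamma> z (snd z) (snd z))" and u = b]
    d\<Gamma>_snd_agree[OF z, where \<zeta> = "(b, - \<Gamma> z b (snd z))" and u = "snd z"]
  by (simp add: \<Gamma>_snd_agree[OF z] \<Gamma>_snd_agree'[OF z] bilinear_rneg[OF C.bilinear_\<Gamma>[OF z]]
      bilinear_rneg[OF C'.bilinear_\<Gamma>[OF z]] algebra_simps)

text \<open>With H = \<Gamma>' - \<Gamma>, the difference of the curvatures is the derivative of
  H(w, w) along the horizontal lift \<zeta> of y, with w fixed, plus N h minus 2 H(w, N w). The last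
  term is orthogonal to y by \<open>g_\<Gamma>_agree\<close>. Differentiating g(H(w, w), y) = 0
  along \<zeta> shows that the first two cancel when paired with y.\<close>

lemma g_local_curvature_agree:
  assumes z: "z \<in> U"
  shows "C.g z (local_curvature \<Gamma>' z (snd z) w w) (snd z) =
    C.g z (local_curvature \<Gamma> z (snd z) w w) (snd z)"
proof -
  define y where "y = snd z"
  define N where "N = (\<lambda>a. \<Gamma> z a y)"
  define h where "h = \<Gamma>' z w w - \<Gamma> z w w"
  note b = C.bilinear_g[OF z]
  have N: "\<Gamma> z a y = N a" "\<Gamma>' z a y = N a" "\<Gamma> z y a = N a" "\<Gamma>' z y a = N a" for a
    using \<Gamma>_snd_agree[OF z] \<Gamma>_snd_agree'[OF z] C.sym_\<Gamma>[OF z] by (simp_all add: N_def y_def)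
  define \<zeta> where "\<zeta> = (y, - N y)"
  define \<xi> where "\<xi> = (w, - N w)"
  have D: "((\<lambda>z. \<Gamma>' z w w - \<Gamma> z w w) has_derivative
      (\<lambda>h. C'.d\<Gamma> z h w w - C.d\<Gamma> z h w w)) (at z)"
    by (intro has_derivative_diff smooth_on_has_derivative[OF C.smooth_\<Gamma> z]
        smooth_on_has_derivative[OF C'.smooth_\<Gamma> z])
  have "((\<lambda>z. C.g z (\<Gamma>' z w w - \<Gamma> z w w) (snd z)) has_derivative
      (\<lambda>k. C.dg z k h y + C.g z (C'.d\<Gamma> z k w w - C.d\<Gamma> z k w w) y + C.g z h (snd k))) (at z)"
    unfolding h_def y_def by (rule C.g_has_derivative[where f = "\<lambda>z. z"])
      (use z D in \<open>auto intro: bounded_linear_imp_has_derivative bounded_linear_snd\<close>)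
  then have "fd (\<lambda>z. C.g z (\<Gamma>' z w w - \<Gamma> z w w) (snd z)) z \<zeta> =
      C.dg z \<zeta> h y + C.g z (C'.d\<Gamma> z \<zeta> w w - C.d\<Gamma> z \<zeta> w w) y - C.g z h (N y)"
    by (simp add: fd_eq \<zeta>_def bilinear_rneg[OF b])
  moreover have "fd (\<lambda>z. C.g z (\<Gamma>' z w w - \<Gamma> z w w) (snd z)) z = fd (\<lambda>z. 0) z"
    using C.open_U z by (rule fd_cong_open) (rule g_\<Gamma>_agree)
  \<comment> \<open>\<open>metric\<close> in direction y evaluates the derivative of g along
    \<zeta>; its term g(h, N y) cancels the one that comes from the motion of the fibre
    coordinate.\<close>
  moreover have "C.dg z \<zeta> h y = C.g z (N h) y + C.g z h (N y)"
    using C.metric[OF z, where u = y and w = h and k = y] C.Q3[OF z] by (simp add: N[unfolded y_def] \<zeta>_def y_def)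
  ultimately have 1: "C.g z (C'.d\<Gamma> z \<zeta> w w - C.d\<Gamma> z \<zeta> w w) y = - C.g z (N h) y"
    by simp
  have "C'.d\<Gamma> z \<xi> y w - C.d\<Gamma> z \<xi> y w = \<Gamma>' z w (N w) - \<Gamma> z w (N w)"
    using d\<Gamma>_snd_agree[OF z, where \<zeta> = \<xi> and u = w] C.d\<Gamma>_sym[OF z, where \<zeta> = \<xi> and a = y and b = w] C'.d\<Gamma>_sym[OF z, where \<zeta> = \<xi> and a = y and b = w]
    by (simp add: \<xi>_def y_def bilinear_rneg[OF C.bilinear_\<Gamma>[OF z]]
        bilinear_rneg[OF C'.bilinear_\<Gamma>[OF z]] algebra_simps)
  \<comment> \<open>One copy of H(w, N w) comes from the derivatives along \<xi>, the other from the
    last product of Christoffel symbols.\<close>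
  then have "local_curvature \<Gamma>' z y w w - local_curvature \<Gamma> z y w w =
      (C'.d\<Gamma> z \<zeta> w w - C.d\<Gamma> z \<zeta> w w) + N h
      - (\<Gamma>' z w (N w) - \<Gamma> z w (N w)) - (\<Gamma>' z w (N w) - \<Gamma> z w (N w))"
    unfolding local_curvature_def
    by (simp add: N y_def[symmetric] \<zeta>_def[symmetric] \<xi>_def[symmetric] h_def)
      (simp add: N(3)[symmetric] bilinear_rsub[OF C.bilinear_\<Gamma>[OF z]] algebra_simps)
  then have "C.g z (local_curvature \<Gamma>' z y w w - local_curvature \<Gamma> z y w w) y = 0"
    using 1 g_\<Gamma>_agree[OF z, of w "N w"] by (simp add: bilinear_ladd[OF b] bilinear_lsub[OF b] y_def)
  then show ?thesis by (simp add: bilinear_lsub[OF b] y_def)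
qed

end

section \<open>Smooth manifolds: charts and cut-offs\<close>

locale manifold =
  fixes \<A> :: "('m::{t2_space, second_countable_topology}, 'e::euclidean_space) atlas"
  assumes atlas: "smooth_atlas \<A>"
begin

lemma chart_homeo: "c \<in> \<A> \<Longrightarrow> homeomorphism (fst c) (snd c ` fst c) (snd c) (chart_inv c)"
  using atlas by (auto simp: smooth_atlas_def)

lemma open_fst: "c \<in> \<A> \<Longrightarrow> open (fst c)" and open_img: "c \<in> \<A> \<Longrightarrow> open (snd c ` fst c)"
  using atlas by (auto simp: smooth_atlas_def)

lemma chart_inv_snd [simp]: "c \<in> \<A> \<Longrightarrow> p \<in> fst c \<Longrightarrow> chart_inv c (snd c p) = p"
  using chart_homeo by (auto simp: homeomorphism_def)

lemma chart_inv_in: "c \<in> \<A> \<Longrightarrow> x \<in> snd c ` fst c \<Longrightarrow> chart_inv c x \<in> fst c"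
  and snd_chart_inv: "c \<in> \<A> \<Longrightarrow> x \<in> snd c ` fst c \<Longrightarrow> snd c (chart_inv c x) = x"
  by auto

lemma open_chart_image:
  assumes "c \<in> \<A>" "open N" "N \<subseteq> fst c"
  shows "open (snd c ` N)"
proof -
  have "open (snd c ` fst c \<inter> chart_inv c -` N)"
    using chart_homeo[OF assms(1)] open_img[OF assms(1)] assms(2)
    by (intro continuous_open_preimage) (auto simp: homeomorphism_def)
  moreover have "snd c ` fst c \<inter> chart_inv c -` N = snd c ` N"
    using assms by (auto simp: image_iff subset_iff)
  ultimately show ?thesis by simp
qed

lemma smooth_transition:
  "c \<in> \<A> \<Longrightarrow> d \<in> \<A> \<Longrightarrow> smooth_on (snd c ` (fst c \<inter> fst d)) (\<lambda>x. snd d (chart_inv c x))"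
  using atlas by (auto simp: smooth_atlas_def o_def)

lemma open_overlap: "c \<in> \<A> \<Longrightarrow> d \<in> \<A> \<Longrightarrow> open (snd c ` (fst c \<inter> fst d))"
  by (intro open_chart_image open_Int open_fst) auto

lemma chart_at: "chart_at \<A> p \<in> \<A>" "p \<in> fst (chart_at \<A> p)"
proof -
  have "p \<in> (\<Union>c\<in>\<A>. fst c)"
    using atlas by (simp add: smooth_atlas_def)
  then have "\<exists>c. c \<in> \<A> \<and> p \<in> fst c" by blast
  from someI_ex[OF this] show "chart_at \<A> p \<in> \<A>" "p \<in> fst (chart_at \<A> p)"
    unfolding chart_at_def by auto
qed

lemma coord_change_eq: "coord_change c d p = fd (\<lambda>x. snd d (chart_inv c x)) (snd c p)"
  by (simp add: coord_change_def o_def)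

lemma transition_has_derivative:
  assumes "c \<in> \<A>" "d \<in> \<A>" "p \<in> fst c" "p \<in> fst d"
  shows "((\<lambda>x. snd d (chart_inv c x)) has_derivative coord_change c d p) (at (snd c p))"
  unfolding coord_change_eq
  by (rule smooth_on_has_derivative[OF smooth_transition]) (use assms in auto)

lemma linear_coord_change:
  "c \<in> \<A> \<Longrightarrow> d \<in> \<A> \<Longrightarrow> p \<in> fst c \<Longrightarrow> p \<in> fst d \<Longrightarrow> linear (coord_change c d p)"
  using transition_has_derivative has_derivative_linear by blast

lemma coord_change_trans:
  assumes "c \<in> \<A>" "d \<in> \<A>" "e \<in> \<A>" "p \<in> fst c" "p \<in> fst d" "p \<in> fst e"
  shows "coord_change d e p (coord_change c d p a) = coord_change c e p a"
proof -
  have "((\<lambda>x. snd e (chart_inv d (snd d (chart_inv c x)))) has_derivative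
      (\<lambda>a. coord_change d e p (coord_change c d p a))) (at (snd c p))"
    by (rule has_derivative_compose[where f = "\<lambda>x. snd d (chart_inv c x)" and g = "\<lambda>x. snd e (chart_inv d x)"])
      (use assms transition_has_derivative in auto)
  then have "((\<lambda>x. snd e (chart_inv c x)) has_derivative
      (\<lambda>a. coord_change d e p (coord_change c d p a))) (at (snd c p))"
    by (rule has_derivative_transform_within_open[OF _ open_overlap[OF assms(1,2)]])
      (use assms in auto)
  then show ?thesis
    by (simp add: coord_change_eq[of c e] fd_eq)
qed

lemma coord_change_same:
  assumes "c \<in> \<A>" "p \<in> fst c"
  shows "coord_change c c p = (\<lambda>a. a)"
proof -
  have "((\<lambda>x. snd c (chart_inv c x)) has_derivative (\<lambda>a. a)) (at (snd c p))"
    by (rule has_derivative_transform_within_open[OF has_derivative_ident open_img[OF assms(1)]])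
      (use assms in auto)
  then show ?thesis by (simp add: coord_change_eq fd_eq)
qed

lemma to_chart_at [simp]: "to_chart \<A> (chart_at \<A> p) p = (\<lambda>a. a)"
  and from_chart_at [simp]: "from_chart \<A> (chart_at \<A> p) p = (\<lambda>a. a)"
  by (simp_all add: to_chart_def from_chart_def coord_change_same chart_at)

lemma to_from_chart [simp]: "c \<in> \<A> \<Longrightarrow> p \<in> fst c \<Longrightarrow> to_chart \<A> c p (from_chart \<A> c p a) = a"
  and from_to_chart [simp]: "c \<in> \<A> \<Longrightarrow> p \<in> fst c \<Longrightarrow> from_chart \<A> c p (to_chart \<A> c p a) = a"
  by (simp_all add: to_chart_def from_chart_def coord_change_trans coord_change_same chart_at)

lemma linear_to_chart: "c \<in> \<A> \<Longrightarrow> p \<in> fst c \<Longrightarrow> linear (to_chart \<A> c p)"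
  and linear_from_chart: "c \<in> \<A> \<Longrightarrow> p \<in> fst c \<Longrightarrow> linear (from_chart \<A> c p)"
  by (simp_all add: to_chart_def from_chart_def linear_coord_change chart_at)

lemma coord_change_to_chart:
  "c \<in> \<A> \<Longrightarrow> d \<in> \<A> \<Longrightarrow> p \<in> fst c \<Longrightarrow> p \<in> fst d \<Longrightarrow>
    coord_change c d p (to_chart \<A> c p a) = to_chart \<A> d p a"
  by (simp add: to_chart_def coord_change_trans chart_at)

lemma smooth_coord_change:
  assumes "c \<in> \<A>" "d \<in> \<A>" "open S" "smooth_on S f" "smooth_on S a" "f ` S \<subseteq> snd c ` (fst c \<inter> fst d)"
  shows "smooth_on S (\<lambda>x. coord_change c d (chart_inv c (f x)) (a x))"
proof -
  have s: "smooth_on (snd c ` (fst c \<inter> fst d)) (\<lambda>x. fd (\<lambda>x. snd d (chart_inv c x)) x i)" for i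
    by (rule smooth_on_fd[OF smooth_transition[OF assms(1,2)]])
  have "smooth_on S (\<lambda>x. fd (\<lambda>x. snd d (chart_inv c x)) (f x) (a x))"
    by (rule smooth_on_linear_family[where T = "fd (\<lambda>x. snd d (chart_inv c x))", OF assms(3) _ s assms(6,4,5)])
      (rule smooth_on_linear_fd[OF smooth_transition[OF assms(1,2)]])
  then show ?thesis
    by (rule smooth_on_cong[OF assms(3), THEN iffD1, rotated])
      (use assms in \<open>auto simp: coord_change_eq\<close>)
qed

lemma vec_rep_transition:
  assumes "c \<in> \<A>" "d \<in> \<A>" "x \<in> snd d ` (fst c \<inter> fst d)"
  shows "vec_rep \<A> d X x =
    coord_change c d (chart_inv c (snd c (chart_inv d x))) (vec_rep \<A> c X (snd c (chart_inv d x)))"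
  using assms by (auto simp: vec_rep_def coord_change_to_chart)

lemma smooth_rep_transition:
  assumes "c \<in> \<A>" "d \<in> \<A>" "open N" "N \<subseteq> fst c" "smooth_on (snd c ` N) F"
  shows "smooth_on (snd d ` (N \<inter> fst d)) (\<lambda>x. F (snd c (chart_inv d x)))"
proof (rule smooth_on_compose[OF _ _ _ assms(5)])
  show "open (snd d ` (N \<inter> fst d))"
    by (intro open_chart_image open_Int open_fst assms) auto
  show "smooth_on (snd d ` (N \<inter> fst d)) (\<lambda>x. snd c (chart_inv d x))"
    by (rule smooth_on_subset[OF smooth_transition[OF assms(2,1)]]) (use assms in auto)
qed (use assms in auto)

lemma smooth_vf_local:
  assumes "\<And>p. \<exists>c N. c \<in> \<A> \<and> open N \<and> p \<in> N \<and> N \<subseteq> fst c \<and> smooth_on (snd c ` N) (vec_rep \<A> c X)"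
  shows "smooth_vf \<A> X"
  unfolding smooth_vf_def
proof (intro ballI smooth_on_local)
  fix d x assume d: "d \<in> \<A>" "x \<in> snd d ` fst d"
  define p where "p = chart_inv d x"
  have p: "p \<in> fst d" "snd d p = x" using d by (auto simp: p_def)
  obtain c N where c: "c \<in> \<A>" "open N" "p \<in> N" "N \<subseteq> fst c" "smooth_on (snd c ` N) (vec_rep \<A> c X)"
    using assms by blast
  let ?T = "snd d ` (N \<inter> fst d)"
  have o: "open ?T" by (intro open_chart_image open_Int open_fst c d) auto
  have "smooth_on ?T (\<lambda>x. coord_change c d (chart_inv c (snd c (chart_inv d x)))
      (vec_rep \<A> c X (snd c (chart_inv d x))))"
  proof (rule smooth_coord_change[OF c(1) d(1) o])
    show "smooth_on ?T (\<lambda>x. snd c (chart_inv d x))"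
      by (rule smooth_on_subset[OF smooth_transition[OF d(1) c(1)]]) (use c in auto)
    show "smooth_on ?T (\<lambda>x. vec_rep \<A> c X (snd c (chart_inv d x)))"
      using smooth_rep_transition[OF c(1) d(1) c(2,4,5)] .
  qed (use c d in auto)
  then have "smooth_on ?T (vec_rep \<A> d X)"
    by (rule smooth_on_cong[OF o, THEN iffD1, rotated])
      (use vec_rep_transition[OF c(1) d(1)] c(4) in auto)
  then show "\<exists>T. open T \<and> x \<in> T \<and> smooth_on T (vec_rep \<A> d X)"
    using o p c(3) by blast
qed

lemma smooth_fun_local:
  assumes "\<And>p. \<exists>c N. c \<in> \<A> \<and> open N \<and> p \<in> N \<and> N \<subseteq> fst c \<and> smooth_on (snd c ` N) (\<lambda>x. f (chart_inv c x))"
  shows "smooth_fun \<A> f"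
  unfolding smooth_fun_def
proof (intro ballI smooth_on_local)
  fix d x assume d: "d \<in> \<A>" "x \<in> snd d ` fst d"
  define p where "p = chart_inv d x"
  have p: "p \<in> fst d" "snd d p = x" using d by (auto simp: p_def)
  obtain c N where c: "c \<in> \<A>" "open N" "p \<in> N" "N \<subseteq> fst c" "smooth_on (snd c ` N) (\<lambda>x. f (chart_inv c x))"
    using assms by blast
  let ?T = "snd d ` (N \<inter> fst d)"
  have o: "open ?T" by (intro open_chart_image open_Int open_fst c d) auto
  have "smooth_on ?T (\<lambda>x. f (chart_inv c (snd c (chart_inv d x))))"
    using smooth_rep_transition[OF c(1) d(1) c(2,4,5)] .
  then have "smooth_on ?T (f \<circ> chart_inv d)"
    by (rule smooth_on_cong[OF o, THEN iffD1, rotated]) (use c d in auto)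
  then show "\<exists>T. open T \<and> x \<in> T \<and> smooth_on T (f \<circ> chart_inv d)"
    using o p c(3) by blast
qed

lemma smooth_vfD: "smooth_vf \<A> X \<Longrightarrow> c \<in> \<A> \<Longrightarrow> smooth_on (snd c ` fst c) (vec_rep \<A> c X)"
  by (simp add: smooth_vf_def)

lemma smooth_funD: "smooth_fun \<A> f \<Longrightarrow> c \<in> \<A> \<Longrightarrow> smooth_on (snd c ` fst c) (\<lambda>x. f (chart_inv c x))"
  by (simp add: smooth_fun_def o_def)

lemma vec_rep_snd [simp]: "c \<in> \<A> \<Longrightarrow> p \<in> fst c \<Longrightarrow> vec_rep \<A> c X (snd c p) = to_chart \<A> c p (X p)"
  by (simp add: vec_rep_def)

lemma vec_rep_add:
  "c \<in> \<A> \<Longrightarrow> x \<in> snd c ` fst c \<Longrightarrow> vec_rep \<A> c (\<lambda>q. X q + Y q) x = vec_rep \<A> c X x + vec_rep \<A> c Y x"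
  by (simp add: vec_rep_def linear_add[OF linear_to_chart] chart_inv_in)

lemma vec_rep_scaleR:
  "c \<in> \<A> \<Longrightarrow> x \<in> snd c ` fst c \<Longrightarrow>
    vec_rep \<A> c (\<lambda>q. f q *\<^sub>R X q) x = f (chart_inv c x) *\<^sub>R vec_rep \<A> c X x"
  by (simp add: vec_rep_def linear_cmul[OF linear_to_chart] chart_inv_in)

lemma smooth_vf_add: "smooth_vf \<A> X \<Longrightarrow> smooth_vf \<A> Y \<Longrightarrow> smooth_vf \<A> (\<lambda>q. X q + Y q)"
  unfolding smooth_vf_def
  by (intro ballI smooth_on_cong[OF open_img, THEN iffD2, OF _ vec_rep_add smooth_on_add[OF open_img]]) auto

lemma smooth_vf_scaleR: "smooth_fun \<A> f \<Longrightarrow> smooth_vf \<A> X \<Longrightarrow> smooth_vf \<A> (\<lambda>q. f q *\<^sub>R X q)"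
  using smooth_funD smooth_vfD unfolding smooth_vf_def
  by (intro ballI smooth_on_cong[OF open_img, THEN iffD2, OF _ vec_rep_scaleR smooth_on_scaleR[OF open_img]]) auto

lemma smooth_fun_const: "smooth_fun \<A> (\<lambda>q. k)"
  by (simp add: smooth_fun_def o_def smooth_on_const)

lemma smooth_vf_zero: "smooth_vf \<A> (\<lambda>q. 0)"
  unfolding smooth_vf_def vec_rep_def
  by (intro ballI smooth_on_cong[OF open_img, THEN iffD2, OF _ _ smooth_on_const[where c = 0]])
    (simp_all add: linear_0[OF linear_to_chart] chart_inv_in)

lemma smooth_vf_sum:
  "finite B \<Longrightarrow> (\<And>i. i \<in> B \<Longrightarrow> smooth_vf \<A> (X i)) \<Longrightarrow> smooth_vf \<A> (\<lambda>q. \<Sum>i\<in>B. X i q)"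
  by (induction B rule: finite_induct) (auto intro: smooth_vf_zero smooth_vf_add)

text \<open>The closed set \<open>K\<close> is returned along with \<open>f\<close> because its
  complement is open: products of \<open>f\<close> with objects defined on \<open>N\<close> only are
  then smooth when extended by zero.\<close>

lemma bump_exists:
  assumes "open N" "p \<in> N"
  obtains f K where "smooth_fun \<A> f" "\<forall>\<^sub>F q in nhds p. f q = 1" "closed K" "K \<subseteq> N" "\<And>q. q \<notin> K \<Longrightarrow> f q = 0"
proof -
  define c where "c = chart_at \<A> p"
  have c: "c \<in> \<A>" "p \<in> fst c" by (simp_all add: c_def chart_at)
  let ?N = "N \<inter> fst c"
  have "open (snd c ` ?N)"
    by (intro open_chart_image open_Int open_fst c assms) auto
  then obtain R where R: "R > 0" "cball (snd c p) R \<subseteq> snd c ` ?N"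
    using assms c open_contains_cball by (metis IntI imageI)
  obtain \<phi> :: "'e \<Rightarrow> real" where \<phi>: "smooth_on UNIV \<phi>" "\<And>x. x \<in> ball (snd c p) (R / 2) \<Longrightarrow> \<phi> x = 1"
    "\<And>x. x \<notin> ball (snd c p) (2 * (R / 2)) \<Longrightarrow> \<phi> x = 0"
    using bump_function_exists[of "R / 2" "snd c p"] R(1) by auto
  define K where "K = chart_inv c ` cball (snd c p) R"
  define f where "f = (\<lambda>q. if q \<in> K then \<phi> (snd c q) else 0)"
  have sub: "cball (snd c p) R \<subseteq> snd c ` fst c" using R by auto
  have KN: "K \<subseteq> ?N"
    using R(2) c by (auto simp: K_def)
  \<comment> \<open>The Hausdorff property enters here: the preimage of a closed coordinate ball is
    compact, hence closed in the whole manifold and not only in the chart domain.\<close>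
  have "compact K" unfolding K_def
    using chart_homeo[OF c(1)] sub
    by (intro compact_continuous_image compact_cball) (auto simp: homeomorphism_def intro: continuous_on_subset)
  then have K: "closed K" by (rule compact_imp_closed)
  \<comment> \<open>\<phi> already vanishes off the ball of radius \<open>R\<close>, so the cut at
    \<open>K\<close> changes nothing within the chart and creates no jump.\<close>
  have f: "f q = \<phi> (snd c q)" if "q \<in> fst c" for q
  proof (cases "q \<in> K")
    case False
    then have "snd c q \<notin> cball (snd c p) R"
      using that c by (auto simp: K_def image_iff) (metis chart_inv_snd mem_cball)
    then show ?thesis using False \<phi>(3) by (simp add: f_def)
  qed (simp add: f_def)
  have "smooth_fun \<A> f"
  proof (rule smooth_fun_local)
    fix q
    show "\<exists>d N. d \<in> \<A> \<and> open N \<and> q \<in> N \<and> N \<subseteq> fst d \<and> smooth_on (snd d ` N) (\<lambda>x. f (chart_inv d x))"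
    proof (cases "q \<in> K")
      case True
      have "smooth_on (snd c ` fst c) (\<lambda>x. f (chart_inv c x))"
        by (rule smooth_on_cong[OF open_img[OF c(1)], THEN iffD2, OF _ smooth_on_subset[OF \<phi>(1)]])
          (use c f in auto)
      then show ?thesis using True KN c open_fst by blast
    next
      case False
      let ?d = "chart_at \<A> q"
      let ?M = "fst ?d - K"
      have M: "open ?M" "q \<in> ?M"
        using open_Diff[OF open_fst[OF chart_at(1)] K] False chart_at(2) by auto
      have "smooth_on (snd ?d ` ?M) (\<lambda>x. f (chart_inv ?d x))"
        by (rule smooth_on_cong[OF open_chart_image[OF _ M(1)], THEN iffD2, OF _ _ _ smooth_on_const[where c = 0]])
          (use chart_at in \<open>auto simp: f_def\<close>)
      then show ?thesis using M chart_at by blast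
    qed
  qed
  moreover have "\<forall>\<^sub>F q in nhds p. f q = 1"
  proof -
    have "open (fst c \<inter> snd c -` ball (snd c p) (R / 2))"
      using chart_homeo[OF c(1)] open_fst[OF c(1)]
      by (intro continuous_open_preimage) (auto simp: homeomorphism_def)
    then show ?thesis
      unfolding eventually_nhds using R(1) c f \<phi>(2)
      by (intro exI[of _ "fst c \<inter> snd c -` ball (snd c p) (R / 2)"]) auto
  qed
  ultimately show ?thesis
    using that[of f K] K KN by (auto simp: f_def)
qed

lemma smooth_vf_cutoff:
  assumes "smooth_fun \<A> f" "closed K" "K \<subseteq> N" "\<And>q. q \<notin> K \<Longrightarrow> f q = 0"
    and c: "c \<in> \<A>" "open N" "N \<subseteq> fst c" "smooth_on (snd c ` N) (vec_rep \<A> c W)"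
  shows "smooth_vf \<A> (\<lambda>q. f q *\<^sub>R W q)"
proof (rule smooth_vf_local)
  fix q
  show "\<exists>d M. d \<in> \<A> \<and> open M \<and> q \<in> M \<and> M \<subseteq> fst d \<and> smooth_on (snd d ` M) (vec_rep \<A> d (\<lambda>q. f q *\<^sub>R W q))"
  proof (cases "q \<in> N")
    case True
    have "smooth_on (snd c ` N) (\<lambda>x. f (chart_inv c x) *\<^sub>R vec_rep \<A> c W x)"
      by (intro smooth_on_scaleR open_chart_image c smooth_on_subset[OF smooth_funD[OF assms(1) c(1)]])
        (use c in auto)
    then have "smooth_on (snd c ` N) (vec_rep \<A> c (\<lambda>q. f q *\<^sub>R W q))"
      by (rule smooth_on_cong[OF open_chart_image[OF c(1-3)], THEN iffD2, rotated])
        (rule vec_rep_scaleR, use c in auto)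
    then show ?thesis using True c by blast
  next
    case False
    let ?d = "chart_at \<A> q"
    let ?M = "fst ?d - K"
    have M: "open ?M" "q \<in> ?M"
      using open_Diff[OF open_fst[OF chart_at(1)] assms(2)] False assms(3) chart_at(2) by auto
    have "smooth_on (snd ?d ` ?M) (vec_rep \<A> ?d (\<lambda>q. f q *\<^sub>R W q))"
      by (rule smooth_on_cong[OF open_chart_image[OF _ M(1)], THEN iffD2, OF _ _ _ smooth_on_const[where c = 0]])
        (use chart_at assms in \<open>auto simp: linear_0[OF linear_to_chart]\<close>)
    then show ?thesis using M chart_at by blast
  qed
qed

lemma smooth_fun_cutoff:
  assumes "smooth_fun \<A> f" "closed K" "K \<subseteq> N" "\<And>q. q \<notin> K \<Longrightarrow> f q = 0"
    and c: "c \<in> \<A>" "open N" "N \<subseteq> fst c" "smooth_on (snd c ` N) (\<lambda>x. h (chart_inv c x))"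
  shows "smooth_fun \<A> (\<lambda>q. f q * h q)"
proof (rule smooth_fun_local)
  fix q
  show "\<exists>d M. d \<in> \<A> \<and> open M \<and> q \<in> M \<and> M \<subseteq> fst d \<and>
      smooth_on (snd d ` M) (\<lambda>x. f (chart_inv d x) * h (chart_inv d x))"
  proof (cases "q \<in> N")
    case True
    have "smooth_on (snd c ` N) (\<lambda>x. f (chart_inv c x) * h (chart_inv c x))"
      by (intro smooth_on_mult open_chart_image c smooth_on_subset[OF smooth_funD[OF assms(1) c(1)]])
        (use c in auto)
    then show ?thesis using True c by blast
  next
    case False
    let ?d = "chart_at \<A> q"
    let ?M = "fst ?d - K"
    have M: "open ?M" "q \<in> ?M"
      using open_Diff[OF open_fst[OF chart_at(1)] assms(2)] False assms(3) chart_at(2) by auto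
    have "smooth_on (snd ?d ` ?M) (\<lambda>x. f (chart_inv ?d x) * h (chart_inv ?d x))"
      by (rule smooth_on_cong[OF open_chart_image[OF _ M(1)], THEN iffD2, OF _ _ _ smooth_on_const[where c = 0]])
        (use chart_at assms in auto)
    then show ?thesis using M chart_at by blast
  qed
qed

lemma vf_extension:
  assumes "c \<in> \<A>" "open N" "p \<in> N" "N \<subseteq> fst c" "smooth_on (snd c ` N) (vec_rep \<A> c W)"
  shows "\<exists>X. smooth_vf \<A> X \<and> (\<forall>\<^sub>F q in nhds p. X q = W q)"
proof -
  obtain f K where f: "smooth_fun \<A> f" "\<forall>\<^sub>F q in nhds p. f q = 1" "closed K" "K \<subseteq> N" "\<And>q. q \<notin> K \<Longrightarrow> f q = 0"
    using bump_exists[OF assms(2,3)] by blast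
  have "\<forall>\<^sub>F q in nhds p. f q *\<^sub>R W q = W q"
    using f(2) by eventually_elim simp
  then show ?thesis
    using smooth_vf_cutoff[OF f(1,3-5) assms(1,2,4,5)] by blast
qed

lemma fun_extension:
  assumes "c \<in> \<A>" "open N" "p \<in> N" "N \<subseteq> fst c" "smooth_on (snd c ` N) (\<lambda>x. h (chart_inv c x))"
  shows "\<exists>f. smooth_fun \<A> f \<and> (\<forall>\<^sub>F q in nhds p. f q = h q)"
proof -
  obtain f K where f: "smooth_fun \<A> f" "\<forall>\<^sub>F q in nhds p. f q = 1" "closed K" "K \<subseteq> N" "\<And>q. q \<notin> K \<Longrightarrow> f q = 0"
    using bump_exists[OF assms(2,3)] by blast
  have "\<forall>\<^sub>F q in nhds p. f q * h q = h q"
    using f(2) by eventually_elim simp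
  then show ?thesis
    using smooth_fun_cutoff[OF f(1,3-5) assms(1,2,4,5)] by blast
qed

lemma germ_ext:
  assumes "c \<in> \<A>" "open N" "p \<in> N" "N \<subseteq> fst c" "smooth_on (snd c ` N) (vec_rep \<A> c W)"
  shows "smooth_vf \<A> (germ_ext \<A> p W)" "\<forall>\<^sub>F q in nhds p. germ_ext \<A> p W q = W q"
  using someI_ex[OF vf_extension[OF assms]] unfolding germ_ext_def by auto

text \<open>A coordinate field, made global because connections act on global fields. Its components
  are known to be constant only near \<open>p\<close>, so \<open>p\<close> stays a
  parameter.\<close>

definition frame :: "('m, 'e) chart \<Rightarrow> 'm \<Rightarrow> 'e \<Rightarrow> 'm \<Rightarrow> 'e" where
  "frame c p a = germ_ext \<A> p (\<lambda>q. from_chart \<A> c q a)"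

lemma frame:
  assumes "c \<in> \<A>" "p \<in> fst c"
  shows "smooth_vf \<A> (frame c p a)" "\<forall>\<^sub>F q in nhds p. frame c p a q = from_chart \<A> c q a"
proof -
  have "smooth_on (snd c ` fst c) (vec_rep \<A> c (\<lambda>q. from_chart \<A> c q a))"
    by (rule smooth_on_cong[OF open_img[OF assms(1)], THEN iffD2, OF _ smooth_on_const[where c = a]])
      (use assms in auto)
  from germ_ext[OF assms(1) open_fst[OF assms(1)] assms(2) order_refl this]
  show "smooth_vf \<A> (frame c p a)" "\<forall>\<^sub>F q in nhds p. frame c p a q = from_chart \<A> c q a"
    unfolding frame_def by auto
qed

lemma eventually_eq_at: "(\<forall>\<^sub>F q in nhds p. X q = W q) \<Longrightarrow> X p = W p"
  by (rule eventually_nhds_x_imp_x)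

lemma vec_ext: "smooth_vf \<A> (vec_ext \<A> p \<xi>)" "vec_ext \<A> p \<xi> p = \<xi>"
proof -
  have "\<exists>X. smooth_vf \<A> X \<and> X p = \<xi>"
    using frame[OF chart_at, of p \<xi>] eventually_eq_at by fastforce
  from someI_ex[OF this] show "smooth_vf \<A> (vec_ext \<A> p \<xi>)" "vec_ext \<A> p \<xi> p = \<xi>"
    unfolding vec_ext_def by auto
qed

lemma eventually_chart:
  assumes "c \<in> \<A>" "p \<in> fst c" "\<forall>\<^sub>F q in nhds p. P q"
  obtains N where "open N" "p \<in> N" "N \<subseteq> fst c" "\<And>q. q \<in> N \<Longrightarrow> P q" "open (snd c ` N)"
proof -
  obtain N where "open N" "p \<in> N" "\<And>q. q \<in> N \<Longrightarrow> P q"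
    using assms(3) unfolding eventually_nhds by blast
  then show ?thesis
    using that[of "N \<inter> fst c"] assms open_fst open_chart_image[OF assms(1), of "N \<inter> fst c"] by blast
qed

lemma vec_rep_cong_fd:
  assumes "c \<in> \<A>" "p \<in> fst c" "\<forall>\<^sub>F q in nhds p. X q = W q"
  shows "fd (vec_rep \<A> c X) (snd c p) = fd (vec_rep \<A> c W) (snd c p)"
proof -
  obtain N where N: "open N" "p \<in> N" "N \<subseteq> fst c" "\<And>q. q \<in> N \<Longrightarrow> X q = W q" "open (snd c ` N)"
    using eventually_chart[OF assms] by blast
  show ?thesis
    by (rule fd_cong_open[OF N(5)]) (use N assms in \<open>auto simp: subset_iff\<close>)
qed

lemma tderiv_chart:
  assumes "c \<in> \<A>" "p \<in> fst c" "(\<lambda>x. f (chart_inv c x)) differentiable (at (snd c p))"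
  shows "tderiv \<A> p \<xi> f = fd (\<lambda>x. f (chart_inv c x)) (snd c p) (to_chart \<A> c p \<xi>)"
proof -
  define d where "d = chart_at \<A> p"
  have d: "d \<in> \<A>" "p \<in> fst d" by (simp_all add: d_def chart_at)
  have D: "((\<lambda>x. f (chart_inv c (snd c (chart_inv d x)))) has_derivative
      (\<lambda>\<xi>. fd (\<lambda>x. f (chart_inv c x)) (snd c p) (coord_change d c p \<xi>))) (at (snd d p))"
    by (rule has_derivative_compose[where f = "\<lambda>x. snd c (chart_inv d x)" and g = "\<lambda>x. f (chart_inv c x)"])
      (use assms d transition_has_derivative fd_works in auto)
  have "((\<lambda>x. f (chart_inv d x)) has_derivative
      (\<lambda>\<xi>. fd (\<lambda>x. f (chart_inv c x)) (snd c p) (coord_change d c p \<xi>))) (at (snd d p))"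
    by (rule has_derivative_transform_within_open[OF D open_overlap[OF d(1) assms(1)]])
      (use assms d in auto)
  then show ?thesis
    by (simp add: tderiv_def d_def[symmetric] o_def fd_eq to_chart_def)
qed

lemma tderiv_cong:
  assumes "\<forall>\<^sub>F q in nhds p. f q = h q"
  shows "tderiv \<A> p \<xi> f = tderiv \<A> p \<xi> h"
proof -
  obtain N where N: "open N" "p \<in> N" "N \<subseteq> fst (chart_at \<A> p)" "\<And>q. q \<in> N \<Longrightarrow> f q = h q"
    "open (snd (chart_at \<A> p) ` N)"
    using eventually_chart[OF chart_at assms] by blast
  have "fd (f \<circ> chart_inv (chart_at \<A> p)) (snd (chart_at \<A> p) p)
      = fd (h \<circ> chart_inv (chart_at \<A> p)) (snd (chart_at \<A> p) p)"
    by (rule fd_cong_open[OF N(5)]) (use N chart_at in \<open>auto simp: subset_iff\<close>)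
  then show ?thesis by (simp add: tderiv_def)
qed

end

section \<open>Anisotropic connections on a manifold\<close>

locale conic_manifold = manifold \<A>
  for \<A> :: "('m::{t2_space, second_countable_topology}, 'e::euclidean_space) atlas" +
  fixes A :: "('m \<times> 'e) set"
  assumes conic: "conic_domain \<A> A"
begin

abbreviation U :: "('m, 'e) chart \<Rightarrow> ('e \<times> 'e) set" where
  "U c \<equiv> tset_rep \<A> c A"

definition tchart :: "('m, 'e) chart \<Rightarrow> 'm \<times> 'e \<Rightarrow> 'e \<times> 'e" where
  "tchart c v = (snd c (fst v), to_chart \<A> c (fst v) (snd v))"

lemma open_U: "c \<in> \<A> \<Longrightarrow> open (U c)"
  using conic by (simp add: conic_domain_def)

lemma fst_tchart_inv [simp]: "fst (tchart_inv \<A> c z) = chart_inv c (fst z)"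
  by (simp add: tchart_inv_def)

lemma tchart_inv_tchart [simp]: "c \<in> \<A> \<Longrightarrow> fst v \<in> fst c \<Longrightarrow> tchart_inv \<A> c (tchart c v) = v"
  by (simp add: tchart_inv_def tchart_def)

lemma tchart_in_U: "c \<in> \<A> \<Longrightarrow> v \<in> A \<Longrightarrow> fst v \<in> fst c \<Longrightarrow> tchart c v \<in> U c"
  by (simp add: tset_rep_def) (simp add: tchart_def)

lemma U_D:
  assumes "c \<in> \<A>" "z \<in> U c"
  shows "fst z \<in> snd c ` fst c" "tchart_inv \<A> c z \<in> A" "chart_inv c (fst z) \<in> fst c"
    "tchart c (tchart_inv \<A> c z) = z"
  using assms by (auto simp: tset_rep_def chart_inv_in tchart_def tchart_inv_def snd_chart_inv)

lemma fst_tchart [simp]: "fst (tchart c v) = snd c (fst v)"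
  and snd_tchart [simp]: "snd (tchart c v) = to_chart \<A> c (fst v) (snd v)"
  by (simp_all add: tchart_def)

lemma section_exists: obtains v where "v \<in> A" "fst v = p"
  using conic by (metis (no_types, lifting) UNIV_I conic_domain_def imageE)

end

section \<open>Locality of anisotropic connections\<close>

locale connection = conic_manifold \<A> A
  for \<A> :: "('m::{t2_space, second_countable_topology}, 'e::euclidean_space) atlas" and A +
  fixes D :: "('m, 'e) conn"
  assumes conn: "aniso_connection \<A> A D"
begin

lemma D_add:
  "v \<in> A \<Longrightarrow> smooth_vf \<A> X \<Longrightarrow> smooth_vf \<A> Y \<Longrightarrow> smooth_vf \<A> Z \<Longrightarrow>
    D v X (\<lambda>q. Y q + Z q) = D v X Y + D v X Z"
  using conn unfolding aniso_connection_def by blast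

lemma D_leibniz:
  "v \<in> A \<Longrightarrow> smooth_vf \<A> X \<Longrightarrow> smooth_vf \<A> Y \<Longrightarrow> smooth_fun \<A> f \<Longrightarrow>
    D v X (\<lambda>q. f q *\<^sub>R Y q) = tderiv \<A> (fst v) (X (fst v)) f *\<^sub>R Y (fst v) + f (fst v) *\<^sub>R D v X Y"
  using conn unfolding aniso_connection_def by blast

lemma D_lincomb_left:
  "v \<in> A \<Longrightarrow> smooth_vf \<A> X \<Longrightarrow> smooth_vf \<A> Y \<Longrightarrow> smooth_vf \<A> Z \<Longrightarrow> smooth_fun \<A> f \<Longrightarrow> smooth_fun \<A> h \<Longrightarrow>
    D v (\<lambda>q. f q *\<^sub>R X q + h q *\<^sub>R Y q) Z = f (fst v) *\<^sub>R D v X Z + h (fst v) *\<^sub>R D v Y Z"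
  using conn unfolding aniso_connection_def by blast

lemma D_smooth: "smooth_vf \<A> X \<Longrightarrow> smooth_vf \<A> Y \<Longrightarrow> aniso_vf \<A> A (\<lambda>v. D v X Y)"
  using conn unfolding aniso_connection_def by blast

lemma D_scaleR_left:
  "v \<in> A \<Longrightarrow> smooth_vf \<A> X \<Longrightarrow> smooth_vf \<A> Z \<Longrightarrow> smooth_fun \<A> f \<Longrightarrow>
    D v (\<lambda>q. f q *\<^sub>R X q) Z = f (fst v) *\<^sub>R D v X Z"
  using D_lincomb_left[of v X X Z f "\<lambda>q. 0"] by (simp add: smooth_fun_const)

text \<open>A bump function \<open>f\<close> makes the products with both fields equal everywhere.
  In the Leibniz rule the terms with the derivative of \<open>f\<close> coincide because the fields
  agree at the point, and \<open>f\<close> is 1 there.\<close>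

lemma D_cong_right:
  assumes "v \<in> A" "smooth_vf \<A> X" "smooth_vf \<A> Y" "smooth_vf \<A> Z" "\<forall>\<^sub>F q in nhds (fst v). Y q = Z q"
  shows "D v X Y = D v X Z"
proof -
  obtain N where N: "open N" "fst v \<in> N" "\<And>q. q \<in> N \<Longrightarrow> Y q = Z q"
    using assms(5) by (auto simp: eventually_nhds)
  obtain f K where f: "smooth_fun \<A> f" "\<forall>\<^sub>F q in nhds (fst v). f q = 1" "K \<subseteq> N" "\<And>q. q \<notin> K \<Longrightarrow> f q = 0"
    using bump_exists[OF N(1,2)] by metis
  have "f q *\<^sub>R Y q = f q *\<^sub>R Z q" for q
    using N(3)[of q] f(3) f(4)[of q] by (cases "q \<in> K") auto
  then have "D v X (\<lambda>q. f q *\<^sub>R Y q) = D v X (\<lambda>q. f q *\<^sub>R Z q)" by presburger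
  then show ?thesis
    using eventually_eq_at[OF f(2)] N(3)[OF N(2)] D_leibniz[OF assms(1,2,3) f(1)] D_leibniz[OF assms(1,2,4) f(1)]
    by simp
qed

lemma D_cong_left:
  assumes "v \<in> A" "smooth_vf \<A> X" "smooth_vf \<A> Y" "smooth_vf \<A> Z" "\<forall>\<^sub>F q in nhds (fst v). X q = Y q"
  shows "D v X Z = D v Y Z"
proof -
  obtain N where N: "open N" "fst v \<in> N" "\<And>q. q \<in> N \<Longrightarrow> X q = Y q"
    using assms(5) by (auto simp: eventually_nhds)
  obtain f K where f: "smooth_fun \<A> f" "\<forall>\<^sub>F q in nhds (fst v). f q = 1" "K \<subseteq> N" "\<And>q. q \<notin> K \<Longrightarrow> f q = 0"
    using bump_exists[OF N(1,2)] by metis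
  have "f q *\<^sub>R X q = f q *\<^sub>R Y q" for q
    using N(3)[of q] f(3) f(4)[of q] by (cases "q \<in> K") auto
  then have "D v (\<lambda>q. f q *\<^sub>R X q) Z = D v (\<lambda>q. f q *\<^sub>R Y q) Z" by presburger
  then show ?thesis
    using eventually_eq_at[OF f(2)] D_scaleR_left[OF assms(1,2,4) f(1)] D_scaleR_left[OF assms(1,3,4) f(1)]
    by simp
qed

lemma D_sum_right:
  assumes "v \<in> A" "smooth_vf \<A> X" "finite B" "\<And>i. i \<in> B \<Longrightarrow> smooth_vf \<A> (Y i)"
  shows "D v X (\<lambda>q. \<Sum>i\<in>B. Y i q) = (\<Sum>i\<in>B. D v X (Y i))"
  using assms(3,4)
proof (induction B rule: finite_induct)
  case empty
  then show ?case
    using D_leibniz[OF assms(1,2) smooth_vf_zero smooth_fun_const[of 0]] by simp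
next
  case (insert i B)
  then show ?case
    using D_add[OF assms(1,2), of "Y i" "\<lambda>q. \<Sum>i\<in>B. Y i q"] smooth_vf_sum[of B Y] by auto
qed

lemma D_sum_left:
  assumes "v \<in> A" "smooth_vf \<A> Z" "finite B" "\<And>i. i \<in> B \<Longrightarrow> smooth_vf \<A> (X i)"
  shows "D v (\<lambda>q. \<Sum>i\<in>B. X i q) Z = (\<Sum>i\<in>B. D v (X i) Z)"
  using assms(3,4)
proof (induction B rule: finite_induct)
  case empty
  then show ?case
    using D_scaleR_left[OF assms(1) smooth_vf_zero assms(2) smooth_fun_const[of 0]] by simp
next
  case (insert i B)
  then show ?case
    using D_lincomb_left[OF assms(1), of "X i" "\<lambda>q. \<Sum>i\<in>B. X i q" Z "\<lambda>q. 1" "\<lambda>q. 1"]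
      smooth_vf_sum[of B X] assms(2) smooth_fun_const by auto
qed

end

section \<open>Expansion of vector fields in coordinate frames\<close>

context manifold
begin

text \<open>The coefficients are extended to global functions, since the Leibniz rule and the
  linearity of a connection are available for those.\<close>

lemma frame_expansion:
  assumes "c \<in> \<A>" "p \<in> fst c" "smooth_vf \<A> X"
  obtains h where "\<And>i. smooth_fun \<A> (h i)"
    "\<And>i. \<forall>\<^sub>F q in nhds p. h i q = vec_rep \<A> c X (snd c q) \<bullet> i"
    "\<forall>\<^sub>F q in nhds p. X q = (\<Sum>i\<in>Basis. h i q *\<^sub>R frame c p i q)"
proof -
  have "\<exists>f. smooth_fun \<A> f \<and> (\<forall>\<^sub>F q in nhds p. f q = vec_rep \<A> c X (snd c q) \<bullet> i)" for i
  proof (rule fun_extension[OF assms(1) open_fst[OF assms(1)] assms(2) order_refl])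
    have "smooth_on (snd c ` fst c) (\<lambda>x. vec_rep \<A> c X x \<bullet> i)"
      by (intro smooth_on_inner open_img smooth_on_const smooth_vfD assms)
    then show "smooth_on (snd c ` fst c) (\<lambda>x. vec_rep \<A> c X (snd c (chart_inv c x)) \<bullet> i)"
      by (rule smooth_on_cong[OF open_img[OF assms(1)], THEN iffD2, rotated]) (use assms in auto)
  qed
  then obtain h where h: "\<And>i. smooth_fun \<A> (h i)"
    "\<And>i. \<forall>\<^sub>F q in nhds p. h i q = vec_rep \<A> c X (snd c q) \<bullet> i"
    by metis
  have "\<forall>\<^sub>F q in nhds p. \<forall>i\<in>Basis. h i q = vec_rep \<A> c X (snd c q) \<bullet> i \<and> frame c p i q = from_chart \<A> c q i"
    using h(2) frame(2)[OF assms(1,2)] by (intro eventually_ball_finite ballI eventually_conj) auto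
  moreover have "\<forall>\<^sub>F q in nhds p. q \<in> fst c"
    using assms(1,2) open_fst eventually_nhds by blast
  ultimately have "\<forall>\<^sub>F q in nhds p. X q = (\<Sum>i\<in>Basis. h i q *\<^sub>R frame c p i q)"
  proof eventually_elim
    case (elim q)
    have "X q = from_chart \<A> c q (to_chart \<A> c q (X q))" using assms elim by simp
    also have "\<dots> = (\<Sum>i\<in>Basis. (to_chart \<A> c q (X q) \<bullet> i) *\<^sub>R from_chart \<A> c q i)"
      using elim assms by (intro linear_sum_Basis linear_from_chart) auto
    finally show ?case using elim assms by simp
  qed
  with h show ?thesis using that by blast
qed

lemma frame_at [simp]: "c \<in> \<A> \<Longrightarrow> p \<in> fst c \<Longrightarrow> to_chart \<A> c p (frame c p a p) = a"
  using eventually_eq_at[OF frame(2)] by simp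

lemma fd_vec_rep_frame:
  assumes "c \<in> \<A>" "p \<in> fst c"
  shows "fd (vec_rep \<A> c (frame c p a)) (snd c p) = (\<lambda>h. 0)"
proof -
  have "fd (vec_rep \<A> c (\<lambda>q. from_chart \<A> c q a)) (snd c p) = fd (\<lambda>x. a) (snd c p)"
    by (rule fd_cong_open[OF open_img[OF assms(1)]]) (use assms in auto)
  then show ?thesis
    using vec_rep_cong_fd[OF assms frame(2)[OF assms]] by simp
qed

text \<open>A frame of \<open>c\<close> has components in \<open>d\<close> given by the derivative
  of the transition map. Its second derivative, appearing here, is the inhomogeneous term in the
  transformation law of the Christoffel symbols.\<close>

lemma fd_vec_rep_frame_other:
  assumes "c \<in> \<A>" "d \<in> \<A>" "p \<in> fst c" "p \<in> fst d"
  shows "fd (vec_rep \<A> d (frame c p b)) (snd d p) h =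
    fd (\<lambda>x. fd (\<lambda>x. snd d (chart_inv c x)) x b) (snd c p) (coord_change d c p h)"
proof -
  let ?F = "\<lambda>x. fd (\<lambda>x. snd d (chart_inv c x)) x b"
  have "(?F has_derivative fd ?F (snd c p)) (at (snd c p))"
    by (rule smooth_on_has_derivative[OF smooth_on_fd[OF smooth_transition[OF assms(1,2)]]])
      (use assms in auto)
  then have D: "((\<lambda>x. ?F (snd c (chart_inv d x))) has_derivative
      (\<lambda>h. fd ?F (snd c p) (coord_change d c p h))) (at (snd d p))"
    by (intro has_derivative_compose[where g = ?F, OF transition_has_derivative[OF assms(2,1,4,3)]])
      (use assms in auto)
  have "fd (vec_rep \<A> d (\<lambda>q. from_chart \<A> c q b)) (snd d p) = fd (\<lambda>x. ?F (snd c (chart_inv d x))) (snd d p)"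
  proof (rule fd_cong_open[OF open_overlap[OF assms(2,1)]])
    fix x assume "x \<in> snd d ` (fst d \<inter> fst c)"
    then obtain q where q: "q \<in> fst d" "q \<in> fst c" "x = snd d q" by auto
    have "vec_rep \<A> d (\<lambda>q. from_chart \<A> c q b) x = coord_change c d q b"
      using q assms by (simp add: to_chart_def from_chart_def coord_change_trans chart_at)
    then show "vec_rep \<A> d (\<lambda>q. from_chart \<A> c q b) x = ?F (snd c (chart_inv d x))"
      using q assms by (simp add: coord_change_eq)
  qed (use assms in auto)
  then show ?thesis
    using vec_rep_cong_fd[OF assms(2,4) frame(2)[OF assms(1,3)]] by (simp add: fd_eq[OF D])
qed

end

section \<open>Christoffel symbols of an anisotropic connection\<close>

context connection
begin

text \<open>The frames are taken at the base point of \<open>z\<close>, since each is controlled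
  only near its own base point; they therefore vary with \<open>z\<close>.\<close>

definition Gam :: "('m, 'e) chart \<Rightarrow> 'e \<times> 'e \<Rightarrow> 'e \<Rightarrow> 'e \<Rightarrow> 'e" where
  "Gam c z a b = (let p = chart_inv c (fst z) in
     to_chart \<A> c p (D (tchart_inv \<A> c z) (frame c p a) (frame c p b)))"

lemma Gam_tchart:
  "c \<in> \<A> \<Longrightarrow> fst v \<in> fst c \<Longrightarrow>
    Gam c (tchart c v) a b = to_chart \<A> c (fst v) (D v (frame c (fst v) a) (frame c (fst v) b))"
  by (simp add: Gam_def Let_def)

text \<open>Stated with sums over the basis because the bilinearity of \<open>Gam\<close> is not
  known yet: it follows from this formula applied to frames, in
  \<open>Gam_expansion\<close>.\<close>

lemma D_expansion:
  assumes c: "c \<in> \<A>" "fst v \<in> fst c" and v: "v \<in> A" and X: "smooth_vf \<A> X" and Y: "smooth_vf \<A> Y"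
  shows "to_chart \<A> c (fst v) (D v X Y) =
    fd (vec_rep \<A> c Y) (snd c (fst v)) (to_chart \<A> c (fst v) (X (fst v))) +
    (\<Sum>i\<in>Basis. (to_chart \<A> c (fst v) (Y (fst v)) \<bullet> i) *\<^sub>R
      (\<Sum>j\<in>Basis. (to_chart \<A> c (fst v) (X (fst v)) \<bullet> j) *\<^sub>R Gam c (tchart c v) j i))"
proof -
  define p where "p = fst v"
  have p: "p \<in> fst c" using c by (simp add: p_def)
  let ?T = "to_chart \<A> c p"
  let ?E = "frame c p"
  have E: "smooth_vf \<A> (?E i)" for i using frame[OF c(1) p] by blast
  note lin = linear_to_chart[OF c(1) p]
  have left: "D v X Z = (\<Sum>j\<in>Basis. (?T (X p) \<bullet> j) *\<^sub>R D v (?E j) Z)" if Z: "smooth_vf \<A> Z" for Z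
  proof -
    obtain h where h: "\<And>i. smooth_fun \<A> (h i)"
      "\<And>i. \<forall>\<^sub>F q in nhds p. h i q = vec_rep \<A> c X (snd c q) \<bullet> i"
      "\<forall>\<^sub>F q in nhds p. X q = (\<Sum>i\<in>Basis. h i q *\<^sub>R ?E i q)"
      using frame_expansion[OF c(1) p X] by blast
    have "D v X Z = D v (\<lambda>q. \<Sum>i\<in>Basis. h i q *\<^sub>R ?E i q) Z"
      using h E by (intro D_cong_left v X Z smooth_vf_sum smooth_vf_scaleR) (auto simp: p_def)
    also have "\<dots> = (\<Sum>i\<in>Basis. D v (\<lambda>q. h i q *\<^sub>R ?E i q) Z)"
      using h E by (intro D_sum_left v Z smooth_vf_scaleR) auto
    also have "\<dots> = (\<Sum>i\<in>Basis. (?T (X p) \<bullet> i) *\<^sub>R D v (?E i) Z)"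
      using D_scaleR_left[OF v E Z h(1)] eventually_eq_at[OF h(2)] c p by (simp add: p_def)
    finally show ?thesis .
  qed
  obtain h where h: "\<And>i. smooth_fun \<A> (h i)"
    "\<And>i. \<forall>\<^sub>F q in nhds p. h i q = vec_rep \<A> c Y (snd c q) \<bullet> i"
    "\<forall>\<^sub>F q in nhds p. Y q = (\<Sum>i\<in>Basis. h i q *\<^sub>R ?E i q)"
    using frame_expansion[OF c(1) p Y] by blast
  have dY: "(vec_rep \<A> c Y has_derivative fd (vec_rep \<A> c Y) (snd c p)) (at (snd c p))"
    by (rule smooth_on_has_derivative[OF smooth_vfD[OF Y c(1)]]) (use p in auto)
  have td: "tderiv \<A> p (X p) (h i) = fd (vec_rep \<A> c Y) (snd c p) (?T (X p)) \<bullet> i" for i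
  proof -
    have "((\<lambda>x. vec_rep \<A> c Y x \<bullet> i) has_derivative (\<lambda>a. fd (vec_rep \<A> c Y) (snd c p) a \<bullet> i)) (at (snd c p))"
      by (rule has_derivative_inner_left[OF dY])
    then have D: "((\<lambda>x. vec_rep \<A> c Y (snd c (chart_inv c x)) \<bullet> i) has_derivative
        (\<lambda>a. fd (vec_rep \<A> c Y) (snd c p) a \<bullet> i)) (at (snd c p))"
      by (rule has_derivative_transform_within_open[OF _ open_img[OF c(1)]]) (use c p in auto)
    then have "tderiv \<A> p (X p) (\<lambda>q. vec_rep \<A> c Y (snd c q) \<bullet> i) = fd (vec_rep \<A> c Y) (snd c p) (?T (X p)) \<bullet> i"
      using tderiv_chart[OF c(1) p, of "\<lambda>q. vec_rep \<A> c Y (snd c q) \<bullet> i" "X p"]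
      by (auto simp: fd_eq differentiable_def)
    then show ?thesis using tderiv_cong[OF h(2)] by simp
  qed
  have TE: "?T (D v X (?E i)) = (\<Sum>j\<in>Basis. (?T (X p) \<bullet> j) *\<^sub>R Gam c (tchart c v) j i)" for i
    unfolding left[OF E]
    using c by (simp only: linear_sum[OF lin] linear_cmul[OF lin] Gam_tchart[OF c] p_def[symmetric])
  have "D v X Y = D v X (\<lambda>q. \<Sum>i\<in>Basis. h i q *\<^sub>R ?E i q)"
    using h E by (intro D_cong_right v X Y smooth_vf_sum smooth_vf_scaleR) (auto simp: p_def)
  also have "\<dots> = (\<Sum>i\<in>Basis. D v X (\<lambda>q. h i q *\<^sub>R ?E i q))"
    using h E by (intro D_sum_right v X smooth_vf_scaleR) auto
  also have "\<dots> = (\<Sum>i\<in>Basis. tderiv \<A> p (X p) (h i) *\<^sub>R ?E i p + (?T (Y p) \<bullet> i) *\<^sub>R D v X (?E i))"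
    using D_leibniz[OF v X E h(1)] eventually_eq_at[OF h(2)] c p by (simp add: p_def)
  finally have "?T (D v X Y) = (\<Sum>i\<in>Basis. (fd (vec_rep \<A> c Y) (snd c p) (?T (X p)) \<bullet> i) *\<^sub>R i)
      + (\<Sum>i\<in>Basis. (?T (Y p) \<bullet> i) *\<^sub>R ?T (D v X (?E i)))"
    using c p by (simp add: linear_sum[OF lin] linear_add[OF lin] linear_cmul[OF lin] td sum.distrib)
  also have "(\<Sum>i\<in>Basis. (fd (vec_rep \<A> c Y) (snd c p) (?T (X p)) \<bullet> i) *\<^sub>R i) =
      fd (vec_rep \<A> c Y) (snd c p) (?T (X p))"
    by (rule euclidean_representation)
  finally show ?thesis by (simp only: TE) (simp add: p_def)
qed

lemma Gam_expansion:
  assumes "c \<in> \<A>" "z \<in> U c"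
  shows "Gam c z a b = (\<Sum>i\<in>Basis. (b \<bullet> i) *\<^sub>R (\<Sum>j\<in>Basis. (a \<bullet> j) *\<^sub>R Gam c z j i))"
proof -
  define v where "v = tchart_inv \<A> c z"
  have v: "v \<in> A" "fst v \<in> fst c" "tchart c v = z"
    using U_D[OF assms] by (simp_all add: v_def)
  show ?thesis
    using D_expansion[OF assms(1) v(2,1) frame(1)[OF assms(1) v(2)] frame(1)[OF assms(1) v(2)], of a b]
      Gam_tchart[OF assms(1) v(2), of a b] fd_vec_rep_frame[OF assms(1) v(2)] assms(1) v by simp
qed

lemma bilinear_Gam:
  assumes "c \<in> \<A>" "z \<in> U c"
  shows "bilinear (Gam c z)"
proof -
  have "bilinear (\<lambda>a b. \<Sum>i\<in>Basis. (b \<bullet> i) *\<^sub>R (\<Sum>j\<in>Basis. (a \<bullet> j) *\<^sub>R Gam c z j i))"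
    unfolding bilinear_def
    by (auto intro!: linearI simp: inner_add_left scaleR_add_left sum.distrib scaleR_add_right
        scaleR_sum_right distrib_left distrib_right mult.assoc mult.left_commute)
  moreover have "Gam c z = (\<lambda>a b. \<Sum>i\<in>Basis. (b \<bullet> i) *\<^sub>R (\<Sum>j\<in>Basis. (a \<bullet> j) *\<^sub>R Gam c z j i))"
    by (intro ext) (rule Gam_expansion[OF assms])
  ultimately show ?thesis by (rule ssubst[rotated])
qed

lemma D_formula:
  assumes c: "c \<in> \<A>" "fst v \<in> fst c" and v: "v \<in> A" and X: "smooth_vf \<A> X" and Y: "smooth_vf \<A> Y"
  shows "to_chart \<A> c (fst v) (D v X Y) =
    fd (vec_rep \<A> c Y) (snd c (fst v)) (to_chart \<A> c (fst v) (X (fst v))) +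
    Gam c (tchart c v) (to_chart \<A> c (fst v) (X (fst v))) (to_chart \<A> c (fst v) (Y (fst v)))"
  using D_expansion[OF assms] Gam_expansion[OF c(1) tchart_in_U[OF c(1) v c(2)]] by metis

text \<open>\<open>D_smooth\<close> concerns fixed fields, while the frames inside
  \<open>Gam\<close> change with the base point. Near a given point one pair of frames serves for
  all points: its components are constant there, so \<open>D_formula\<close> has no derivative
  term.\<close>

lemma smooth_Gam:
  assumes c: "c \<in> \<A>"
  shows "smooth_on (U c) (\<lambda>z. Gam c z a b)"
proof (rule smooth_on_local)
  fix z assume z: "z \<in> U c"
  define p where "p = chart_inv c (fst z)"
  have p: "p \<in> fst c" "snd c p = fst z"
    using U_D(1,3)[OF c z] snd_chart_inv[OF c] by (simp_all add: p_def)
  let ?X = "frame c p a" and ?Y = "frame c p b"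
  have sm: "smooth_vf \<A> ?X" "smooth_vf \<A> ?Y" using frame(1)[OF c p(1)] by auto
  have "\<forall>\<^sub>F q in nhds p. ?X q = from_chart \<A> c q a \<and> ?Y q = from_chart \<A> c q b"
    using frame(2)[OF c p(1)] by (intro eventually_conj) auto
  from eventually_chart[OF c p(1) this] obtain N where N: "open N" "p \<in> N" "N \<subseteq> fst c"
    "\<And>q. q \<in> N \<Longrightarrow> ?X q = from_chart \<A> c q a" "\<And>q. q \<in> N \<Longrightarrow> ?Y q = from_chart \<A> c q b"
    "open (snd c ` N)" by metis
  define T where "T = U c \<inter> fst -` (snd c ` N)"
  have T: "open T" unfolding T_def
    by (intro open_Int open_U c open_vimage N continuous_on_fst continuous_on_id)
  have zT: "z \<in> T" using z imageI[OF N(2), of "snd c"] p(2) by (simp add: T_def)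
  have "smooth_on T (\<lambda>z. to_chart \<A> c (chart_inv c (fst z)) (D (tchart_inv \<A> c z) ?X ?Y))"
  proof (rule smooth_on_subset)
    show "smooth_on (U c) (\<lambda>z. to_chart \<A> c (chart_inv c (fst z)) (D (tchart_inv \<A> c z) ?X ?Y))"
      using D_smooth[OF sm] c unfolding aniso_vf_def by blast
  qed (simp add: T_def)
  moreover have "to_chart \<A> c (chart_inv c (fst w)) (D (tchart_inv \<A> c w) ?X ?Y) = Gam c w a b" if w: "w \<in> T" for w
  proof -
    define v where "v = tchart_inv \<A> c w"
    have wU: "w \<in> U c" using w by (simp add: T_def)
    have v: "v \<in> A" "fst v \<in> fst c" "tchart c v = w" and fv: "fst v = chart_inv c (fst w)"
      using U_D[OF c wU] by (simp_all add: v_def)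
    have vN: "fst v \<in> N" using w N(3) c by (auto simp: T_def fv)
    have "fd (vec_rep \<A> c ?Y) (snd c (fst v)) = fd (\<lambda>x. b) (snd c (fst v))"
      by (rule fd_cong_open[OF N(6)]) (use vN N c in \<open>auto simp: subset_iff\<close>)
    then show ?thesis
      using D_formula[OF c v(2,1) sm] N(4,5)[OF vN] v c by (simp add: fv[symmetric] v_def[symmetric])
  qed
  ultimately have "smooth_on T (\<lambda>z. Gam c z a b)"
    using smooth_on_cong[OF T] by (metis (no_types, lifting))
  then show "\<exists>T. open T \<and> z \<in> T \<and> smooth_on T (\<lambda>z. Gam c z a b)" using T zT by blast
qed

text \<open>The covariant derivatives of the frames of \<open>c\<close>, read in \<open>d\<close>.
  This is what makes \<open>cov_along\<close>, computed in a chart that changes along the curve,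
  accessible in a fixed chart.\<close>

lemma Gam_transition:
  assumes "c \<in> \<A>" "d \<in> \<A>" "v \<in> A" "fst v \<in> fst c" "fst v \<in> fst d"
  shows "coord_change c d (fst v) (Gam c (tchart c v) a b) =
    fd (\<lambda>x. fd (\<lambda>x. snd d (chart_inv c x)) x b) (snd c (fst v)) a
    + Gam d (tchart d v) (coord_change c d (fst v) a) (coord_change c d (fst v) b)"
proof -
  let ?p = "fst v"
  have sm: "smooth_vf \<A> (frame c ?p a)" for a using frame(1) assms by blast
  have T: "to_chart \<A> d ?p (frame c ?p a ?p) = coord_change c d ?p a" for a
    using coord_change_to_chart[OF assms(1,2,4,5), of "frame c ?p a ?p"] assms by simp
  have "coord_change c d ?p (Gam c (tchart c v) a b) = to_chart \<A> d ?p (D v (frame c ?p a) (frame c ?p b))"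
    using assms by (simp add: Gam_tchart coord_change_to_chart)
  then show ?thesis
    using D_formula[OF assms(2,5,3) sm sm, of a b] assms
    by (simp add: T fd_vec_rep_frame_other coord_change_trans coord_change_same)
qed

end

locale torsion_free_connection = connection +
  assumes torsion: "torsion_free \<A> A D"
begin

text \<open>The bracket is defined in the preferred chart, where the frames of \<open>c\<close> need
  not have constant components. Their derivatives are second derivatives of the transition map, and
  the symmetry of these makes the bracket vanish.\<close>

lemma Gam_sym:
  assumes c: "c \<in> \<A>" "z \<in> U c"
  shows "Gam c z a b = Gam c z b a"
proof -
  define v where "v = tchart_inv \<A> c z"
  define p where "p = fst v"
  define d where "d = chart_at \<A> p"
  have v: "v \<in> A" "fst v \<in> fst c" "tchart c v = z" "p \<in> fst c"
    using U_D[OF assms] by (simp_all add: v_def p_def)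
  have d: "d \<in> \<A>" "p \<in> fst d" by (simp_all add: d_def chart_at)
  let ?X = "frame c p a" and ?Y = "frame c p b"
  have sm: "smooth_vf \<A> (frame c p a)" for a using frame(1) c(1) v by blast
  have cc: "coord_change d c p (frame c p a p) = a" for a
    using frame_at[OF c(1) v(4), of a] by (simp add: to_chart_def d_def)
  let ?\<phi> = "\<lambda>x. snd d (chart_inv c x)"
  have "lie_bracket \<A> ?X ?Y p = fd (\<lambda>x. fd ?\<phi> x b) (snd c p) a - fd (\<lambda>x. fd ?\<phi> x a) (snd c p) b"
    by (simp add: lie_bracket_def Let_def d_def[symmetric] fd_vec_rep_frame_other[OF c(1) d(1) v(4) d(2)] cc)
  also have "\<dots> = 0"
    using second_derivative_symmetric[OF open_overlap[OF c(1) d(1)] smooth_transition[OF c(1) d(1)],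
        where x = "snd c p" and a = b and b = a] d v(4) by simp
  finally have "D v ?X ?Y = D v ?Y ?X"
    using torsion v(1) sm unfolding torsion_free_def p_def[symmetric] by (metis p_def right_minus_eq)
  then show ?thesis
    using Gam_tchart[OF c(1) v(2)] v(3) by (simp add: p_def)
qed

text \<open>The chart independence of the bracket is read off from the connection: by
  torsion-freeness it is a difference of two covariant derivatives at any admissible vector over
  \<open>p\<close>, and the Christoffel terms cancel by symmetry.\<close>

lemma lie_bracket_chart:
  assumes c: "c \<in> \<A>" "p \<in> fst c" and X: "smooth_vf \<A> X" and Y: "smooth_vf \<A> Y"
  shows "to_chart \<A> c p (lie_bracket \<A> X Y p) =
    fd (vec_rep \<A> c Y) (snd c p) (to_chart \<A> c p (X p)) - fd (vec_rep \<A> c X) (snd c p) (to_chart \<A> c p (Y p))"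
proof -
  obtain v where v: "v \<in> A" "fst v = p" by (rule section_exists)
  have "lie_bracket \<A> X Y p = D v X Y - D v Y X"
    using torsion X Y v unfolding torsion_free_def by metis
  then show ?thesis
    using D_formula[OF c(1) _ v(1) X Y] D_formula[OF c(1) _ v(1) Y X] c v
      Gam_sym[OF c(1) tchart_in_U[OF c(1) v(1)], of "to_chart \<A> c p (X p)" "to_chart \<A> c p (Y p)"]
    by (simp add: linear_diff[OF linear_to_chart])
qed

lemma smooth_vf_lie_bracket:
  assumes X: "smooth_vf \<A> X" and Y: "smooth_vf \<A> Y"
  shows "smooth_vf \<A> (lie_bracket \<A> X Y)"
  unfolding smooth_vf_def
proof
  fix c assume c: "c \<in> \<A>"
  let ?O = "snd c ` fst c"
  have "smooth_on ?O (\<lambda>x. fd (vec_rep \<A> c X) x (vec_rep \<A> c Y x))" if "smooth_vf \<A> X" "smooth_vf \<A> Y" for X Y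
    by (rule smooth_on_linear_family[where f = "\<lambda>x. x" and U = ?O, OF open_img[OF c]])
      (use smooth_vfD[OF _ c] that in \<open>auto intro: smooth_on_linear_fd smooth_on_fd smooth_on_ident\<close>)
  then have "smooth_on ?O (\<lambda>x. fd (vec_rep \<A> c Y) x (vec_rep \<A> c X x) - fd (vec_rep \<A> c X) x (vec_rep \<A> c Y x))"
    using X Y by (intro smooth_on_diff open_img c) auto
  then show "smooth_on ?O (vec_rep \<A> c (lie_bracket \<A> X Y))"
    by (rule smooth_on_cong[OF open_img[OF c], THEN iffD2, rotated])
      (use c lie_bracket_chart[OF c _ X Y] in auto)
qed

lemma local_connection_chart: "c \<in> \<A> \<Longrightarrow> local_connection (U c) (Gam c)"
  by unfold_locales (auto intro: open_U smooth_Gam bilinear_Gam Gam_sym)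

end

section \<open>Coordinate expressions of the metric, the curvature and the vertical derivative\<close>

lemma has_derivative_fibre:
  assumes "(F has_derivative F') (at (x, y))"
  shows "((\<lambda>t. F (x, y + t *\<^sub>R a)) has_derivative (\<lambda>t. F' (0, t *\<^sub>R a))) (at (0::real))"
  by (rule has_derivative_compose[where f = "\<lambda>t. (x, y + t *\<^sub>R a)" and g = F])
    (use assms in \<open>auto intro!: derivative_eq_intros\<close>)

lemma has_vector_derivative_fibre:
  assumes "(F has_derivative F') (at (x, y))"
  shows "((\<lambda>t. F (x, y + t *\<^sub>R a)) has_vector_derivative F' (0, a)) (at (0::real))"
proof -
  have "F' (0, t *\<^sub>R a) = t *\<^sub>R F' (0, a)" for t
    using linear_cmul[OF has_derivative_linear[OF assms], of t "(0, a)"] by simp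
  then show ?thesis
    using has_derivative_fibre[OF assms, of a] by (simp add: has_vector_derivative_def)
qed

lemma has_real_derivative_fibre:
  fixes F :: "'a::real_normed_vector \<times> 'b::real_normed_vector \<Rightarrow> real"
  assumes "(F has_derivative F') (at (x, y))"
  shows "((\<lambda>t. F (x, y + t *\<^sub>R a)) has_real_derivative F' (0, a)) (at 0)"
  using has_vector_derivative_fibre[OF assms] by (simp add: has_real_derivative_iff_has_vector_derivative)

lemma open_fibre:
  fixes y :: "'b::real_normed_vector"
  shows "open U \<Longrightarrow> open {t::real. (x, y + t *\<^sub>R a) \<in> U}"
proof -
  assume "open U"
  moreover have "continuous_on UNIV (\<lambda>t::real. (x, y + t *\<^sub>R a))"
    by (intro continuous_intros)
  ultimately show ?thesis
    using open_vimage[of U "\<lambda>t. (x, y + t *\<^sub>R a)"] by (simp add: vimage_def)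
qed

context conic_manifold
begin

lemma tchart_inv_vadd:
  assumes "c \<in> \<A>" "v \<in> A" "fst v \<in> fst c"
  shows "vadd v h = tchart_inv \<A> c (snd c (fst v), to_chart \<A> c (fst v) (snd v) + to_chart \<A> c (fst v) h)"
  using assms by (simp add: vadd_def tchart_inv_def linear_add[OF linear_from_chart])

lemma vadd_in_A:
  assumes "c \<in> \<A>" "v \<in> A" "fst v \<in> fst c"
  shows "vadd v (t *\<^sub>R h) \<in> A \<longleftrightarrow>
    (snd c (fst v), to_chart \<A> c (fst v) (snd v) + t *\<^sub>R to_chart \<A> c (fst v) h) \<in> U c"
  using assms by (simp add: tchart_inv_vadd[OF assms] tset_rep_def linear_cmul[OF linear_to_chart])

lemma tchart_vadd:
  "c \<in> \<A> \<Longrightarrow> fst v \<in> fst c \<Longrightarrow> tchart c (vadd v (t *\<^sub>R h)) =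
    (snd c (fst v), to_chart \<A> c (fst v) (snd v) + t *\<^sub>R to_chart \<A> c (fst v) h)"
  by (simp add: tchart_def vadd_def linear_add[OF linear_to_chart] linear_cmul[OF linear_to_chart])

lemma admissible_open:
  assumes c: "c \<in> \<A>" and V: "smooth_vf \<A> V"
  shows "open {x \<in> snd c ` fst c. (x, vec_rep \<A> c V x) \<in> U c}"
proof -
  have "continuous_on (snd c ` fst c) (\<lambda>x. (x, vec_rep \<A> c V x))"
    by (intro continuous_intros smooth_on_continuous_on smooth_vfD V c)
  from continuous_open_preimage[OF this open_img[OF c] open_U[OF c]] show ?thesis
    by (simp add: vimage_def Int_def conj_commute)
qed

lemma tchart_section:
  "c \<in> \<A> \<Longrightarrow> q \<in> fst c \<Longrightarrow> tchart c (q, V q) = (snd c q, vec_rep \<A> c V (snd c q))"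
  by (simp add: tchart_def)

lemma section_in_A:
  assumes "c \<in> \<A>" "q \<in> fst c"
  shows "(q, V q) \<in> A \<longleftrightarrow> (snd c q, vec_rep \<A> c V (snd c q)) \<in> U c"
  using assms by (simp add: tset_rep_def tchart_inv_def)

end

locale finsler_manifold = conic_manifold \<A> A
  for \<A> :: "('m::{t2_space, second_countable_topology}, 'e::euclidean_space) atlas" and A +
  fixes L :: "'m \<times> 'e \<Rightarrow> real"
  assumes finsler: "pseudo_finsler \<A> A L"
begin

definition Lc :: "('m, 'e) chart \<Rightarrow> 'e \<times> 'e \<Rightarrow> real" where
  "Lc c z = L (tchart_inv \<A> c z)"

lemma smooth_Lc: "c \<in> \<A> \<Longrightarrow> smooth_on (U c) (Lc c)"
  using finsler unfolding pseudo_finsler_def aniso_fun_def Lc_def o_def by blast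

lemma fund_tensor_chart:
  assumes c: "c \<in> \<A>" and v: "v \<in> A" "fst v \<in> fst c"
  shows "fund_tensor L v u w =
    fibre_hessian (Lc c) (tchart c v) (to_chart \<A> c (fst v) u) (to_chart \<A> c (fst v) w)"
proof -
  define x where "x = snd c (fst v)"
  define y where "y = to_chart \<A> c (fst v) (snd v)"
  define a where "a = to_chart \<A> c (fst v) u"
  define b where "b = to_chart \<A> c (fst v) w"
  have z: "tchart c v = (x, y)" by (simp add: x_def y_def tchart_def)
  have zU: "(x, y) \<in> U c" using tchart_in_U[OF c v] z by simp
  have Lt: "L (vadd v (t *\<^sub>R u + s *\<^sub>R w)) = Lc c (x, y + t *\<^sub>R a + s *\<^sub>R b)" for t s
    using c v by (simp add: tchart_inv_vadd[OF c v] Lc_def x_def y_def a_def b_def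
        linear_add[OF linear_to_chart] linear_cmul[OF linear_to_chart] add.assoc)
  have inner: "deriv (\<lambda>s. L (vadd v (t *\<^sub>R u + s *\<^sub>R w))) 0 = fd (Lc c) (x, y + t *\<^sub>R a) (0, b)"
    if "(x, y + t *\<^sub>R a) \<in> U c" for t
    unfolding Lt
    by (rule DERIV_imp_deriv[OF has_real_derivative_fibre[OF smooth_on_has_derivative[OF smooth_Lc[OF c] that]]])
  have "((\<lambda>t. fd (Lc c) (x, y + t *\<^sub>R a) (0, b)) has_real_derivative
      fd (\<lambda>z. fd (Lc c) z (0, b)) (x, y) (0, a)) (at 0)"
    by (rule has_real_derivative_fibre[OF smooth_on_has_derivative[OF smooth_on_fd[OF smooth_Lc[OF c]] zU]])
  \<comment> \<open>The formula for the inner derivative holds only while the base of that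
    derivative is admissible, which is an open condition on \<open>t\<close>.\<close>
  then have "((\<lambda>t. deriv (\<lambda>s. L (vadd v (t *\<^sub>R u + s *\<^sub>R w))) 0) has_real_derivative
      fd (\<lambda>z. fd (Lc c) z (0, b)) (x, y) (0, a)) (at 0)"
    by (rule has_field_derivative_transform_within_open[OF _ open_fibre[OF open_U[OF c], of x y a]])
      (use zU inner in auto)
  then show ?thesis
    by (simp add: fund_tensor_def fibre_hessian_def DERIV_imp_deriv z a_def b_def)
qed

lemma local_finsler_chart:
  assumes c: "c \<in> \<A>"
  shows "local_finsler (U c) (Lc c)"
proof
  show "open (U c)" "smooth_on (U c) (Lc c)"
    using open_U[OF c] smooth_Lc[OF c] .
next
  fix x y :: 'e and r :: real
  assume z: "(x, y) \<in> U c" and r: "r > 0"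
  define v where "v = tchart_inv \<A> c (x, y)"
  have v: "v \<in> A" "fst v = chart_inv c x" "fst v \<in> fst c" "x \<in> snd c ` fst c"
    using U_D[OF c z] by (simp_all add: v_def)
  have eq: "tchart_inv \<A> c (x, r *\<^sub>R y) = (fst v, r *\<^sub>R snd v)"
    using v c by (simp add: v_def tchart_inv_def linear_cmul[OF linear_from_chart])
  show "(x, r *\<^sub>R y) \<in> U c"
    using conic v(1,4) r eq unfolding conic_domain_def tset_rep_def by simp
  show "Lc c (x, r *\<^sub>R y) = r\<^sup>2 * Lc c (x, y)"
    using finsler v(1) r unfolding pseudo_finsler_def Lc_def eq v_def[symmetric] by blast
next
  fix z u assume z: "z \<in> U c" and g: "\<And>w. fibre_hessian (Lc c) z u w = 0"
  define v where "v = tchart_inv \<A> c z"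
  have v: "v \<in> A" "fst v \<in> fst c" "tchart c v = z"
    using U_D[OF c z] by (simp_all add: v_def)
  have "fund_tensor L v (from_chart \<A> c (fst v) u) w = 0" for w
    using fund_tensor_chart[OF c v(1,2), of "from_chart \<A> c (fst v) u" w] g c v by simp
  then have "from_chart \<A> c (fst v) u = 0"
    using finsler v(1) unfolding pseudo_finsler_def by blast
  then show "u = 0"
    using to_from_chart[OF c v(2), of u] linear_0[OF linear_to_chart[OF c v(2)]] by simp
qed

end

locale finsler_connection = finsler_manifold \<A> A L + torsion_free_connection \<A> A D
  for \<A> :: "('m::{t2_space, second_countable_topology}, 'e::euclidean_space) atlas" and A L D
begin

text \<open>The derivatives of all chosen extensions cancel: those of \<open>W\<close> and
  \<open>K\<close> against the terms with \<open>D v X W\<close> and \<open>D v X K\<close>, that of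
  \<open>V\<close> against the vertical derivative in the direction \<open>D v X V\<close>. What
  remains of the latter pair is the derivative along the horizontal lift of
  \<open>u\<close>.\<close>

lemma cov_tensor2_chart:
  assumes c: "c \<in> \<A>" and v: "v \<in> A" "fst v \<in> fst c"
  defines "z \<equiv> tchart c v" and "T \<equiv> to_chart \<A> c (fst v)"
  shows "cov_tensor2 \<A> D (fund_tensor L) v u w k =
    fd (\<lambda>z. fibre_hessian (Lc c) z (T w) (T k)) z (T u, - Gam c z (T u) (snd z))
    - fibre_hessian (Lc c) z (Gam c z (T u) (T w)) (T k) - fibre_hessian (Lc c) z (T w) (Gam c z (T u) (T k))"
proof -
  interpret F: local_finsler "U c" "Lc c" by (rule local_finsler_chart[OF c])
  define p where "p = fst v"
  have p: "p \<in> fst c" using v by (simp add: p_def)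
  define V where "V = vec_ext \<A> p (snd v)"
  define X where "X = vec_ext \<A> p u"
  define W where "W = vec_ext \<A> p w"
  define K where "K = vec_ext \<A> p k"
  have sm: "smooth_vf \<A> V" "smooth_vf \<A> X" "smooth_vf \<A> W" "smooth_vf \<A> K"
    and at: "V p = snd v" "X p = u" "W p = w" "K p = k"
    by (simp_all add: V_def X_def W_def K_def vec_ext)
  have T: "T = to_chart \<A> c p" by (simp add: T_def p_def)
  have lin: "linear T" using linear_to_chart[OF c p] T by simp
  have zU: "z \<in> U c" unfolding z_def by (rule tchart_in_U[OF c v])
  have z: "z = (snd c p, T (snd v))" by (simp add: z_def tchart_def p_def T)
  have bil: "bilinear (F.g z)" by (rule F.bilinear_g[OF zU])
  define h where "h = (\<lambda>v'. fund_tensor L v' (W (fst v')) (K (fst v')))"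
  have rep: "(vec_rep \<A> c Z has_derivative fd (vec_rep \<A> c Z) (snd c p)) (at (snd c p))"
    if "smooth_vf \<A> Z" for Z
    by (rule smooth_on_has_derivative[OF smooth_vfD[OF that c]]) (use p in auto)
  have DT: "T (D v X Z) = fd (vec_rep \<A> c Z) (snd c p) (T u) + Gam c z (T u) (T (Z p))"
    if "smooth_vf \<A> Z" for Z
    using D_formula[OF c v(2,1) sm(2) that] by (simp add: p_def[symmetric] z_def T at)
  let ?dV = "fd (vec_rep \<A> c V) (snd c p) (T u)"
  let ?dW = "fd (vec_rep \<A> c W) (snd c p) (T u)"
  let ?dK = "fd (vec_rep \<A> c K) (snd c p) (T u)"
  have "((\<lambda>x. F.g (x, vec_rep \<A> c V x) (vec_rep \<A> c W x) (vec_rep \<A> c K x)) has_derivative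
      (\<lambda>a. F.dg (snd c p, vec_rep \<A> c V (snd c p)) (a, fd (vec_rep \<A> c V) (snd c p) a)
          (vec_rep \<A> c W (snd c p)) (vec_rep \<A> c K (snd c p))
        + F.g (snd c p, vec_rep \<A> c V (snd c p)) (fd (vec_rep \<A> c W) (snd c p) a) (vec_rep \<A> c K (snd c p))
        + F.g (snd c p, vec_rep \<A> c V (snd c p)) (vec_rep \<A> c W (snd c p)) (fd (vec_rep \<A> c K) (snd c p) a)))
      (at (snd c p))"
    by (rule F.g_has_derivative)
      (use zU z T c p at in \<open>auto intro!: has_derivative_Pair rep sm\<close>)
  then have Dg: "((\<lambda>x. F.g (x, vec_rep \<A> c V x) (vec_rep \<A> c W x) (vec_rep \<A> c K x)) has_derivative
      (\<lambda>a. F.dg z (a, fd (vec_rep \<A> c V) (snd c p) a) (T w) (T k)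
        + F.g z (fd (vec_rep \<A> c W) (snd c p) a) (T k) + F.g z (T w) (fd (vec_rep \<A> c K) (snd c p) a)))
      (at (snd c p))"
    using c p at by (simp add: z T)
  have "((\<lambda>x. h (chart_inv c x, V (chart_inv c x))) has_derivative
      (\<lambda>a. F.dg z (a, fd (vec_rep \<A> c V) (snd c p) a) (T w) (T k)
        + F.g z (fd (vec_rep \<A> c W) (snd c p) a) (T k) + F.g z (T w) (fd (vec_rep \<A> c K) (snd c p) a)))
      (at (snd c p))"
  proof (rule has_derivative_transform_within_open[OF Dg admissible_open[OF c sm(1)]])
    show "snd c p \<in> {x \<in> snd c ` fst c. (x, vec_rep \<A> c V x) \<in> U c}"
      using zU z T c p at by auto
    fix x assume "x \<in> {x \<in> snd c ` fst c. (x, vec_rep \<A> c V x) \<in> U c}"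
    then obtain q where q: "q \<in> fst c" "x = snd c q" "(snd c q, vec_rep \<A> c V (snd c q)) \<in> U c" by auto
    then have "(q, V q) \<in> A" using section_in_A[OF c] by blast
    then show "F.g (x, vec_rep \<A> c V x) (vec_rep \<A> c W x) (vec_rep \<A> c K x) = h (chart_inv c x, V (chart_inv c x))"
      using fund_tensor_chart[OF c, of "(q, V q)" "W q" "K q"] q(1,2) c
      by (simp add: h_def tchart_def)
  qed
  then have td: "tderiv \<A> p u (\<lambda>q. h (q, V q)) =
      F.dg z (T u, ?dV) (T w) (T k) + F.g z ?dW (T k) + F.g z (T w) ?dK"
    using tderiv_chart[OF c p, of "\<lambda>q. h (q, V q)" u] by (auto simp: fd_eq differentiable_def T)
  have vert: "vert_fun h v \<eta> = F.dg z (0, T \<eta>) (T w) (T k)" for \<eta>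
  proof -
    have "((\<lambda>t. F.g (snd c p, T (snd v) + t *\<^sub>R T \<eta>) (T w) (T k)) has_real_derivative
        F.dg z (0, T \<eta>) (T w) (T k)) (at 0)"
      using smooth_on_has_derivative[OF F.smooth_g zU] unfolding z by (rule has_real_derivative_fibre)
    then have "((\<lambda>t. h (vadd v (t *\<^sub>R \<eta>))) has_real_derivative F.dg z (0, T \<eta>) (T w) (T k)) (at 0)"
    proof (rule has_field_derivative_transform_within_open[OF _ open_fibre[OF open_U[OF c]]])
      show "0 \<in> {t. (snd c p, T (snd v) + t *\<^sub>R T \<eta>) \<in> U c}"
        using zU z by simp
      fix t assume "t \<in> {t. (snd c p, T (snd v) + t *\<^sub>R T \<eta>) \<in> U c}"
      then have "vadd v (t *\<^sub>R \<eta>) \<in> A"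
        using vadd_in_A[OF c v] by (simp add: p_def T)
      then show "F.g (snd c p, T (snd v) + t *\<^sub>R T \<eta>) (T w) (T k) = h (vadd v (t *\<^sub>R \<eta>))"
        using fund_tensor_chart[OF c, of "vadd v (t *\<^sub>R \<eta>)" w k] tchart_vadd[OF c v(2)] v at
        by (simp add: h_def p_def T) (simp add: vadd_def)
    qed
    then show ?thesis unfolding vert_fun_def by (rule DERIV_imp_deriv)
  qed
  have "cov_tensor2 \<A> D (fund_tensor L) v u w k =
      tderiv \<A> p u (\<lambda>q. h (q, V q)) - vert_fun h v (D v X V)
      - fund_tensor L v (D v X W) k - fund_tensor L v w (D v X K)"
    using at by (simp add: cov_tensor2_def cov_fun_def Let_def p_def[symmetric] V_def X_def W_def K_def h_def)
  also have "fund_tensor L v (D v X W) k = F.g z ?dW (T k) + F.g z (Gam c z (T u) (T w)) (T k)"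
    using fund_tensor_chart[OF c v, of "D v X W" k] DT[OF sm(3)] at
    by (simp add: z_def[symmetric] T_def[symmetric] bilinear_ladd[OF bil])
  also have "fund_tensor L v w (D v X K) = F.g z (T w) ?dK + F.g z (T w) (Gam c z (T u) (T k))"
    using fund_tensor_chart[OF c v, of w "D v X K"] DT[OF sm(4)] at
    by (simp add: z_def[symmetric] T_def[symmetric] bilinear_radd[OF bil])
  also have "vert_fun h v (D v X V) = F.dg z (0, ?dV + Gam c z (T u) (snd z)) (T w) (T k)"
    using DT[OF sm(1)] at by (simp add: vert z)
  finally have *: "cov_tensor2 \<A> D (fund_tensor L) v u w k =
      F.dg z (T u, ?dV) (T w) (T k) - F.dg z (0, ?dV + Gam c z (T u) (snd z)) (T w) (T k)
      - F.g z (Gam c z (T u) (T w)) (T k) - F.g z (T w) (Gam c z (T u) (T k))"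
    using td by simp
  have "F.dg z (T u, ?dV) (T w) (T k) - F.dg z (0, ?dV + Gam c z (T u) (snd z)) (T w) (T k) =
      F.dg z ((T u, ?dV) - (0, ?dV + Gam c z (T u) (snd z))) (T w) (T k)"
    using linear_diff[OF F.linear_dg[OF zU, of "T w" "T k"]] by metis
  then show ?thesis using * by simp
qed

lemma local_metric_chart:
  assumes c: "c \<in> \<A>"
    and Q: "\<And>v u w k. v \<in> A \<Longrightarrow> cov_tensor2 \<A> D (fund_tensor L) v u w k = Q v u w k"
    and Q1: "\<And>v w k. v \<in> A \<Longrightarrow> Q v (snd v) w k = 0"
    and Q3: "\<And>v u w. v \<in> A \<Longrightarrow> Q v u w (snd v) = 0"
  shows "local_metric_connection (U c) (Lc c) (Gam c)
    (\<lambda>z a b k. let p = chart_inv c (fst z) in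
      Q (tchart_inv \<A> c z) (from_chart \<A> c p a) (from_chart \<A> c p b) (from_chart \<A> c p k))"
proof (intro local_metric_connection.intro local_finsler_chart local_connection_chart c
    local_metric_connection_axioms.intro)
  fix z u w k assume z: "z \<in> U c"
  define v where "v = tchart_inv \<A> c z"
  have v: "v \<in> A" "fst v \<in> fst c" "tchart c v = z" and fv: "chart_inv c (fst z) = fst v"
    and y: "from_chart \<A> c (fst v) (snd z) = snd v"
    using U_D[OF c z] by (simp_all add: v_def tchart_inv_def)
  show "fd (\<lambda>z. fibre_hessian (Lc c) z w k) z (u, - Gam c z u (snd z)) =
      fibre_hessian (Lc c) z (Gam c z u w) k + fibre_hessian (Lc c) z w (Gam c z u k) +
      (let p = chart_inv c (fst z) in
        Q (tchart_inv \<A> c z) (from_chart \<A> c p u) (from_chart \<A> c p w) (from_chart \<A> c p k))"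
    using cov_tensor2_chart[OF c v(1,2), of "from_chart \<A> c (fst v) u" "from_chart \<A> c (fst v) w"
        "from_chart \<A> c (fst v) k"] Q[OF v(1)] c v
    by (simp add: fv v_def[symmetric])
  show "(let p = chart_inv c (fst z) in
      Q (tchart_inv \<A> c z) (from_chart \<A> c p (snd z)) (from_chart \<A> c p w) (from_chart \<A> c p k)) = 0"
    using Q1[OF v(1)] by (simp add: fv y v_def[symmetric])
  show "(let p = chart_inv c (fst z) in
      Q (tchart_inv \<A> c z) (from_chart \<A> c p u) (from_chart \<A> c p w) (from_chart \<A> c p (snd z))) = 0"
    using Q3[OF v(1)] by (simp add: fv y v_def[symmetric])
qed

end

context torsion_free_connection
begin

text \<open>In the preferred chart at \<open>fst v\<close> the components of a tangent vector at \<open>fst v\<close> are the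
  vector itself, so that no coordinate change appears below.\<close>

lemma D_formula_at:
  assumes v: "v \<in> A" and "smooth_vf \<A> X" "smooth_vf \<A> Y"
  defines "c \<equiv> chart_at \<A> (fst v)"
  shows "D v X Y = fd (vec_rep \<A> c Y) (snd c (fst v)) (X (fst v)) + Gam c (tchart c v) (X (fst v)) (Y (fst v))"
  using D_formula[OF chart_at v assms(2,3)] by (simp add: c_def)

text \<open>Along a fibre the first summand of \<open>D_formula_at\<close> is constant, so only the
  Christoffel symbols are differentiated.\<close>

lemma vertical_D_at:
  assumes v: "v \<in> A" and X: "smooth_vf \<A> X" and Y: "smooth_vf \<A> Y"
  defines "c \<equiv> chart_at \<A> (fst v)"
  shows "vector_derivative (\<lambda>t. D (vadd v (t *\<^sub>R h)) X Y) (at 0) =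
    fd (\<lambda>z. Gam c z (X (fst v)) (Y (fst v))) (tchart c v) (0, h)"
proof -
  let ?p = "fst v"
  have c: "c \<in> \<A>" "?p \<in> fst c" by (simp_all add: c_def chart_at)
  have T: "to_chart \<A> c ?p = (\<lambda>a. a)" by (simp add: c_def)
  have z: "tchart c v = (snd c ?p, snd v)" by (simp add: tchart_def T)
  have zU: "tchart c v \<in> U c" by (rule tchart_in_U[OF c(1) v c(2)])
  have "((\<lambda>t. Gam c (snd c ?p, snd v + t *\<^sub>R h) (X ?p) (Y ?p)) has_vector_derivative
      fd (\<lambda>z. Gam c z (X ?p) (Y ?p)) (tchart c v) (0, h)) (at 0)"
    using smooth_on_has_derivative[OF smooth_Gam[OF c(1)] zU] unfolding z by (rule has_vector_derivative_fibre)
  then have D: "((\<lambda>t. fd (vec_rep \<A> c Y) (snd c ?p) (X ?p) + Gam c (snd c ?p, snd v + t *\<^sub>R h) (X ?p) (Y ?p))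
      has_vector_derivative fd (\<lambda>z. Gam c z (X ?p) (Y ?p)) (tchart c v) (0, h)) (at 0)"
    using has_vector_derivative_add[OF has_vector_derivative_const] by fastforce
  have "((\<lambda>t. D (vadd v (t *\<^sub>R h)) X Y)
      has_vector_derivative fd (\<lambda>z. Gam c z (X ?p) (Y ?p)) (tchart c v) (0, h)) (at 0)"
  proof (rule has_vector_derivative_transform_within_open[OF D open_fibre[OF open_U[OF c(1)]]])
    show "0 \<in> {t. (snd c ?p, snd v + t *\<^sub>R h) \<in> U c}"
      using zU z by simp
    fix t assume "t \<in> {t. (snd c ?p, snd v + t *\<^sub>R h) \<in> U c}"
    then have "vadd v (t *\<^sub>R h) \<in> A"
      using vadd_in_A[OF c(1) v c(2)] by (simp add: T)
    moreover have "fst (vadd v (t *\<^sub>R h)) = ?p" by (simp add: vadd_def)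
    ultimately show "fd (vec_rep \<A> c Y) (snd c ?p) (X ?p) + Gam c (snd c ?p, snd v + t *\<^sub>R h) (X ?p) (Y ?p)
        = D (vadd v (t *\<^sub>R h)) X Y"
      using D_formula_at[OF _ X Y, of "vadd v (t *\<^sub>R h)"] tchart_vadd[OF c, of t h] by (simp add: c_def)
  qed
  then show ?thesis by (rule vector_derivative_at)
qed

lemma vert_conn_at:
  assumes "v \<in> A"
  defines "c \<equiv> chart_at \<A> (fst v)"
  shows "vert_conn \<A> D v x y h = fd (\<lambda>z. Gam c z x y) (tchart c v) (0, h)"
  using vertical_D_at[OF assms(1) vec_ext(1) vec_ext(1), of h "fst v" x "fst v" y]
  by (simp add: vert_conn_def Let_def vec_ext c_def)

text \<open>As in \<open>cov_tensor2_chart\<close>, the derivative of the extension \<open>V\<close>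
  cancels and leaves the horizontal lift of \<open>x\<close>. The derivatives of \<open>Y\<close>
  and \<open>Z\<close> survive; they disappear only in \<open>curvature_at\<close>.\<close>

lemma cov_vf_at:
  assumes v: "v \<in> A" and X: "smooth_vf \<A> X" and Y: "smooth_vf \<A> Y" and Z: "smooth_vf \<A> Z"
  defines "c \<equiv> chart_at \<A> (fst v)"
  defines "x0 \<equiv> snd c (fst v)" and "z \<equiv> tchart c v"
  defines "x \<equiv> X (fst v)" and "y \<equiv> Y (fst v)" and "k \<equiv> Z (fst v)"
  shows "cov_vf \<A> D X (\<lambda>v'. D v' Y Z) v =
    fd (\<lambda>\<xi>. fd (vec_rep \<A> c Z) \<xi> y) x0 x + fd (vec_rep \<A> c Z) x0 (fd (vec_rep \<A> c Y) x0 x)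
    + fd (\<lambda>z. Gam c z y k) z (x, - Gam c z x (snd z))
    + Gam c z (fd (vec_rep \<A> c Y) x0 x) k + Gam c z y (fd (vec_rep \<A> c Z) x0 x)
    + Gam c z x (fd (vec_rep \<A> c Z) x0 y) + Gam c z x (Gam c z y k)"
proof -
  define p where "p = fst v"
  have c: "c \<in> \<A>" "p \<in> fst c" by (simp_all add: c_def p_def chart_at)
  interpret C: local_connection "U c" "Gam c" by (rule local_connection_chart[OF c(1)])
  have cp: "chart_at \<A> p = c" by (simp add: c_def p_def)
  have T: "to_chart \<A> c p = (\<lambda>a. a)" by (simp add: c_def p_def)
  have zU: "z \<in> U c" unfolding z_def using tchart_in_U[OF c(1) v] c by (simp add: p_def)
  define V where "V = vec_ext \<A> p (snd v)"
  have V: "smooth_vf \<A> V" "V p = snd v" by (simp_all add: V_def vec_ext)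
  have z: "z = (x0, snd v)" by (simp add: z_def x0_def tchart_def p_def[symmetric] T)
  \<comment> \<open>The coordinates of the points where \<open>V\<close> is admissible. Only there
    is \<open>D\<close> at \<open>V\<close> controlled, which is why the field to be differentiated
    enters through \<open>germ_ext\<close>.\<close>
  define S where "S = {\<xi> \<in> snd c ` fst c. (\<xi>, vec_rep \<A> c V \<xi>) \<in> U c}"
  have S: "open S" unfolding S_def by (rule admissible_open[OF c(1) V(1)])
  have rep0: "vec_rep \<A> c R x0 = R p" for R
    using c by (simp add: x0_def p_def[symmetric] T)
  have x0: "x0 \<in> S" using zU z c rep0[of V] V(2) by (auto simp: S_def x0_def p_def)
  have sO: "smooth_on S (vec_rep \<A> c R)" if "smooth_vf \<A> R" for R
    by (rule smooth_on_subset[OF smooth_vfD[OF that c(1)]]) (auto simp: S_def)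
  define F where "F = (\<lambda>\<xi>. fd (vec_rep \<A> c Z) \<xi> (vec_rep \<A> c Y \<xi>)
      + Gam c (\<xi>, vec_rep \<A> c V \<xi>) (vec_rep \<A> c Y \<xi>) (vec_rep \<A> c Z \<xi>))"
  have sF: "smooth_on S F"
    unfolding F_def
  proof (intro smooth_on_add S)
    show "smooth_on S (\<lambda>\<xi>. fd (vec_rep \<A> c Z) \<xi> (vec_rep \<A> c Y \<xi>))"
      by (rule smooth_on_linear_family[where f = "\<lambda>x. x" and U = S and T = "fd (vec_rep \<A> c Z)", OF S])
        (use sO Y Z in \<open>auto intro: smooth_on_linear_fd smooth_on_fd smooth_on_ident\<close>)
    show "smooth_on S (\<lambda>\<xi>. Gam c (\<xi>, vec_rep \<A> c V \<xi>) (vec_rep \<A> c Y \<xi>) (vec_rep \<A> c Z \<xi>))"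
      by (rule smooth_on_bilinear_family[where f = "\<lambda>\<xi>. (\<xi>, vec_rep \<A> c V \<xi>)" and U = "U c" and T = "Gam c", OF S])
        (use sO V Y Z in \<open>auto intro: C.bilinear_\<Gamma> C.smooth_\<Gamma> smooth_on_ident
          intro!: smooth_on_Pair[OF S], simp add: S_def\<close>)
  qed
  have rep: "(vec_rep \<A> c R has_derivative fd (vec_rep \<A> c R) x0) (at x0)" if "smooth_vf \<A> R" for R
    by (rule smooth_on_has_derivative[OF sO[OF that] x0])
  have F': "(F has_derivative (\<lambda>a. (fd (\<lambda>\<xi>. fd (vec_rep \<A> c Z) \<xi> y) x0 a + fd (vec_rep \<A> c Z) x0 (fd (vec_rep \<A> c Y) x0 a))
      + (C.d\<Gamma> z (a, fd (vec_rep \<A> c V) x0 a) y k + Gam c z (fd (vec_rep \<A> c Y) x0 a) k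
        + Gam c z y (fd (vec_rep \<A> c Z) x0 a)))) (at x0)"
    unfolding F_def
  proof (rule has_derivative_add)
    have "((\<lambda>\<xi>. fd (vec_rep \<A> c Z) \<xi> (vec_rep \<A> c Y \<xi>)) has_derivative
        (\<lambda>a. fd (\<lambda>\<xi>. fd (vec_rep \<A> c Z) \<xi> (vec_rep \<A> c Y x0)) x0 a + fd (vec_rep \<A> c Z) x0 (fd (vec_rep \<A> c Y) x0 a))) (at x0)"
      by (rule has_derivative_linear_family[where f = "\<lambda>x. x" and T = "fd (vec_rep \<A> c Z)", OF S])
        (use x0 rep[OF Y] smooth_on_linear_fd[OF sO[OF Z]] smooth_on_differentiable[OF smooth_on_fd[OF sO[OF Z]] x0] in auto)
    then show "((\<lambda>\<xi>. fd (vec_rep \<A> c Z) \<xi> (vec_rep \<A> c Y \<xi>)) has_derivative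
        (\<lambda>a. fd (\<lambda>\<xi>. fd (vec_rep \<A> c Z) \<xi> y) x0 a + fd (vec_rep \<A> c Z) x0 (fd (vec_rep \<A> c Y) x0 a))) (at x0)"
      by (simp add: rep0 y_def p_def)
    have "((\<lambda>\<xi>. Gam c (\<xi>, vec_rep \<A> c V \<xi>) (vec_rep \<A> c Y \<xi>) (vec_rep \<A> c Z \<xi>)) has_derivative
      (\<lambda>a. C.d\<Gamma> (x0, vec_rep \<A> c V x0) (a, fd (vec_rep \<A> c V) x0 a) (vec_rep \<A> c Y x0) (vec_rep \<A> c Z x0)
        + Gam c (x0, vec_rep \<A> c V x0) (fd (vec_rep \<A> c Y) x0 a) (vec_rep \<A> c Z x0)
        + Gam c (x0, vec_rep \<A> c V x0) (vec_rep \<A> c Y x0) (fd (vec_rep \<A> c Z) x0 a))) (at x0)"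
      by (rule C.\<Gamma>_has_derivative[where f = "\<lambda>\<xi>. (\<xi>, vec_rep \<A> c V \<xi>)"])
        (use x0 rep V Y Z in \<open>auto simp: S_def intro!: has_derivative_Pair\<close>)
    then show "((\<lambda>\<xi>. Gam c (\<xi>, vec_rep \<A> c V \<xi>) (vec_rep \<A> c Y \<xi>) (vec_rep \<A> c Z \<xi>)) has_derivative
      (\<lambda>a. C.d\<Gamma> z (a, fd (vec_rep \<A> c V) x0 a) y k + Gam c z (fd (vec_rep \<A> c Y) x0 a) k
        + Gam c z y (fd (vec_rep \<A> c Z) x0 a))) (at x0)"
      by (simp add: rep0 z V(2)[unfolded p_def] y_def k_def p_def)
  qed
  define B where "B = (\<lambda>q. D (q, V q) Y Z)"
  define N where "N = fst c \<inter> snd c -` S"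
  have imgN: "snd c ` N = S"
    by (auto simp: N_def S_def)
  have N: "open N"
    unfolding N_def using chart_homeo[OF c(1)] open_fst[OF c(1)] S
    by (intro continuous_open_preimage) (auto simp: homeomorphism_def)
  have B: "vec_rep \<A> c B \<xi> = F \<xi>" if \<xi>: "\<xi> \<in> S" for \<xi>
  proof -
    obtain q where q: "q \<in> fst c" "\<xi> = snd c q" using \<xi> unfolding S_def by blast
    have "(q, V q) \<in> A" using \<xi> q section_in_A[OF c(1) q(1)] by (simp add: S_def)
    then show ?thesis
      using D_formula[OF c(1) _ _ Y Z, of "(q, V q)"] q c
      by (simp add: B_def F_def tchart_section)
  qed
  have "smooth_on (snd c ` N) (vec_rep \<A> c B)"
    unfolding imgN using smooth_on_cong[OF S, of "vec_rep \<A> c B" F] B sF by blast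
  moreover have pN: "p \<in> N" using x0 c by (simp add: N_def x0_def p_def)
  ultimately have G: "smooth_vf \<A> (germ_ext \<A> p B)" "\<forall>\<^sub>F q in nhds p. germ_ext \<A> p B q = B q"
    using germ_ext[OF c(1) N, of p B] by (auto simp: N_def)
  have dB: "fd (vec_rep \<A> c (germ_ext \<A> p B)) x0 = fd F x0"
    using vec_rep_cong_fd[OF c G(2)] fd_cong_open[OF S x0, of "vec_rep \<A> c B" F] B
    by (simp add: x0_def p_def)
  have Bp: "germ_ext \<A> p B p = fd (vec_rep \<A> c Z) x0 y + Gam c z y k"
    using eventually_eq_at[OF G(2)] B[OF x0] rep0[of B] rep0[of V] rep0[of Y] rep0[of Z] V(2)
    by (simp add: F_def z y_def k_def p_def)
  have DV: "D v X V = fd (vec_rep \<A> c V) x0 x + Gam c z x (snd z)"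
    using D_formula_at[OF v X V(1)] V(2)
    by (simp add: cp x0_def z_def x_def p_def[symmetric] T)
  have "cov_vf \<A> D X (\<lambda>v'. D v' Y Z) v =
      D v X (germ_ext \<A> p B) - vector_derivative (\<lambda>t. D (vadd v (t *\<^sub>R D v X V)) Y Z) (at 0)"
    by (simp add: cov_vf_def Let_def p_def[symmetric] V_def[symmetric] B_def vert_vf_def)
  also have "\<dots> = fd F x0 x + Gam c z x (fd (vec_rep \<A> c Z) x0 y + Gam c z y k)
      - C.d\<Gamma> z (0, fd (vec_rep \<A> c V) x0 x + Gam c z x (snd z)) y k"
    using D_formula_at[OF v X G(1)] vertical_D_at[OF v Y Z, of "D v X V"] dB Bp DV
    by (simp add: cp x0_def[folded p_def, symmetric] z_def[symmetric] x_def[folded p_def, symmetric]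
        y_def[folded p_def, symmetric] k_def[folded p_def, symmetric] p_def[symmetric])
  also have "fd F x0 x = (fd (\<lambda>\<xi>. fd (vec_rep \<A> c Z) \<xi> y) x0 x + fd (vec_rep \<A> c Z) x0 (fd (vec_rep \<A> c Y) x0 x))
      + (C.d\<Gamma> z (x, fd (vec_rep \<A> c V) x0 x) y k + Gam c z (fd (vec_rep \<A> c Y) x0 x) k
        + Gam c z y (fd (vec_rep \<A> c Z) x0 x))"
    by (simp add: fd_eq[OF F'])
  finally have *: "cov_vf \<A> D X (\<lambda>v'. D v' Y Z) v = \<dots> + Gam c z x (fd (vec_rep \<A> c Z) x0 y + Gam c z y k)
      - C.d\<Gamma> z (0, fd (vec_rep \<A> c V) x0 x + Gam c z x (snd z)) y k" .
  have split: "C.d\<Gamma> z (x, - Gam c z x (snd z)) y k = C.d\<Gamma> z (x, fd (vec_rep \<A> c V) x0 x) y k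
      - C.d\<Gamma> z (0, fd (vec_rep \<A> c V) x0 x + Gam c z x (snd z)) y k"
    using linear_diff[OF C.linear_d\<Gamma>[OF zU, of y k], of "(x, fd (vec_rep \<A> c V) x0 x)"
        "(0, fd (vec_rep \<A> c V) x0 x + Gam c z x (snd z))"] by simp
  show ?thesis
    unfolding split using * by (simp add: bilinear_radd[OF C.bilinear_\<Gamma>[OF zU]] algebra_simps)
qed

text \<open>Second derivatives of \<open>Z\<close> are symmetric, the two products of \<Gamma> with
  a first derivative of \<open>Z\<close> are exchanged by swapping \<open>x\<close> and
  \<open>y\<close>, and the derivatives of \<open>X\<close> and \<open>Y\<close> are absorbed by the
  bracket. All extensions thus drop out.\<close>

lemma curvature_at:
  assumes v: "v \<in> A"
  defines "c \<equiv> chart_at \<A> (fst v)"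
  shows "curvature \<A> D v x y k = local_curvature (Gam c) (tchart c v) x y k"
proof -
  define p where "p = fst v"
  define X where "X = vec_ext \<A> p x"
  define Y where "Y = vec_ext \<A> p y"
  define Z where "Z = vec_ext \<A> p k"
  have sm: "smooth_vf \<A> X" "smooth_vf \<A> Y" "smooth_vf \<A> Z" and at: "X p = x" "Y p = y" "Z p = k"
    by (simp_all add: X_def Y_def Z_def vec_ext)
  have c: "c \<in> \<A>" "p \<in> fst c" by (simp_all add: c_def p_def chart_at)
  interpret C: local_connection "U c" "Gam c" by (rule local_connection_chart[OF c(1)])
  have zU: "tchart c v \<in> U c" using tchart_in_U[OF c(1) v] c by (simp add: p_def)
  let ?x0 = "snd c p" and ?z = "tchart c v"
  let ?dX = "fd (vec_rep \<A> c X) ?x0" and ?dY = "fd (vec_rep \<A> c Y) ?x0" and ?dZ = "fd (vec_rep \<A> c Z) ?x0"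
  have cp: "chart_at \<A> p = c" by (simp add: c_def p_def)
  then have T: "to_chart \<A> c p = (\<lambda>a. a)" using to_chart_at[of p] by simp
  have lie: "lie_bracket \<A> X Y p = ?dY x - ?dX y"
    using at by (simp add: lie_bracket_def Let_def c_def p_def)
  have linZ: "linear ?dZ"
    by (rule smooth_on_linear_fd[OF smooth_vfD[OF sm(3) c(1)]]) (use c in auto)
  have "fd (\<lambda>\<xi>. fd (vec_rep \<A> c Z) \<xi> y) ?x0 x = fd (\<lambda>\<xi>. fd (vec_rep \<A> c Z) \<xi> x) ?x0 y"
    using second_derivative_symmetric[OF open_img[OF c(1)] smooth_vfD[OF sm(3) c(1)]] c by blast
  moreover have "curvature \<A> D v x y k = cov_vf \<A> D X (\<lambda>v'. D v' Y Z) v - cov_vf \<A> D Y (\<lambda>v'. D v' X Z) v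
      - D v (lie_bracket \<A> X Y) Z"
    by (simp add: curvature_def Let_def p_def[symmetric] X_def Y_def Z_def)
  ultimately show ?thesis
    using cov_vf_at[OF v sm(1,2,3)] cov_vf_at[OF v sm(2,1,3)]
      D_formula_at[OF v smooth_vf_lie_bracket[OF sm(1,2)] sm(3)]
    by (simp add: cp T p_def[symmetric] at lie local_curvature_def linear_diff[OF linZ]
        bilinear_lsub[OF C.bilinear_\<Gamma>[OF zU]] algebra_simps)
qed

end

section \<open>Curves and Jacobi fields\<close>

lemma smooth_on_has_vector_derivative:
  "smooth_on J f \<Longrightarrow> t \<in> J \<Longrightarrow> (f has_vector_derivative fd f t 1) (at t)" for f :: "real \<Rightarrow> 'a::real_normed_vector"
  using frechet_derivative_eq_vector_derivative smooth_on_differentiable vector_derivative_works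
  by (metis scaleR_one)

context manifold
begin

lemma smooth_into_open:
  assumes "open S" "smooth_into \<A> S f" "c \<in> \<A>"
  shows "open {x \<in> S. f x \<in> fst c}"
proof -
  have "open (S \<inter> f -` fst c)"
    using assms open_fst by (intro continuous_open_preimage) (auto simp: smooth_into_def)
  then show ?thesis by (simp add: vimage_def Int_def)
qed

lemma smooth_intoD: "smooth_into \<A> S f \<Longrightarrow> c \<in> \<A> \<Longrightarrow> smooth_on {x \<in> S. f x \<in> fst c} (\<lambda>x. snd c (f x))"
  by (simp add: smooth_into_def o_def)

lemma smooth_into_compose:
  fixes g :: "'a::real_normed_vector \<Rightarrow> 'b::euclidean_space"
  assumes "open T" "g ` T \<subseteq> S" "smooth_on T g" "smooth_into \<A> S f"
    and opn: "\<And>c. c \<in> \<A> \<Longrightarrow> open {x \<in> T. f (g x) \<in> fst c}"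
  shows "smooth_into \<A> T (\<lambda>x. f (g x))"
  unfolding smooth_into_def
proof (intro conjI ballI)
  show "continuous_on T (\<lambda>x. f (g x))"
    using assms by (auto simp: smooth_into_def intro: continuous_on_compose2 smooth_on_continuous_on)
  fix c assume c: "c \<in> \<A>"
  have "smooth_on {x \<in> T. f (g x) \<in> fst c} (\<lambda>x. snd c (f (g x)))"
    by (rule smooth_on_compose[OF opn[OF c] _ smooth_on_subset[OF assms(3)] smooth_intoD[OF assms(4) c]])
      (use assms(2) in auto)
  then show "smooth_on {x \<in> T. f (g x) \<in> fst c} (snd c \<circ> (\<lambda>x. f (g x)))"
    by (simp add: o_def)
qed

lemma velocity_chart:
  assumes I: "open I" "smooth_into \<A> I \<gamma>" "t \<in> I" and c: "c \<in> \<A>" "\<gamma> t \<in> fst c"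
  shows "to_chart \<A> c (\<gamma> t) (velocity \<A> \<gamma> t) = fd (\<lambda>s. snd c (\<gamma> s)) t 1"
proof -
  define d where "d = chart_at \<A> (\<gamma> t)"
  have d: "d \<in> \<A>" "\<gamma> t \<in> fst d" by (simp_all add: d_def chart_at)
  have dd: "((\<lambda>s. snd d (\<gamma> s)) has_vector_derivative fd (\<lambda>s. snd d (\<gamma> s)) t 1) (at t)"
    using smooth_on_has_vector_derivative[OF smooth_intoD[OF I(2) d(1)]] I(3) d(2) by blast
  have cd: "((\<lambda>s. snd c (\<gamma> s)) has_vector_derivative fd (\<lambda>s. snd c (\<gamma> s)) t 1) (at t)"
    using smooth_on_has_vector_derivative[OF smooth_intoD[OF I(2) c(1)]] I(3) c(2) by blast
  have lin: "linear (coord_change d c (\<gamma> t))" using linear_coord_change c d by blast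
  have "((\<lambda>s. snd c (chart_inv d (snd d (\<gamma> s)))) has_derivative
      (\<lambda>h. coord_change d c (\<gamma> t) (h *\<^sub>R fd (\<lambda>s. snd d (\<gamma> s)) t 1))) (at t)"
    by (rule has_derivative_compose[OF dd[unfolded has_vector_derivative_def] transition_has_derivative[OF d(1) c(1) d(2) c(2)]])
  then have "((\<lambda>s. snd c (chart_inv d (snd d (\<gamma> s)))) has_vector_derivative
      coord_change d c (\<gamma> t) (fd (\<lambda>s. snd d (\<gamma> s)) t 1)) (at t)"
    by (simp add: has_vector_derivative_def linear_cmul[OF lin])
  then have "((\<lambda>s. snd c (\<gamma> s)) has_vector_derivative
      coord_change d c (\<gamma> t) (fd (\<lambda>s. snd d (\<gamma> s)) t 1)) (at t)"
    by (rule has_vector_derivative_transform_within_open[OF _ smooth_into_open[OF I(1,2) d(1)]])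
      (use I(3) d in auto)
  then have "fd (\<lambda>s. snd c (\<gamma> s)) t 1 = coord_change d c (\<gamma> t) (fd (\<lambda>s. snd d (\<gamma> s)) t 1)"
    using cd vector_derivative_unique_at by blast
  moreover have "velocity \<A> \<gamma> t = fd (\<lambda>s. snd d (\<gamma> s)) t 1"
    using vector_derivative_at[OF dd] by (simp add: velocity_def d_def o_def)
  ultimately show ?thesis by (simp add: to_chart_def d_def)
qed

end

context torsion_free_connection
begin

lemma christoffel_at:
  assumes "v \<in> A"
  defines "c \<equiv> chart_at \<A> (fst v)"
  shows "christoffel \<A> D v a b = Gam c (tchart c v) a b"
proof -
  have "christoffel \<A> D v a b = D v (frame c (fst v) a) (frame c (fst v) b)"
    by (simp add: christoffel_def Let_def frame_def coord_field_def[abs_def] c_def)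
  then show ?thesis
    using Gam_tchart[OF chart_at] by (simp add: c_def)
qed

lemma christoffel_sum:
  assumes "v \<in> A"
  defines "c \<equiv> chart_at \<A> (fst v)"
  shows "(\<Sum>i\<in>Basis. \<Sum>j\<in>Basis. ((a \<bullet> i) * (b \<bullet> j)) *\<^sub>R christoffel \<A> D v i j) = Gam c (tchart c v) a b"
proof -
  have "Gam c (tchart c v) a b =
      (\<Sum>j\<in>Basis. \<Sum>i\<in>Basis. ((a \<bullet> i) * (b \<bullet> j)) *\<^sub>R Gam c (tchart c v) i j)"
    by (subst Gam_expansion)
      (simp_all add: c_def chart_at tchart_in_U assms(1) scaleR_sum_right mult.commute)
  also have "\<dots> = (\<Sum>i\<in>Basis. \<Sum>j\<in>Basis. ((a \<bullet> i) * (b \<bullet> j)) *\<^sub>R Gam c (tchart c v) i j)"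
    by (rule sum.swap)
  finally show ?thesis using christoffel_at[OF assms(1)] by (simp add: c_def)
qed

text \<open>\<open>cov_along\<close> is defined in the preferred chart at \<open>\<gamma> t\<close>,
  which changes with \<open>t\<close>; to differentiate it again, it is needed in one chart at all
  nearby times. The second derivative of the transition map produced by the components of
  \<open>X\<close> is cancelled by the one in \<open>Gam_transition\<close>.\<close>

lemma cov_along_chart:
  assumes I: "open I" "smooth_into \<A> I \<gamma>" "t \<in> I" and c: "c \<in> \<A>" "\<gamma> t \<in> fst c"
    and V: "(\<gamma> t, V t) \<in> A"
    and X: "((\<lambda>s. to_chart \<A> c (\<gamma> s) (X s)) has_vector_derivative X') (at t)"
  shows "to_chart \<A> c (\<gamma> t) (cov_along \<A> D \<gamma> V X t) =
    X' + Gam c (tchart c (\<gamma> t, V t)) (fd (\<lambda>s. snd c (\<gamma> s)) t 1) (to_chart \<A> c (\<gamma> t) (X t))"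
proof -
  define p where "p = \<gamma> t"
  define d where "d = chart_at \<A> p"
  have p: "p \<in> fst c" using c by (simp add: p_def)
  have d: "d \<in> \<A>" "p \<in> fst d" by (simp_all add: d_def chart_at)
  define \<phi> where "\<phi> = (\<lambda>x. snd d (chart_inv c x))"
  define x' where "x' = fd (\<lambda>s. snd c (\<gamma> s)) t 1"
  define Xc where "Xc = to_chart \<A> c p (X t)"
  let ?C = "coord_change c d p"
  have lin: "linear ?C" using linear_coord_change c d p by blast
  have \<phi>: "smooth_on (snd c ` (fst c \<inter> fst d)) \<phi>"
    unfolding \<phi>_def by (rule smooth_transition[OF c(1) d(1)])
  have x: "((\<lambda>s. snd c (\<gamma> s)) has_derivative (\<lambda>h. h *\<^sub>R x')) (at t)"
    using smooth_on_has_vector_derivative[OF smooth_intoD[OF I(2) c(1)]] I(3) c(2)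
    by (simp add: has_vector_derivative_def x'_def)
  have pin: "snd c p \<in> snd c ` (fst c \<inter> fst d)" using p d by blast
  have lin2: "linear (\<lambda>h. fd (\<lambda>x. fd \<phi> x Xc) (snd c p) h)"
    by (rule smooth_on_linear_fd[OF smooth_on_fd[OF \<phi>] pin])
  have "((\<lambda>s. fd \<phi> (snd c (\<gamma> s)) (to_chart \<A> c (\<gamma> s) (X s))) has_derivative
      (\<lambda>h. fd (\<lambda>x. fd \<phi> x (to_chart \<A> c (\<gamma> t) (X t))) (snd c (\<gamma> t)) (h *\<^sub>R x') + fd \<phi> (snd c (\<gamma> t)) (h *\<^sub>R X'))) (at t)"
    using smooth_on_linear_fd[OF \<phi>] smooth_on_differentiable[OF smooth_on_fd[OF \<phi>]] pin x X
    by (intro has_derivative_linear_family[where T = "fd \<phi>" and f = "\<lambda>s. snd c (\<gamma> s)", OF open_overlap[OF c(1) d(1)]])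
      (auto simp: p_def has_vector_derivative_def)
  then have "((\<lambda>s. fd \<phi> (snd c (\<gamma> s)) (to_chart \<A> c (\<gamma> s) (X s))) has_vector_derivative
      fd (\<lambda>x. fd \<phi> x Xc) (snd c p) x' + ?C X') (at t)"
    using linear_cmul[OF lin2] linear_cmul[OF lin]
    by (simp add: has_vector_derivative_def p_def Xc_def \<phi>_def coord_change_eq scaleR_add_right)
  then have "((\<lambda>s. to_chart \<A> d (\<gamma> s) (X s)) has_vector_derivative
      fd (\<lambda>x. fd \<phi> x Xc) (snd c p) x' + ?C X') (at t)"
  proof (rule has_vector_derivative_transform_within_open)
    show "open ({s \<in> I. \<gamma> s \<in> fst c} \<inter> {s \<in> I. \<gamma> s \<in> fst d})"
      using smooth_into_open[OF I(1,2)] c d by blast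
    show "t \<in> {s \<in> I. \<gamma> s \<in> fst c} \<inter> {s \<in> I. \<gamma> s \<in> fst d}"
      using I(3) p d by (simp add: p_def)
    fix s assume "s \<in> {s \<in> I. \<gamma> s \<in> fst c} \<inter> {s \<in> I. \<gamma> s \<in> fst d}"
    then show "fd \<phi> (snd c (\<gamma> s)) (to_chart \<A> c (\<gamma> s) (X s)) = to_chart \<A> d (\<gamma> s) (X s)"
      using coord_change_to_chart[OF c(1) d(1), of "\<gamma> s" "X s"] by (simp add: \<phi>_def coord_change_eq)
  qed
  then have "cov_along \<A> D \<gamma> V X t = fd (\<lambda>x. fd \<phi> x Xc) (snd c p) x' + ?C X'
      + Gam d (tchart d (p, V t)) (velocity \<A> \<gamma> t) (X t)"
    using christoffel_sum[OF V] by (simp add: cov_along_def vector_derivative_at d_def p_def)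
  moreover have "velocity \<A> \<gamma> t = ?C x'"
    using coord_change_to_chart[OF c(1) d(1) p d(2), of "velocity \<A> \<gamma> t"] velocity_chart[OF I c]
    by (simp add: d_def x'_def p_def)
  moreover have "X t = ?C Xc"
    using coord_change_to_chart[OF c(1) d(1) p d(2), of "X t"] by (simp add: d_def Xc_def)
  ultimately have "cov_along \<A> D \<gamma> V X t = ?C X' + ?C (Gam c (tchart c (p, V t)) x' Xc)"
    using Gam_transition[OF c(1) d(1), of "(p, V t)" x' Xc] V p d by (simp add: p_def \<phi>_def algebra_simps)
  then have "cov_along \<A> D \<gamma> V X t = ?C (X' + Gam c (tchart c (p, V t)) x' Xc)"
    by (simp add: linear_add[OF lin])
  then show ?thesis
    using c d p by (simp add: to_chart_def d_def[symmetric] p_def[symmetric] coord_change_trans coord_change_same x'_def Xc_def)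
qed

end

lemma fd_slice:
  fixes f :: "real \<times> real \<Rightarrow> 'a::real_normed_vector"
  assumes "(f has_derivative f') (at (s, t))"
  shows "((\<lambda>t. f (s, t)) has_vector_derivative f' (0, 1)) (at t)"
    "((\<lambda>s. f (s, t)) has_vector_derivative f' (1, 0)) (at s)"
proof -
  have 1: "((\<lambda>t. f (s, t)) has_derivative (\<lambda>h. f' (0, h))) (at t)"
    by (rule has_derivative_compose[where f = "\<lambda>t. (s, t)" and g = f])
      (use assms in \<open>auto intro!: derivative_eq_intros\<close>)
  have "f' (0, h) = h *\<^sub>R f' (0, 1)" for h
    using linear_cmul[OF has_derivative_linear[OF assms], of h "(0, 1)"] by simp
  then have "(\<lambda>h. f' (0, h)) = (\<lambda>h. h *\<^sub>R f' (0, 1))" by (rule ext)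
  with 1 show "((\<lambda>t. f (s, t)) has_vector_derivative f' (0, 1)) (at t)"
    by (simp only: has_vector_derivative_def)
  have 2: "((\<lambda>s. f (s, t)) has_derivative (\<lambda>h. f' (h, 0))) (at s)"
    by (rule has_derivative_compose[where f = "\<lambda>s. (s, t)" and g = f])
      (use assms in \<open>auto intro!: derivative_eq_intros\<close>)
  have "f' (h, 0) = h *\<^sub>R f' (1, 0)" for h
    using linear_cmul[OF has_derivative_linear[OF assms], of h "(1, 0)"] by simp
  then have "(\<lambda>h. f' (h, 0)) = (\<lambda>h. h *\<^sub>R f' (1, 0))" by (rule ext)
  with 2 show "((\<lambda>s. f (s, t)) has_vector_derivative f' (1, 0)) (at s)"
    by (simp only: has_vector_derivative_def)
qed

lemma fd_real_eq: "(f has_vector_derivative f') (at t) \<Longrightarrow> fd f t 1 = f'" for f :: "real \<Rightarrow> 'a::real_normed_vector"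
  by (simp add: has_vector_derivative_def fd_eq)

locale metric_connection = finsler_connection \<A> A L D
  for \<A> :: "('m::{t2_space, second_countable_topology}, 'e::euclidean_space) atlas" and A L D +
  fixes Q :: "'m \<times> 'e \<Rightarrow> 'e \<Rightarrow> 'e \<Rightarrow> 'e \<Rightarrow> real"
  assumes nabla_g: "v \<in> A \<Longrightarrow> cov_tensor2 \<A> D (fund_tensor L) v u w k = Q v u w k"
    and Q_left: "v \<in> A \<Longrightarrow> Q v (snd v) w k = 0"
    and Q_right: "v \<in> A \<Longrightarrow> Q v u w (snd v) = 0"
begin

definition Qc :: "('m, 'e) chart \<Rightarrow> 'e \<times> 'e \<Rightarrow> 'e \<Rightarrow> 'e \<Rightarrow> 'e \<Rightarrow> real" where
  "Qc c z a b k = (let p = chart_inv c (fst z) in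
    Q (tchart_inv \<A> c z) (from_chart \<A> c p a) (from_chart \<A> c p b) (from_chart \<A> c p k))"

lemma metric_chart: "c \<in> \<A> \<Longrightarrow> local_metric_connection (U c) (Lc c) (Gam c) (Qc c)"
  unfolding Qc_def[abs_def] by (rule local_metric_chart) (simp_all add: nabla_g Q_left Q_right)

lemma vert_conn_zero:
  assumes "v \<in> A"
  shows "vert_conn \<A> D v (snd v) (snd v) u = 0"
proof -
  interpret local_metric_connection "U (chart_at \<A> (fst v))" "Lc (chart_at \<A> (fst v))"
    "Gam (chart_at \<A> (fst v))" "Qc (chart_at \<A> (fst v))"
    by (rule metric_chart[OF chart_at(1)])
  show ?thesis
    using vertical_derivative_snd_snd[OF tchart_in_U[OF chart_at(1) assms chart_at(2)], of u]
    by (simp add: vert_conn_at[OF assms])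
qed

lemma g_vert_conn_zero:
  assumes "v \<in> A"
  shows "fund_tensor L v (vert_conn \<A> D v (snd v) u w) (snd v) = 0"
proof -
  interpret local_metric_connection "U (chart_at \<A> (fst v))" "Lc (chart_at \<A> (fst v))"
    "Gam (chart_at \<A> (fst v))" "Qc (chart_at \<A> (fst v))"
    by (rule metric_chart[OF chart_at(1)])
  have z: "tchart (chart_at \<A> (fst v)) v \<in> U (chart_at \<A> (fst v))"
    by (rule tchart_in_U[OF chart_at(1) assms chart_at(2)])
  show ?thesis
    using g_vertical_derivative_snd[OF z, where u = u and w = w]
      d\<Gamma>_sym[OF z, where a = u and b = "snd v" and \<zeta> = "(0, w)"]
    by (simp add: vert_conn_at[OF assms] fund_tensor_chart[OF chart_at(1) assms chart_at(2)])
qed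

text \<open>Read in a single chart around \<open>\<gamma> t0\<close>, the variation is a family of
  coordinate geodesics with variation field \<open>b\<close>, so that \<open>local_jacobi\<close>
  applies.\<close>

lemma jacobi_field_equation:
  assumes par: "auto_parallel \<A> A D I \<gamma>" and jac: "jacobi_field \<A> A D I \<gamma> J"
  shows "jacobi_equation \<A> D I \<gamma> J"
  unfolding jacobi_equation_def
proof
  fix t0 assume t0: "t0 \<in> I"
  obtain \<epsilon> \<sigma> where \<epsilon>: "\<epsilon> > 0" and \<sigma>: "smooth_into \<A> ({-\<epsilon><..<\<epsilon>} \<times> I) \<sigma>"
    and \<sigma>0: "\<And>t. t \<in> I \<Longrightarrow> \<sigma> (0, t) = \<gamma> t"
    and \<sigma>par: "\<And>s. s \<in> {-\<epsilon><..<\<epsilon>} \<Longrightarrow> auto_parallel \<A> A D I (\<lambda>t. \<sigma> (s, t))"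
    and J: "\<And>t. t \<in> I \<Longrightarrow> J t = velocity \<A> (\<lambda>s. \<sigma> (s, t)) 0"
    using jac unfolding jacobi_field_def by blast
  have I: "open I" and \<gamma>: "smooth_into \<A> I \<gamma>" and vA: "\<And>t. t \<in> I \<Longrightarrow> (\<gamma> t, velocity \<A> \<gamma> t) \<in> A"
    using par unfolding auto_parallel_def by blast+
  define c where "c = chart_at \<A> (\<gamma> t0)"
  have c: "c \<in> \<A>" "\<gamma> t0 \<in> fst c" by (simp_all add: c_def chart_at)
  interpret M: local_metric_connection "U c" "Lc c" "Gam c" "Qc c" by (rule metric_chart[OF c(1)])
  define W where "W = {w \<in> {-\<epsilon><..<\<epsilon>} \<times> I. \<sigma> w \<in> fst c}"
  define f where "f = (\<lambda>w. snd c (\<sigma> w))"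
  define y where "y = (\<lambda>w. fd f w (0, 1))"
  define b where "b = (\<lambda>w. fd f w (1, 0))"
  define DJ where "DJ = (\<lambda>w. fd b w (0, 1) + Gam c (f w, y w) (y w) (b w))"
  have W: "open W" unfolding W_def by (intro smooth_into_open open_Times I \<sigma> c) auto
  have f: "smooth_on W f" unfolding W_def f_def by (rule smooth_intoD[OF \<sigma> c(1)])
  have sy: "smooth_on W y" and sb: "smooth_on W b"
    unfolding y_def b_def by (rule smooth_on_fd[OF f])+
  have curve_s: "smooth_into \<A> {-\<epsilon><..<\<epsilon>} (\<lambda>s. \<sigma> (s, t))" if "t \<in> I" for t
  proof (rule smooth_into_compose[OF _ _ _ \<sigma>, where g = "\<lambda>s. (s, t)"])
    show "smooth_on {-\<epsilon><..<\<epsilon>} (\<lambda>s. (s, t))"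
      by (intro smooth_on_Pair smooth_on_ident smooth_on_const) auto
    fix d assume d: "d \<in> \<A>"
    have "continuous_on {-\<epsilon><..<\<epsilon>} (\<lambda>s. \<sigma> (s, t))"
      by (rule continuous_on_compose2[where g = \<sigma> and f = "\<lambda>s. (s, t)" and t = "{-\<epsilon><..<\<epsilon>} \<times> I"])
        (use \<sigma> that in \<open>auto simp: smooth_into_def intro!: continuous_intros\<close>)
    from continuous_open_preimage[OF this _ open_fst[OF d]]
    show "open {s \<in> {-\<epsilon><..<\<epsilon>}. \<sigma> (s, t) \<in> fst d}"
      by (simp add: vimage_def Int_def)
  qed (use that in auto)
  have curve_t: "smooth_into \<A> I (\<lambda>t. \<sigma> (s, t))"
    and vel_A: "\<And>t. t \<in> I \<Longrightarrow> (\<sigma> (s, t), velocity \<A> (\<lambda>t. \<sigma> (s, t)) t) \<in> A"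
    and geo: "\<And>t. t \<in> I \<Longrightarrow> cov_along \<A> D (\<lambda>t. \<sigma> (s, t)) (velocity \<A> (\<lambda>t. \<sigma> (s, t))) (velocity \<A> (\<lambda>t. \<sigma> (s, t))) t = 0"
    if "s \<in> {-\<epsilon><..<\<epsilon>}" for s
    using \<sigma>par[OF that] unfolding auto_parallel_def by blast+
  have ft: "fd (\<lambda>t. snd c (\<sigma> (s, t))) t 1 = y (s, t)" and fs: "fd (\<lambda>s. snd c (\<sigma> (s, t))) s 1 = b (s, t)"
    if "(s, t) \<in> W" for s t
    using fd_slice[OF smooth_on_has_derivative[OF f that]] by (auto simp: f_def y_def b_def fd_real_eq)
  have vel: "to_chart \<A> c (\<sigma> (s, t)) (velocity \<A> (\<lambda>t. \<sigma> (s, t)) t) = y (s, t)" if "(s, t) \<in> W" for s t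
    using velocity_chart[OF I curve_t _ c(1), of s t] ft[OF that] that by (auto simp: W_def)
  have inU: "(f w, y w) \<in> U c" if w: "w \<in> W" for w
  proof -
    obtain s t where st: "w = (s, t)" by fastforce
    have "tchart c (\<sigma> (s, t), velocity \<A> (\<lambda>t. \<sigma> (s, t)) t) \<in> U c"
      by (rule tchart_in_U[OF c(1) vel_A]) (use w st in \<open>auto simp: W_def\<close>)
    then show ?thesis using vel w by (simp add: tchart_def st f_def)
  qed
  have geodesic: "fd y w (0, 1) + Gam c (f w, y w) (y w) (y w) = 0" if w: "w \<in> W" for w
  proof -
    obtain s t where st: "w = (s, t)" by fastforce
    have s: "s \<in> {-\<epsilon><..<\<epsilon>}" and t: "t \<in> I" and p: "\<sigma> (s, t) \<in> fst c" and wW: "(s, t) \<in> W"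
      using w by (auto simp: W_def st)
    have "((\<lambda>t. y (s, t)) has_vector_derivative fd y (s, t) (0, 1)) (at t)"
      using fd_slice(1)[OF smooth_on_has_derivative[OF sy wW]] .
    then have "((\<lambda>t. to_chart \<A> c (\<sigma> (s, t)) (velocity \<A> (\<lambda>t. \<sigma> (s, t)) t)) has_vector_derivative fd y (s, t) (0, 1)) (at t)"
      by (rule has_vector_derivative_transform_within_open[OF _ smooth_into_open[OF I curve_t[OF s] c(1)]])
        (use s t p vel in \<open>auto simp: W_def\<close>)
    from cov_along_chart[where \<gamma> = "\<lambda>t. \<sigma> (s, t)" and V = "velocity \<A> (\<lambda>t. \<sigma> (s, t))"
        and X = "velocity \<A> (\<lambda>t. \<sigma> (s, t))", OF I curve_t[OF s] t c(1) p vel_A[OF s t] this]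
    show ?thesis
      using geo[OF s t] linear_0[OF linear_to_chart[OF c(1) p]] vel[OF wW] ft[OF wW]
      by (simp add: st tchart_def f_def)
  qed
  have T: "open {t \<in> I. \<gamma> t \<in> fst c}" by (rule smooth_into_open[OF I \<gamma> c(1)])
  have W0: "(0, t) \<in> W" if "t \<in> I" "\<gamma> t \<in> fst c" for t
    using that \<epsilon> \<sigma>0 by (simp add: W_def)
  have \<gamma>f: "fd (\<lambda>t. snd c (\<gamma> t)) t 1 = y (0, t)" if t: "t \<in> I" "\<gamma> t \<in> fst c" for t
  proof -
    \<comment> \<open>The curve and the central curve of the variation agree on \<open>I\<close>
      only; since \<open>I\<close> is open, this suffices for their derivatives.\<close>
    have "fd (\<lambda>t. snd c (\<gamma> t)) t = fd (\<lambda>t. snd c (\<sigma> (0, t))) t"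
      using I t(1) by (rule fd_cong_open) (simp add: \<sigma>0)
    then show ?thesis using ft[OF W0[OF t]] by simp
  qed
  have vel0: "to_chart \<A> c (\<gamma> t) (velocity \<A> \<gamma> t) = y (0, t)" if "t \<in> I" "\<gamma> t \<in> fst c" for t
    using velocity_chart[OF I \<gamma> that(1) c(1) that(2)] \<gamma>f[OF that] by simp
  have tch: "tchart c (\<gamma> t, velocity \<A> \<gamma> t) = (f (0, t), y (0, t))" if "t \<in> I" "\<gamma> t \<in> fst c" for t
    using vel0[OF that] \<sigma>0[OF that(1)] by (simp add: tchart_def f_def)
  have J0: "to_chart \<A> c (\<gamma> t) (J t) = b (0, t)" if t: "t \<in> I" "\<gamma> t \<in> fst c" for t
    using velocity_chart[OF _ curve_s[OF t(1)] _ c(1), of 0] fs[OF W0[OF t]] J[OF t(1)] \<sigma>0[OF t(1)] t \<epsilon>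
    by simp
  define E where "E = cov_along \<A> D \<gamma> (velocity \<A> \<gamma>) J"
  \<comment> \<open>Established for all times in the chart and not only at \<open>t0\<close>,
    because the first covariant derivative is differentiated again.\<close>
  have E0: "to_chart \<A> c (\<gamma> t) (E t) = DJ (0, t)" if t: "t \<in> I" "\<gamma> t \<in> fst c" for t
  proof -
    have "((\<lambda>t. b (0, t)) has_vector_derivative fd b (0, t) (0, 1)) (at t)"
      using fd_slice(1)[OF smooth_on_has_derivative[OF sb W0[OF t]]] .
    then have "((\<lambda>t. to_chart \<A> c (\<gamma> t) (J t)) has_vector_derivative fd b (0, t) (0, 1)) (at t)"
      by (rule has_vector_derivative_transform_within_open[OF _ T]) (use t J0 in auto)
    from cov_along_chart[where \<gamma> = \<gamma> and V = "velocity \<A> \<gamma>" and X = J, OF I \<gamma> t(1) c(1) t(2) vA[OF t(1)] this]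
    show ?thesis by (simp add: E_def DJ_def tch[OF t] \<gamma>f[OF t] J0[OF t])
  qed
  have sDJ: "smooth_on W DJ"
    unfolding DJ_def
  proof (intro smooth_on_add W smooth_on_fd sb)
    show "smooth_on W (\<lambda>w. Gam c (f w, y w) (y w) (b w))"
      by (rule smooth_on_bilinear_family[where f = "\<lambda>w. (f w, y w)" and T = "Gam c" and U = "U c", OF W])
        (use inU in \<open>auto intro: M.bilinear_\<Gamma> M.smooth_\<Gamma> smooth_on_Pair W f sy sb\<close>)
  qed
  have "((\<lambda>t. DJ (0, t)) has_vector_derivative fd DJ (0, t0) (0, 1)) (at t0)"
    using fd_slice(1)[OF smooth_on_has_derivative[OF sDJ W0[OF t0 c(2)]]] .
  then have "((\<lambda>t. to_chart \<A> c (\<gamma> t) (E t)) has_vector_derivative fd DJ (0, t0) (0, 1)) (at t0)"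
    by (rule has_vector_derivative_transform_within_open[OF _ T]) (use t0 c E0 in auto)
  from cov_along_chart[where \<gamma> = \<gamma> and V = "velocity \<A> \<gamma>" and X = E, OF I \<gamma> t0 c vA[OF t0] this]
  have 1: "cov_along2 \<A> D \<gamma> J t0 = fd DJ (0, t0) (0, 1) + Gam c (f (0, t0), y (0, t0)) (y (0, t0)) (DJ (0, t0))"
    by (simp add: cov_along2_def E_def[symmetric] tch[OF t0 c(2)] \<gamma>f[OF t0 c(2)] E0[OF t0 c(2)])
      (simp add: c_def)
  have "jacobi_operator \<A> D \<gamma> J t0 = local_curvature (Gam c) (f (0, t0), y (0, t0)) (y (0, t0)) (b (0, t0)) (y (0, t0))"
    using curvature_at[OF vA[OF t0]] tch[OF t0 c(2)] vel0[OF t0 c(2)] J0[OF t0 c(2)]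
    by (simp add: jacobi_operator_def c_def)
  moreover have "fd DJ (0, t0) (0, 1) + Gam c (f (0, t0), y (0, t0)) (y (0, t0)) (DJ (0, t0)) =
      local_curvature (Gam c) (f (0, t0), y (0, t0)) (y (0, t0)) (b (0, t0)) (y (0, t0))"
    using M.local_jacobi[OF W W0[OF t0 c(2)] f, folded y_def b_def] inU geodesic
    unfolding DJ_def y_def b_def by blast
  ultimately show "cov_along2 \<A> D \<gamma> J t0 = jacobi_operator \<A> D \<gamma> J t0"
    using 1 by simp
qed

end

section \<open>Comparison of two metric connections\<close>

locale metric_connection_pair =
  N: metric_connection \<A> A L D Q + N': metric_connection \<A> A L D' Q'
  for \<A> :: "('m::{t2_space, second_countable_topology}, 'e::euclidean_space) atlas" and A L D Q D' Q'
begin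

lemma pair_chart:
  "c \<in> \<A> \<Longrightarrow> local_metric_connection_pair (N.U c) (N.Lc c) (N.Gam c) (N.Qc c) (N'.Gam c) (N'.Qc c)"
  by (intro local_metric_connection_pair.intro N.metric_chart N'.metric_chart)

lemma tchart_at: "v \<in> A \<Longrightarrow> N.tchart (chart_at \<A> (fst v)) v \<in> N.U (chart_at \<A> (fst v))"
  by (rule N.tchart_in_U[OF N.chart_at(1) _ N.chart_at(2)])

lemma flag_quotient_agree:
  assumes "v \<in> A"
  shows "flag_quotient \<A> L D' v w = flag_quotient \<A> L D v w"
  using local_metric_connection_pair.g_local_curvature_agree[OF pair_chart[OF N.chart_at(1)] tchart_at[OF assms], of w]
  by (simp add: flag_quotient_def N.curvature_at[OF assms] N'.curvature_at[OF assms]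
      N.fund_tensor_chart[OF N.chart_at(1) assms N.chart_at(2)])

lemma jacobi_operator_agree:
  assumes "(\<gamma> t, velocity \<A> \<gamma> t) \<in> A"
  shows "jacobi_operator \<A> D' \<gamma> X t = jacobi_operator \<A> D \<gamma> X t"
  using local_metric_connection_pair.local_curvature_jacobi[OF pair_chart[OF N.chart_at(1)] tchart_at[OF assms], of "X t"]
  by (simp add: jacobi_operator_def N.curvature_at[OF assms] N'.curvature_at[OF assms])

text \<open>The velocity is both the reference vector and the first argument of \<Gamma>, so only
  \<Gamma>(y, .) enters.\<close>

lemma cov_along_agree:
  assumes "(\<gamma> t, velocity \<A> \<gamma> t) \<in> A"
  shows "cov_along \<A> D' \<gamma> (velocity \<A> \<gamma>) X t = cov_along \<A> D \<gamma> (velocity \<A> \<gamma>) X t"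
  using local_metric_connection_pair.\<Gamma>_snd_agree'[OF pair_chart[OF N.chart_at(1)] tchart_at[OF assms], of "X t"]
  by (simp add: cov_along_def N.christoffel_sum[OF assms] N'.christoffel_sum[OF assms])

lemma auto_parallel_agree: "auto_parallel \<A> A D' I \<gamma> \<longleftrightarrow> auto_parallel \<A> A D I \<gamma>"
  unfolding auto_parallel_def using cov_along_agree by metis

text \<open>The outer derivative depends on the inner covariant derivative near \<open>t\<close>;
  the two inner ones agree on the open set \<open>I\<close>.\<close>

lemma cov_along2_agree:
  assumes "open I" "t \<in> I" "\<And>t. t \<in> I \<Longrightarrow> (\<gamma> t, velocity \<A> \<gamma> t) \<in> A"
  shows "cov_along2 \<A> D' \<gamma> J t = cov_along2 \<A> D \<gamma> J t"
proof -
  let ?V = "velocity \<A> \<gamma>"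
  have "vector_derivative (\<lambda>s. to_chart \<A> d (\<gamma> s) (cov_along \<A> D' \<gamma> ?V J s)) (at t) =
      vector_derivative (\<lambda>s. to_chart \<A> d (\<gamma> s) (cov_along \<A> D \<gamma> ?V J s)) (at t)" for d
    by (rule vector_derivative_cong_eq)
      (use assms cov_along_agree in \<open>auto simp: eventually_nhds\<close>)
  then have "cov_along \<A> D' \<gamma> ?V (cov_along \<A> D' \<gamma> ?V J) t = cov_along \<A> D' \<gamma> ?V (cov_along \<A> D \<gamma> ?V J) t"
    using cov_along_agree[OF assms(3)[OF assms(2)], of J] by (simp add: cov_along_def)
  then show ?thesis
    using cov_along_agree[OF assms(3)[OF assms(2)]] by (simp add: cov_along2_def)
qed

end

theorem proposition3p6:
  fixes \<A> :: "('m::{t2_space, second_countable_topology}, 'e::euclidean_space) atlas"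
    and A :: "('m \<times> 'e) set"
    and L :: "'m \<times> 'e \<Rightarrow> real"
    and Q :: "'m \<times> 'e \<Rightarrow> 'e \<Rightarrow> 'e \<Rightarrow> 'e \<Rightarrow> real"
    and D Dh :: "('m, 'e) conn"
  assumes "smooth_atlas \<A>"
    and "conic_domain \<A> A"
    and "pseudo_finsler \<A> A L"
    and "levi_civita_chern \<A> A L D"
    and "aniso_tensor3 \<A> A Q"
    and "symmetric_tensor3 A Q"
    and "\<forall>v\<in>A. \<forall>u w. Q v (snd v) u w = 0"
    and "aniso_connection \<A> A Dh"
    and "torsion_free \<A> A Dh"
    and "\<forall>v\<in>A. \<forall>u w z. cov_tensor2 \<A> Dh (fund_tensor L) v u w z = Q v u w z"
  shows
    "(\<forall>v\<in>A. \<forall>w. flag_denom L v w \<noteq> 0 \<longrightarrow>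
        flag_curvature \<A> A L v w = flag_quotient \<A> L Dh v w \<and>
        flag_quotient \<A> L Dh v w = flag_quotient \<A> L D v w) \<and>
     (\<forall>I \<gamma>. auto_parallel \<A> A D I \<gamma> \<or> auto_parallel \<A> A Dh I \<gamma> \<longrightarrow>
        (\<forall>U. smooth_along \<A> I \<gamma> U \<longrightarrow>
           (\<forall>t\<in>I. jacobi_operator \<A> Dh \<gamma> U t = jacobi_operator \<A> D \<gamma> U t)) \<and>
        (\<forall>J. smooth_along \<A> I \<gamma> J \<longrightarrow>
           (\<forall>t\<in>I. cov_along2 \<A> Dh \<gamma> J t = cov_along2 \<A> D \<gamma> J t) \<and>
           (jacobi_equation \<A> Dh I \<gamma> J \<longleftrightarrow> jacobi_equation \<A> D I \<gamma> J)) \<and>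
        (\<forall>J. jacobi_field \<A> A Dh I \<gamma> J \<longrightarrow> jacobi_equation \<A> Dh I \<gamma> J) \<and>
        (\<forall>J. jacobi_field \<A> A D I \<gamma> J \<longrightarrow> jacobi_equation \<A> D I \<gamma> J)) \<and>
     (\<forall>v\<in>A. \<forall>u. vert_conn \<A> D v (snd v) (snd v) u = 0 \<and>
                vert_conn \<A> Dh v (snd v) (snd v) u = 0) \<and>
     (\<forall>v\<in>A. \<forall>u w. fund_tensor L v (vert_conn \<A> Dh v (snd v) u w) (snd v) = 0)"
proof -
  have metric: "metric_connection \<A> A L E T"
    if "aniso_connection \<A> A E" "torsion_free \<A> A E"
      "\<forall>v\<in>A. \<forall>u w z. cov_tensor2 \<A> E (fund_tensor L) v u w z = T v u w z"
      "\<And>v w k. v \<in> A \<Longrightarrow> T v (snd v) w k = 0" "\<And>v u w. v \<in> A \<Longrightarrow> T v u w (snd v) = 0" for E T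
    using that assms(1-3) by unfold_locales auto
  \<comment> \<open>Symmetry moves \<open>snd v\<close> from the first slot to the last.\<close>
  have Q: "Q v u w (snd v) = 0" if "v \<in> A" for v u w
    using assms(6,7) that unfolding symmetric_tensor3_def by metis
  \<comment> \<open>\<open>flag_curvature\<close> refers to a chosen Levi-Civita-Chern connection,
    which as a function may differ from \<open>D\<close>. Instead of proving uniqueness, both
    \<open>D0\<close> and \<open>D\<close> are compared with \<open>Dh\<close>.\<close>
  define D0 where "D0 = (SOME D. levi_civita_chern \<A> A L D)"
  have "levi_civita_chern \<A> A L D0"
    unfolding D0_def using assms(4) by (rule someI[where P = "levi_civita_chern \<A> A L"])
  then interpret N0: metric_connection \<A> A L D0 "\<lambda>_ _ _ _. 0"
    by (intro metric) (auto simp: levi_civita_chern_def)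
  interpret N: metric_connection \<A> A L D "\<lambda>_ _ _ _. 0"
    using assms(4) by (intro metric) (auto simp: levi_civita_chern_def)
  interpret N': metric_connection \<A> A L Dh Q
    using assms(7-10) Q by (intro metric) auto
  interpret P0: metric_connection_pair \<A> A L D0 "\<lambda>_ _ _ _. 0" Dh Q ..
  interpret P: metric_connection_pair \<A> A L D "\<lambda>_ _ _ _. 0" Dh Q ..
  have flag: "flag_curvature \<A> A L v w = flag_quotient \<A> L Dh v w \<and>
      flag_quotient \<A> L Dh v w = flag_quotient \<A> L D v w" if "v \<in> A" for v w
    using P0.flag_quotient_agree[OF that] P.flag_quotient_agree[OF that]
    by (simp add: flag_curvature_def D0_def)
  have curve: "(\<forall>X. smooth_along \<A> I \<gamma> X \<longrightarrow>
        (\<forall>t\<in>I. jacobi_operator \<A> Dh \<gamma> X t = jacobi_operator \<A> D \<gamma> X t)) \<and>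
      (\<forall>J. smooth_along \<A> I \<gamma> J \<longrightarrow> (\<forall>t\<in>I. cov_along2 \<A> Dh \<gamma> J t = cov_along2 \<A> D \<gamma> J t) \<and>
        (jacobi_equation \<A> Dh I \<gamma> J \<longleftrightarrow> jacobi_equation \<A> D I \<gamma> J)) \<and>
      (\<forall>J. jacobi_field \<A> A Dh I \<gamma> J \<longrightarrow> jacobi_equation \<A> Dh I \<gamma> J) \<and>
      (\<forall>J. jacobi_field \<A> A D I \<gamma> J \<longrightarrow> jacobi_equation \<A> D I \<gamma> J)"
    if "auto_parallel \<A> A D I \<gamma> \<or> auto_parallel \<A> A Dh I \<gamma>" for I \<gamma>
  proof -
    have par: "auto_parallel \<A> A D I \<gamma>" "auto_parallel \<A> A Dh I \<gamma>"
      using that P.auto_parallel_agree by auto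
    then have I: "open I" "\<And>t. t \<in> I \<Longrightarrow> (\<gamma> t, velocity \<A> \<gamma> t) \<in> A"
      unfolding auto_parallel_def by auto
    have op: "jacobi_operator \<A> Dh \<gamma> X t = jacobi_operator \<A> D \<gamma> X t" if "t \<in> I" for X t
      using P.jacobi_operator_agree[OF I(2)[OF that]] .
    have cov2: "cov_along2 \<A> Dh \<gamma> J t = cov_along2 \<A> D \<gamma> J t" if "t \<in> I" for J t
      using P.cov_along2_agree[OF I(1) that I(2)] .
    show ?thesis
      using op cov2 N.jacobi_field_equation[OF par(1)] N'.jacobi_field_equation[OF par(2)]
      by (simp add: jacobi_equation_def)
  qed
  show ?thesis
    by ((intro conjI; intro ballI allI impI), erule flag, erule curve,
        simp_all add: N.vert_conn_zero N'.vert_conn_zero N'.g_vert_conn_zero)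
qed

end
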